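(* Let $\Omega\subsetneq\mathbb{C}$ be a simply connected domain and let $1<p_0<2$, $p_0'=\frac{p_0}{p_0-1}$. Suppose there exists a biholomorphic mapping $\varphi:\mathbb{D}\to\Omega$ such that $$|\varphi'|^{(2-p)\left(\frac{p_0}{p(p_0-1)}\right)}\in A_2^+(\mathbb{D})\quad\text{for all } p_0<p<\tfrac{p_0}{p_0-1}.$$ If $p_0<p<\frac{p_0}{p_0-1}$ and $\omega$ is a weight on $\Omega$ with $\omega\circ\varphi\in A^+_{\frac{p}{p_0}}(\mathbb{D})\cap\mathrm{RH}_{\left(\frac{p_0'}{p}\right)'}(\mathbb{D})$, then the Bergman projection $\mathcal{B}$ of $\Omega$ is bounded on $L^p_\omega(\Omega)$. Moreover, $$\|\mathcal{B}\|_{L^p_\omega(\Omega)\to L^p_\omega(\Omega)}\le C\,C_p\left([\omega\circ\varphi]_{A^+_{\frac{p}{p_0}}}\cdot[\omega\circ\varphi]_{\mathrm{RH}_{\left(\frac{p_0'}{p}\right)'}}\cdot\left[|\varphi'|^{(2-p)\left(\frac{p_0}{p(p_0-1)}\right)}\right]_{A_2^+}^{\frac{p(p_0-1)}{p_0}}\right)^{\max\{1,\frac1{p-1}\}},$$ where $C_p=\max\{p,\frac1{p-1}\}$ and $C>0$ is a constant independent of $p$ and $\Omega$ (and of $\varphi$ and $\omega$).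
   Context: $\mathbb{D}$ is the open unit disc, $dA$ is (normalized) Lebesgue area measure in the plane, $D_r(z_0)=\{z\in\mathbb{C}:|z-z_0|<r\}$, and $|E|=A(E)$. For $1<q<\infty$, $q'=\frac q{q-1}$. The Bergman projection $\mathcal{B}$ of $\Omega$ is the orthogonal projection of $L^2(\Omega)$ onto the Bergman space $A^2(\Omega)$ of square-integrable holomorphic functions on $\Omega$. A weight is a locally integrable function that is positive almost everywhere; $\|f\|^p_{L^p_\omega(\Omega)}=\int_\Omega|f|^p\omega\,dA$. Boundedness of $\mathcal{B}$ on $L^p_\omega(\Omega)$ is understood by extension from $L^2\cap L^p_\omega$. For a weight $\omega$ on $\mathbb{D}$ and $1<p<\infty$, $\omega\in A_p^+(\mathbb{D})$ if $$[\omega]_{A_p^+}=\sup_{z\in\partial\mathbb{D},\,r>0}\left(\frac1{|D_r(z)\cap\mathbb{D}|}\int_{D_r(z)\cap\mathbb{D}}\omega\,dA\right)\left(\frac1{|D_r(z)\cap\mathbb{D}|}\int_{D_r(z)\cap\mathbb{D}}\omega^{-\frac1{p-1}}dA\right)^{p-1}<\infty,$$ and for $1<q<\infty$, $\omega\in\mathrm{RH}_q(\mathbb{D})$ if $$[\omega]_{\mathrm{RH}_q}=\sup_{z\in\partial\mathbb{D},\,r>0}\frac{\left(\frac1{|D_r(z)\cap\mathbb{D}|}\int_{D_r(z)\cap\mathbb{D}}\omega^q\,dA\right)^{1/q}}{\frac1{|D_r(z)\cap\mathbb{D}|}\int_{D_r(z)\cap\mathbb{D}}\omega\,dA}<\infty.$$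 *)

theory Defs
  imports "HOL-Complex_Analysis.Complex_Analysis"
begin

definition conj_exp :: "real \<Rightarrow> real" where
  "conj_exp q = q / (q - 1)"

(* Real powers on [0,\<infinity>]; only meant for exponents a > 0. *)
definition epowr :: "ennreal \<Rightarrow> real \<Rightarrow> ennreal" (infixr "epowr" 80) where
  "x epowr a = (if x = top then top else ennreal (enn2real x powr a))"

(* Lebesgue area measure, normalized so that the unit disc has measure 1. *)
definition area :: "complex measure" where
  "area = density lebesgue (\<lambda>_. ennreal (1 / pi))"

definition weight_on :: "complex set \<Rightarrow> (complex \<Rightarrow> real) \<Rightarrow> bool" where
  "weight_on \<Omega> w \<longleftrightarrow>
     (\<forall>K. compact K \<and> K \<subseteq> \<Omega> \<longrightarrow> set_integrable area K w) \<and>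
     (AE z in area. z \<in> \<Omega> \<longrightarrow> 0 < w z)"

definition Lp_norm :: "complex set \<Rightarrow> real \<Rightarrow> (complex \<Rightarrow> real) \<Rightarrow> (complex \<Rightarrow> complex) \<Rightarrow> ennreal" where
  "Lp_norm \<Omega> p w f = (\<integral>\<^sup>+z\<in>\<Omega>. ennreal (cmod (f z) powr p * w z) \<partial>area) epowr (1 / p)"

(* Elements are functions rather than classes modulo null sets; values off \<Omega> are irrelevant. *)
definition Lp_space :: "complex set \<Rightarrow> real \<Rightarrow> (complex \<Rightarrow> real) \<Rightarrow> (complex \<Rightarrow> complex) set" where
  "Lp_space \<Omega> p w = {f. f \<in> borel_measurable (lebesgue_on \<Omega>) \<and> Lp_norm \<Omega> p w f < top}"

abbreviation L2_space :: "complex set \<Rightarrow> (complex \<Rightarrow> complex) set" where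
  "L2_space \<Omega> \<equiv> Lp_space \<Omega> 2 (\<lambda>_. 1)"

definition bergman_space :: "complex set \<Rightarrow> (complex \<Rightarrow> complex) set" where
  "bergman_space \<Omega> = {g. g holomorphic_on \<Omega>} \<inter> L2_space \<Omega>"

(* The orthogonal projection of f: the element g of the Bergman space with f - g orthogonal
   to the Bergman space.  Such a g is determined on \<Omega>, being continuous there; we take
   the representative vanishing off \<Omega>.  Meaningful for f in L2_space \<Omega> only. *)
definition bergman_proj :: "complex set \<Rightarrow> (complex \<Rightarrow> complex) \<Rightarrow> complex \<Rightarrow> complex" where
  "bergman_proj \<Omega> f =
     (THE g. g \<in> bergman_space \<Omega> \<and> (\<forall>z. z \<notin> \<Omega> \<longrightarrow> g z = 0) \<and>
        (\<forall>h\<in>bergman_space \<Omega>. (LINT z:\<Omega>|area. (f z - g z) * cnj (h z)) = 0))"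

(* K bounds the Bergman projection on the dense subspace L2 \<inter> Lp(w) of Lp(w), from which
   the operator is extended; the extension has the same norm. *)
definition bergman_bound :: "complex set \<Rightarrow> real \<Rightarrow> (complex \<Rightarrow> real) \<Rightarrow> ennreal \<Rightarrow> bool" where
  "bergman_bound \<Omega> p w K \<longleftrightarrow>
     (\<forall>f \<in> L2_space \<Omega> \<inter> Lp_space \<Omega> p w.
        Lp_norm \<Omega> p w (bergman_proj \<Omega> f) \<le> K * Lp_norm \<Omega> p w f)"

definition bergman_bounded :: "complex set \<Rightarrow> real \<Rightarrow> (complex \<Rightarrow> real) \<Rightarrow> bool" where
  "bergman_bounded \<Omega> p w \<longleftrightarrow> (\<exists>K<top. bergman_bound \<Omega> p w K)"

definition bergman_opnorm :: "complex set \<Rightarrow> real \<Rightarrow> (complex \<Rightarrow> real) \<Rightarrow> ennreal" where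
  "bergman_opnorm \<Omega> p w = Inf {K. bergman_bound \<Omega> p w K}"

abbreviation unit_disc :: "complex set" ("\<bbbD>") where
  "\<bbbD> \<equiv> ball 0 1"

definition avg :: "complex set \<Rightarrow> (complex \<Rightarrow> real) \<Rightarrow> ennreal" where
  "avg E u = (\<integral>\<^sup>+z\<in>E. ennreal (u z) \<partial>area) / emeasure area E"

(* For a weight w both averages are nonzero, so the product never has the form 0 * \<infinity>. *)
definition Ap_const :: "real \<Rightarrow> (complex \<Rightarrow> real) \<Rightarrow> ennreal" where
  "Ap_const p w =
     (SUP z\<in>sphere 0 1. SUP r\<in>{0<..}.
        avg (ball z r \<inter> \<bbbD>) w *
        avg (ball z r \<inter> \<bbbD>) (\<lambda>x. w x powr (- 1 / (p - 1))) epowr (p - 1))"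

definition Ap_plus :: "real \<Rightarrow> (complex \<Rightarrow> real) set" where
  "Ap_plus p = {w. weight_on \<bbbD> w \<and> Ap_const p w < top}"

(* In ennreal the quotient \<infinity> / \<infinity> is 0, hence the explicit case
   for an infinite numerator, where the quotient has to count as infinite. *)
definition RH_quotient :: "real \<Rightarrow> (complex \<Rightarrow> real) \<Rightarrow> complex set \<Rightarrow> ennreal" where
  "RH_quotient q w E =
     (if avg E (\<lambda>x. w x powr q) = top then top
      else avg E (\<lambda>x. w x powr q) epowr (1 / q) / avg E w)"

definition RH_const :: "real \<Rightarrow> (complex \<Rightarrow> real) \<Rightarrow> ennreal" where
  "RH_const q w = (SUP z\<in>sphere 0 1. SUP r\<in>{0<..}. RH_quotient q w (ball z r \<inter> \<bbbD>))"

definition RH :: "real \<Rightarrow> (complex \<Rightarrow> real) set" where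
  "RH q = {w. weight_on \<bbbD> w \<and> RH_const q w < top}"

definition biholomorphic :: "(complex \<Rightarrow> complex) \<Rightarrow> complex set \<Rightarrow> complex set \<Rightarrow> bool" where
  "biholomorphic \<phi> U V \<longleftrightarrow>
     \<phi> holomorphic_on U \<and> \<phi> ` U = V \<and>
     (\<exists>\<psi>. \<psi> holomorphic_on V \<and> (\<forall>z\<in>U. \<psi> (\<phi> z) = z))"

definition deriv_weight :: "real \<Rightarrow> (complex \<Rightarrow> complex) \<Rightarrow> real \<Rightarrow> complex \<Rightarrow> real" where
  "deriv_weight p0 \<phi> p z = cmod (deriv \<phi> z) powr ((2 - p) * (p0 / (p * (p0 - 1))))"

end

theory Submission
  imports Defs
begin

text \<open>Conformal transplantation \<open>f \<mapsto> (f \<circ> \<phi>) \<cdot> \<phi>'\<close> turns the problem into a bound for the Bergman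
  projection of the disc on \<open>L\<^sup>p\<close> with the weight \<open>u = |\<phi>'|\<^sup>2\<^sup>-\<^sup>p \<cdot> (\<omega> \<circ> \<phi>)\<close>.  Hoelder's inequality on each
  boundary cap bounds the \<open>A\<^sub>p\<^sup>+\<close> constant of \<open>u\<close> by the product of the three constants in the claim.
  On the disc the Bergman kernel is dominated by the sum, over the Carleson boxes of two rotated dyadic
  grids, of \<open>1 / |Q|\<close> times the indicator of \<open>Q \<times> Q\<close>.  As the top halves of the boxes are disjoint and of
  comparable area, this sum is sparse, and its bilinear form has the sharp dependence on the \<open>A\<^sub>p\<^sup>+\<close>
  constant: Moen's pointwise computation reduces it to two weighted Carleson embeddings, which are proved
  by a Bellman function.  Boundedness on unweighted \<open>L\<^sup>2\<close> also identifies the integral operator with the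
  orthogonal projection.\<close>

section \<open>Sums over the dyadic tree\<close>

text \<open>The cap conditions control no small disc inside the unit disc, so averages may be taken
  only over sets reaching the circle; Carleson boxes do, and each lies in a cap of comparable area.
  With \<sigma> = p0'/p the transplanted weight is w^(1/\<sigma>) * v, where w is the weight of the
  A_2 hypothesis and v = \<omega> o \<phi>. The reverse Hoelder exponent is the conjugate of
  \<sigma>: Hoelder separates w from v, and the reverse Hoelder condition returns the resulting
  power mean of v to its mean. The top half of a box may carry a tiny share of its weighted mass, so
  sparseness for area does not pass to the weighted measures with the same constant. Moen's
  computation uses the A_p condition once per box and leaves the masses of the tops as coefficients;
  the embeddings accept them because the tops are disjoint. Absorbing a norm requires it to be
  finite, so the image function is truncated first. The final constant depends on p0 alone: p and
  its conjugate both stay between p0 and p0', where the remaining p-dependent factors are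
  bounded.\<close>

lemma powr_tangent:
  fixes p u t :: real
  assumes "p > 1" "u \<ge> 0" "t \<ge> 0"
  shows "p * t powr (p - 1) * u - (p - 1) * t powr p \<le> u powr p"
proof -
  have q: "p / (p - 1) > 1" "1 / p + 1 / (p / (p - 1)) = 1"
    using assms by (auto simp: field_simps)
  \<comment> \<open>The left side of the claim is the tangent line of \<open>u powr p\<close> at
    \<open>t\<close>; Young's inequality for \<open>u\<close> and \<open>t powr (p - 1)\<close> is
    the same bound divided by p.\<close>
  have "u * t powr (p - 1) \<le> u powr p / p + (t powr (p - 1)) powr (p / (p - 1)) / (p / (p - 1))"
    by (rule Youngs_inequality) (use assms q in auto)
  also have "(t powr (p - 1)) powr (p / (p - 1)) = t powr p"
    using assms by (simp add: powr_powr)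
  finally show ?thesis
    using assms by (simp add: field_simps)
qed

text \<open>The perspective \<open>x powr p / a powr (p - 1)\<close> is a supremum of functions
  linear in (x, a), one for each slope \<open>t\<close>. At the slope of the sum the linear function
  is exact on the left and a lower bound for each summand on the right.\<close>

lemma powr_perspective_superadd:
  fixes p x y a b :: real
  assumes "p > 1" "x \<ge> 0" "y \<ge> 0" "a > 0" "b > 0"
  shows "(x + y) powr p / (a + b) powr (p - 1) \<le> x powr p / a powr (p - 1) + y powr p / b powr (p - 1)"
proof -
  define t where "t = (x + y) / (a + b)"
  have t: "t \<ge> 0" "x + y = t * (a + b)" using assms by (auto simp: t_def)
  have tang: "p * t powr (p - 1) * x - (p - 1) * t powr p * a \<le> x powr p / a powr (p - 1)"
    if "x \<ge> 0" "a > 0" for x a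
  proof -
    have "a * (p * t powr (p - 1) * (x / a) - (p - 1) * t powr p) \<le> a * (x / a) powr p"
      using powr_tangent[of p "x / a" t] assms that t by (intro mult_left_mono) auto
    also have "a * (x / a) powr p = x powr p / a powr (p - 1)"
      using that by (simp add: powr_divide powr_diff)
    finally show ?thesis using that by (simp add: algebra_simps)
  qed
  have e: "t powr (p - 1) * t = t powr p"
    using t assms by (cases "t = 0") (auto simp: powr_diff)
  have "(x + y) powr p / (a + b) powr (p - 1) = t powr p * (a + b)"
    using assms t by (simp add: powr_mult powr_diff)
  also have "\<dots> = p * (t powr (p - 1) * t) * (a + b) - (p - 1) * t powr p * (a + b)"
    unfolding e by (simp add: algebra_simps)
  also have "\<dots> = p * t powr (p - 1) * (x + y) - (p - 1) * t powr p * (a + b)"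
    unfolding t(2) by (simp add: algebra_simps)
  also have "\<dots> = (p * t powr (p - 1) * x - (p - 1) * t powr p * a)
      + (p * t powr (p - 1) * y - (p - 1) * t powr p * b)" by (simp add: algebra_simps)
  also have "\<dots> \<le> x powr p / a powr (p - 1) + y powr p / b powr (p - 1)"
    using tang assms by (intro add_mono) auto
  finally show ?thesis .
qed

text \<open>A mean value bound for M^(1-p) on [B - e, B], where its slope is at least (p - 1) / B^p
  in absolute value; it is obtained from 1 - x \<le> exp (-x). \<open>B \<le> 2 * A\<close> trades B
  for A and is the origin of \<open>2 powr p\<close>. This is the gain of the Bellman function when
  \<open>e\<close> is added to its last variable.\<close>

lemma neg_powr_increment:
  fixes p e A B :: real
  assumes "p > 1" "0 < e" "e < B" "B \<le> 2 * A"
  shows "e / A powr p \<le> 2 powr p / (p - 1) * (1 / (B - e) powr (p - 1) - 1 / B powr (p - 1))"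
proof -
  have B: "B > 0" "A > 0" using assms by auto
  have "1 - e / B \<le> exp (- (e / B))" using exp_ge_add_one_self[of "- (e / B)"] by simp
  moreover have "0 < 1 - e / B" using assms B by auto
  ultimately have "(1 - e / B) powr (p - 1) \<le> exp (- (e / B)) powr (p - 1)"
    using assms by (intro powr_mono2) auto
  also have "\<dots> = exp (- ((p - 1) * (e / B)))"
    by (simp add: powr_def mult.commute)
  finally have le: "(1 - e / B) powr (p - 1) \<le> exp (- ((p - 1) * (e / B)))" .
  have "1 + (p - 1) * (e / B) \<le> exp ((p - 1) * (e / B))" by (rule exp_ge_add_one_self)
  also have "\<dots> = 1 / exp (- ((p - 1) * (e / B)))" by (simp add: exp_minus field_simps)
  also have "\<dots> \<le> 1 / (1 - e / B) powr (p - 1)"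
    using le \<open>0 < 1 - e / B\<close> by (intro divide_left_mono mult_pos_pos) (auto simp del: diff_gt_0_iff_gt)
  finally have *: "(p - 1) * (e / B) \<le> 1 / (1 - e / B) powr (p - 1) - 1" by simp
  have "B - e = B * (1 - e / B)" using B by (simp add: field_simps)
  then have "(B - e) powr (p - 1) = B powr (p - 1) * (1 - e / B) powr (p - 1)"
    using powr_mult[of B "1 - e / B" "p - 1"] B \<open>0 < 1 - e / B\<close> by simp
  then have "1 / (B - e) powr (p - 1) - 1 / B powr (p - 1)
     = (1 / B powr (p - 1)) * (1 / (1 - e / B) powr (p - 1) - 1)"
    using B by (simp add: field_simps)
  also have "\<dots> \<ge> (1 / B powr (p - 1)) * ((p - 1) * (e / B))"
    using * by (intro mult_left_mono) auto
  also have "(1 / B powr (p - 1)) * ((p - 1) * (e / B)) = (p - 1) * e / B powr p"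
    using B by (simp add: powr_diff)
  finally have "(p - 1) * e / B powr p \<le> 1 / (B - e) powr (p - 1) - 1 / B powr (p - 1)" .
  moreover have "(p - 1) * e / (2 * A) powr p \<le> (p - 1) * e / B powr p"
    using assms B by (intro divide_left_mono powr_mono2) auto
  ultimately have "(p - 1) * e / (2 * A) powr p \<le> 1 / (B - e) powr (p - 1) - 1 / B powr (p - 1)"
    by linarith
  then have "2 powr p / (p - 1) * ((p - 1) * e / (2 * A) powr p)
      \<le> 2 powr p / (p - 1) * (1 / (B - e) powr (p - 1) - 1 / B powr (p - 1))"
    using assms by (intro mult_left_mono) auto
  also have "2 powr p / (p - 1) * ((p - 1) * e / (2 * A) powr p) = e / A powr p"
    using assms B by (simp add: powr_mult)
  finally show ?thesis .
qed

text \<open>The children of node (k, j) are (k+1, 2j) and (k+1, 2j+1). The recursion from the root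
  fits the Bellman induction, where one step compares a node with its two children.\<close>

primrec tree_sum :: "(nat \<Rightarrow> nat \<Rightarrow> real) \<Rightarrow> nat \<Rightarrow> nat \<Rightarrow> nat \<Rightarrow> real" where
  "tree_sum g 0 k j = 0"
| "tree_sum g (Suc n) k j = g k j + tree_sum g n (Suc k) (2 * j) + tree_sum g n (Suc k) (Suc (2 * j))"

text \<open>The recursion removes the root, a sum by levels removes the lowest generation. The
  descendants of (k, j) after n steps are the 2^n indices from 2^n * j on, and those of its two
  children form consecutive blocks.\<close>

lemma tree_sum_Suc_bottom:
  "tree_sum g (Suc n) k j = tree_sum g n k j + (\<Sum>l<2 ^ n. g (k + n) (2 ^ n * j + l))"
proof (induction n arbitrary: k j)
  case (Suc n)
  have "tree_sum g (Suc (Suc n)) k j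
      = g k j + tree_sum g (Suc n) (Suc k) (2 * j) + tree_sum g (Suc n) (Suc k) (Suc (2 * j))"
    by (rule tree_sum.simps(2))
  also have "\<dots> = tree_sum g (Suc n) k j
      + ((\<Sum>l<2 ^ n. g (Suc (k + n)) (2 ^ n * (2 * j) + l))
      + (\<Sum>l<2 ^ n. g (Suc (k + n)) (2 ^ n * Suc (2 * j) + l)))"
    using Suc.IH[of "Suc k" "2 * j"] Suc.IH[of "Suc k" "Suc (2 * j)"] tree_sum.simps(2)[of g n k j]
    by (simp only: add_Suc add_Suc_right ac_simps)
  also have "(\<Sum>l<2 ^ n. g (Suc (k + n)) (2 ^ n * (2 * j) + l))
      + (\<Sum>l<2 ^ n. g (Suc (k + n)) (2 ^ n * Suc (2 * j) + l))
      = (\<Sum>l<2 ^ n + 2 ^ n. g (Suc (k + n)) (2 ^ Suc n * j + l))"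
    unfolding sum.nat_group[symmetric] lessThan_atLeast0
    using sum.atLeastLessThan_concat[of 0 "2^n" "2^n+2^n" "\<lambda>l. g (Suc (k + n)) (2 ^ Suc n * j + l)"]
      sum.shift_bounds_nat_ivl[of "\<lambda>l. g (Suc (k + n)) (2 ^ Suc n * j + l)" 0 "2^n" "2^n"]
    by (simp add: algebra_simps)
  finally show ?case by (simp add: mult_2)
qed simp

lemma tree_sum_eq: "tree_sum g n 0 0 = (\<Sum>k<n. \<Sum>j<2 ^ k. g k j)"
  by (induction n) (simp_all only: tree_sum_Suc_bottom, simp_all)

text \<open>The subtracted term is the Bellman function: \<open>(x, a) \<mapsto> x\<^sup>p / a\<^sup>p\<^sup>-\<^sup>1\<close> is subadditive, so it only has to
  pay for the root, which it does because adding \<open>e k j\<close> to \<open>M\<close> lowers it by a multiple of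
  \<open>e k j * (I k j / A k j)\<^sup>p\<close>.  Here \<open>M \<le> 2 * A\<close> keeps the multiple bounded below.\<close>

lemma tree_carleson_strong:
  fixes p :: real and A I F e IE FE :: "nat \<Rightarrow> nat \<Rightarrow> real"
  defines "M \<equiv> \<lambda>n k j. A k j + tree_sum e n k j"
  assumes p: "p > 1" and A: "\<And>k j. j < 2 ^ k \<Longrightarrow> A k j > 0" and e: "\<And>k j. j < 2 ^ k \<Longrightarrow> e k j > 0"
    and I: "\<And>k j. j < 2 ^ k \<Longrightarrow> I k j \<ge> 0" and IE: "\<And>k j. j < 2 ^ k \<Longrightarrow> IE k j \<ge> 0"
    and A_le: "\<And>k j. j < 2 ^ k \<Longrightarrow> A (Suc k) (2 * j) + A (Suc k) (Suc (2 * j)) + e k j \<le> A k j"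
    and I_le: "\<And>k j. j < 2 ^ k \<Longrightarrow> I k j \<le> I (Suc k) (2 * j) + I (Suc k) (Suc (2 * j)) + IE k j"
    and F_le: "\<And>k j. j < 2 ^ k \<Longrightarrow> F (Suc k) (2 * j) + F (Suc k) (Suc (2 * j)) + FE k j \<le> F k j"
    and IF: "\<And>k j. j < 2 ^ k \<Longrightarrow> I k j powr p / A k j powr (p - 1) \<le> F k j"
    and IFE: "\<And>k j. j < 2 ^ k \<Longrightarrow> IE k j powr p / e k j powr (p - 1) \<le> FE k j"
    and j: "j < 2 ^ k"
  shows "tree_sum (\<lambda>k j. e k j * (I k j / A k j) powr p) n k j
    \<le> 2 powr p / (p - 1) * (F k j - I k j powr p / M n k j powr (p - 1))"
    (is "?T n k j \<le> ?C * _")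
using j
proof (induction n arbitrary: k j)
  case 0
  show ?case using IF[OF 0] p by (simp add: M_def)
next
  case (Suc n)
  have child: "2 * j < 2 ^ Suc k" "Suc (2 * j) < 2 ^ Suc k" if "j < 2 ^ k" for k j :: nat
    using that by auto
  have ts_nonneg: "tree_sum e n k j \<ge> 0" if "j < 2 ^ k" for n k j
    using that by (induction n arbitrary: k j) (auto intro!: add_nonneg_nonneg simp: less_imp_le e)
  \<comment> \<open>Telescoping of \<open>A_le\<close>: the parts \<open>e\<close> of a subtree fit
    together into its root. Hence A \<le> M \<le> 2 A, the range in which the increment bound
    applies.\<close>
  have ts_le: "tree_sum e n k j \<le> A k j" if "j < 2 ^ k" for n k j
    using that
  proof (induction n arbitrary: k j)
    case 0 then show ?case using A[of j k] by simp
  next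
    case (Suc n) then show ?case
      using A_le[of j k] Suc.IH[of "2 * j" "Suc k"] Suc.IH[of "Suc (2 * j)" "Suc k"] child[of j k]
      unfolding tree_sum.simps by linarith
  qed
  have Mpos: "M n k j > 0" if "j < 2 ^ k" for n k j
    using A[OF that] ts_nonneg[OF that, of n] by (simp add: M_def)
  define B where "B = M (Suc n) k j"
  note j = Suc.prems and c = child[OF Suc.prems]
  let ?c1 = "2 * j" and ?c2 = "Suc (2 * j)"
  let ?pr = "\<lambda>x a. x powr p / a powr (p - 1)"
  have Cpos: "?C \<ge> 0" using p by simp
  have eB: "e k j < B"
    using A[OF j] ts_nonneg[OF c(1), of n] ts_nonneg[OF c(2), of n] by (simp add: B_def M_def)
  \<comment> \<open>\<open>B - e k j\<close> is \<open>A k j\<close> plus the tree sums of the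
    children, so by \<open>A_le\<close> it still has room for M of both children and for one more
    \<open>e k j\<close>, the denominator that goes with \<open>IE\<close>.\<close>
  have "?pr (I k j) (B - e k j)
      \<le> ?pr (I (Suc k) ?c1 + I (Suc k) ?c2 + IE k j) (M n (Suc k) ?c1 + M n (Suc k) ?c2 + e k j)"
    using I_le[OF j] A_le[OF j] eB I[OF j] p e[OF j] Mpos[OF c(1), of n] Mpos[OF c(2), of n]
    by (intro frac_le powr_mono2) (auto simp: B_def M_def)
  also have "\<dots> \<le> ?pr (I (Suc k) ?c1 + I (Suc k) ?c2) (M n (Suc k) ?c1 + M n (Suc k) ?c2)
       + ?pr (IE k j) (e k j)"
    by (intro powr_perspective_superadd p add_nonneg_nonneg I IE add_pos_pos Mpos e j c)
  also have "\<dots> \<le> ?pr (I (Suc k) ?c1) (M n (Suc k) ?c1) + ?pr (I (Suc k) ?c2) (M n (Suc k) ?c2)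
       + FE k j"
    by (intro add_mono powr_perspective_superadd p I Mpos IFE j c)
  finally have pr: "?pr (I k j) (B - e k j) \<le>
      ?pr (I (Suc k) ?c1) (M n (Suc k) ?c1) + ?pr (I (Suc k) ?c2) (M n (Suc k) ?c2) + FE k j" .
  \<comment> \<open>The term of the root is paid by moving the denominator from
    \<open>B - e k j\<close> to \<open>B\<close> while \<open>I k j\<close> stays fixed.\<close>
  have inc: "e k j * (I k j / A k j) powr p \<le> ?C * (?pr (I k j) (B - e k j) - ?pr (I k j) B)"
  proof -
    have "e k j / A k j powr p \<le> ?C * (1 / (B - e k j) powr (p - 1) - 1 / B powr (p - 1))"
      using eB p e[OF j] ts_le[OF j, of "Suc n"] by (intro neg_powr_increment) (auto simp: B_def M_def)
    then have "I k j powr p * (e k j / A k j powr p)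
        \<le> I k j powr p * (?C * (1 / (B - e k j) powr (p - 1) - 1 / B powr (p - 1)))"
      by (intro mult_left_mono) auto
    then show ?thesis
      using I[OF j] A[OF j] by (simp add: powr_divide algebra_simps)
  qed
  have "?T (Suc n) k j \<le> ?C * (?pr (I k j) (B - e k j) - ?pr (I k j) B)
    + ?C * (F (Suc k) ?c1 - ?pr (I (Suc k) ?c1) (M n (Suc k) ?c1))
    + ?C * (F (Suc k) ?c2 - ?pr (I (Suc k) ?c2) (M n (Suc k) ?c2))"
    unfolding tree_sum.simps by (intro add_mono inc Suc.IH c)
  also have "\<dots> = ?C * (?pr (I k j) (B - e k j) - ?pr (I k j) B + F (Suc k) ?c1 + F (Suc k) ?c2
      - ?pr (I (Suc k) ?c1) (M n (Suc k) ?c1) - ?pr (I (Suc k) ?c2) (M n (Suc k) ?c2))"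
    by (simp only: distrib_left right_diff_distrib)
  also have "\<dots> \<le> ?C * (F k j - ?pr (I k j) B)"
    using pr F_le[OF j] by (intro mult_left_mono Cpos) linarith
  finally show ?case by (simp add: B_def)
qed

text \<open>In the application A is the mass of the dual weight on a box, I the integral of f and F
  that of f^p times the weight; \<open>e\<close>, \<open>IE\<close>, \<open>FE\<close> are the same
  three over the top half. Then \<open>IF\<close> and \<open>IFE\<close> are Hoelder's
  inequality.\<close>

corollary tree_carleson:
  fixes p :: real and A I F e IE FE :: "nat \<Rightarrow> nat \<Rightarrow> real"
  assumes p: "p > 1" and A: "\<And>k j. j < 2 ^ k \<Longrightarrow> A k j > 0" and e: "\<And>k j. j < 2 ^ k \<Longrightarrow> e k j > 0"
    and I: "\<And>k j. j < 2 ^ k \<Longrightarrow> I k j \<ge> 0" and IE: "\<And>k j. j < 2 ^ k \<Longrightarrow> IE k j \<ge> 0"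
    and A_le: "\<And>k j. j < 2 ^ k \<Longrightarrow> A (Suc k) (2 * j) + A (Suc k) (Suc (2 * j)) + e k j \<le> A k j"
    and I_le: "\<And>k j. j < 2 ^ k \<Longrightarrow> I k j \<le> I (Suc k) (2 * j) + I (Suc k) (Suc (2 * j)) + IE k j"
    and F_le: "\<And>k j. j < 2 ^ k \<Longrightarrow> F (Suc k) (2 * j) + F (Suc k) (Suc (2 * j)) + FE k j \<le> F k j"
    and IF: "\<And>k j. j < 2 ^ k \<Longrightarrow> I k j powr p / A k j powr (p - 1) \<le> F k j"
    and IFE: "\<And>k j. j < 2 ^ k \<Longrightarrow> IE k j powr p / e k j powr (p - 1) \<le> FE k j"
  shows "(\<Sum>k<n. \<Sum>j<2 ^ k. e k j * (I k j / A k j) powr p) \<le> 2 powr p / (p - 1) * F 0 0"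
proof -
  let ?M = "A 0 0 + tree_sum e n 0 0"
  have "(\<Sum>k<n. \<Sum>j<2 ^ k. e k j * (I k j / A k j) powr p)
      \<le> 2 powr p / (p - 1) * (F 0 0 - I 0 0 powr p / ?M powr (p - 1))"
    using tree_carleson_strong[of p A e I IE F FE 0 0 n] assms by (simp add: tree_sum_eq)
  also have "\<dots> \<le> 2 powr p / (p - 1) * F 0 0"
    using p by (intro mult_left_mono) auto
  finally show ?thesis .
qed

section \<open>Hoelder's inequality for sums and the A_p condition on a single box\<close>

lemma Holder_sum_bound:
  fixes x y :: "'a \<Rightarrow> real"
  assumes pq: "p > 1" "q > 1" "1 / p + 1 / q = 1"
    and nn: "\<And>i. i \<in> S \<Longrightarrow> x i \<ge> 0" "\<And>i. i \<in> S \<Longrightarrow> y i \<ge> 0" and AB: "A > 0" "B > 0"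
    and le: "(\<Sum>i\<in>S. x i powr p) \<le> A" "(\<Sum>i\<in>S. y i powr q) \<le> B"
  shows "(\<Sum>i\<in>S. x i * y i) \<le> A powr (1 / p) * B powr (1 / q)"
proof -
  let ?a = "A powr (1 / p)" and ?b = "B powr (1 / q)"
  have ab: "?a > 0" "?b > 0" using AB by auto
  have "x i * y i \<le> ?a * ?b * (x i powr p / A / p + y i powr q / B / q)" if "i \<in> S" for i
  proof -
    have "(x i / ?a) * (y i / ?b) \<le> (x i / ?a) powr p / p + (y i / ?b) powr q / q"
      using nn that ab by (intro Youngs_inequality pq) auto
    also have "\<dots> = x i powr p / A / p + y i powr q / B / q"
      using nn that AB pq by (simp add: powr_divide powr_powr)
    finally show ?thesis using ab by (simp add: field_simps)
  qed
  then have "(\<Sum>i\<in>S. x i * y i) \<le> (\<Sum>i\<in>S. ?a * ?b * (x i powr p / A / p + y i powr q / B / q))"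
    by (rule sum_mono)
  also have "\<dots> = ?a * ?b * ((\<Sum>i\<in>S. x i powr p) / A / p + (\<Sum>i\<in>S. y i powr q) / B / q)"
    by (simp add: sum_distrib_left[symmetric] sum.distrib sum_divide_distrib)
  also have "\<dots> \<le> ?a * ?b * (1 / p + 1 / q)"
    using le AB pq ab by (intro mult_left_mono add_mono divide_right_mono) auto
  finally show ?thesis using pq by simp
qed

text \<open>Here w, s, a are the two weighted masses and the area of a box, and wE, sE, d those of
  its top half. One use of \<open>Ap\<close> leaves a^(p-1) * s^(2-p); for p \<ge> 2 the exponent of
  s is nonpositive, so s may be lowered to sE, while a is bounded through d by the masses of the
  top. The result is linear in X.\<close>

lemma Ap_sparse_ge2:
  fixes p :: real
  assumes p: "p \<ge> 2" and pos: "a > 0" "w > 0" "s > 0" "wE > 0" "sE > 0" "d > 0" "X > 0"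
    and Ap: "w * s powr (p - 1) \<le> X * a powr p"
    and sE: "sE \<le> s" and ad: "a \<le> 4 * d" and d: "d \<le> wE powr (1 / p) * sE powr (1 - 1 / p)"
  shows "w * s / a \<le> 4 powr (p - 1) * X * (sE powr (1 / p) * wE powr (1 - 1 / p))"
proof -
  have "w * s / a = w * s powr (p - 1) * s powr (2 - p) / a"
    using pos powr_add[of s "p - 1" "2 - p"] by simp
  also have "\<dots> \<le> X * a powr p * s powr (2 - p) / a"
    using Ap pos by (intro divide_right_mono mult_right_mono) auto
  also have "\<dots> = X * a powr (p - 1) * s powr (2 - p)"
    using pos by (simp add: powr_diff)
  also have "\<dots> \<le> X * (4 * (wE powr (1 / p) * sE powr (1 - 1 / p))) powr (p - 1) * sE powr (2 - p)"
    using pos p sE ad d by (intro mult_mono mult_nonneg_nonneg powr_mono2 powr_mono2') auto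
  also have "\<dots> = 4 powr (p - 1) * X * ((wE powr ((1 / p) * (p - 1)))
        * (sE powr ((1 - 1 / p) * (p - 1)) * sE powr (2 - p)))"
    by (simp add: powr_mult powr_powr)
  also have "(1 / p) * (p - 1) = 1 - 1 / p" using p by (simp add: field_simps)
  also have "sE powr ((1 - 1 / p) * (p - 1)) * sE powr (2 - p) = sE powr (1 / p)"
    using p pos by (simp add: powr_add[symmetric] field_simps)
  finally show ?thesis by (simp add: ac_simps)
qed

lemma conj_exponent_eq:
  fixes p q :: real
  assumes "p > 1" "1 / p + 1 / q = 1" shows "q = p / (p - 1)"
proof -
  have q1: "1 / q = 1 - 1 / p" using assms by simp
  have "q = 1 / (1 / q)" by simp
  also have "\<dots> = p / (p - 1)" unfolding q1 using assms by (simp add: field_simps)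
  finally show ?thesis .
qed

text \<open>For p < 2 the two weights and the exponents p and q exchange roles. The dual condition
  has constant X^(q-1) = X^(1/(p-1)), which is where the exponent \<open>max 1 (1 / (p - 1))\<close>
  comes from.\<close>

lemma Ap_sparse:
  fixes p q :: real
  assumes p: "p > 1" and q: "1 / p + 1 / q = 1"
    and pos: "a > 0" "w > 0" "s > 0" "wE > 0" "sE > 0" "d > 0" "X > 0"
    and Ap: "w * s powr (p - 1) \<le> X * a powr p"
    and le: "sE \<le> s" "wE \<le> w" "a \<le> 4 * d" and d: "d \<le> wE powr (1 / p) * sE powr (1 / q)"
  shows "w * s / a \<le> 4 powr (p + q) * X powr max 1 (1 / (p - 1)) * (sE powr (1 / p) * wE powr (1 / q))"
proof -
  have q1: "1 / q = 1 - 1 / p" using q by simp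
  have q2: "q = p / (p - 1)" by (rule conj_exponent_eq[OF p q])
  then have qgt: "q > 1" using p by simp
  show ?thesis
  proof (cases "p \<ge> 2")
    case True
    have "w * s / a \<le> 4 powr (p - 1) * X * (sE powr (1 / p) * wE powr (1 - 1 / p))"
      by (rule Ap_sparse_ge2) (use True pos Ap le d q1 in auto)
    also have "\<dots> \<le> 4 powr (p + q) * X powr max 1 (1 / (p - 1)) * (sE powr (1 / p) * wE powr (1 / q))"
      using True pos qgt by (intro mult_mono) (auto simp: q1 max_def)
    finally show ?thesis .
  next
    case False
    have q': "q \<ge> 2" unfolding q2 using False p by (simp add: pos_le_divide_eq)
    have "s * w powr (q - 1) = (w * s powr (p - 1)) powr (q - 1)"
      using p pos by (simp add: powr_mult powr_powr q2 field_simps)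
    also have "\<dots> \<le> (X * a powr p) powr (q - 1)"
      using Ap pos qgt by (intro powr_mono2) auto
    also have "\<dots> = X powr (q - 1) * a powr q"
      using p pos by (simp add: powr_mult powr_powr q2 field_simps)
    finally have Ap': "s * w powr (q - 1) \<le> X powr (q - 1) * a powr q" .
    have "s * w / a \<le> 4 powr (q - 1) * X powr (q - 1) * (wE powr (1 / q) * sE powr (1 - 1 / q))"
      by (rule Ap_sparse_ge2) (use q' pos Ap' le d q1 in \<open>auto simp: mult.commute\<close>)
    also have "\<dots> \<le> 4 powr (p + q) * X powr max 1 (1 / (p - 1)) * (wE powr (1 / q) * sE powr (1 - 1 / q))"
    proof -
      have "q - 1 = max 1 (1 / (p - 1))"
        using False p by (simp add: q2 max_def field_simps)
      then show ?thesis using p pos by (intro mult_mono) auto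
    qed
    finally show ?thesis by (simp add: q1 mult.commute)
  qed
qed

section \<open>Holomorphic change of variables\<close>

text \<open>The formula for the measure of a differentiable image involves determinants of matrices;
  these two maps move it between the complex plane and \<open>real^2\<close>.\<close>

definition vec2 :: "complex \<Rightarrow> real^2" where "vec2 z = (\<chi> i. if i = 1 then Re z else Im z)"
definition complex_of_vec2 :: "real^2 \<Rightarrow> complex" where "complex_of_vec2 v = Complex (v $ 1) (v $ 2)"

lemma vec2_inverse [simp]: "complex_of_vec2 (vec2 z) = z" "vec2 (complex_of_vec2 v) = v"
  by (auto simp: vec2_def complex_of_vec2_def vec_eq_iff forall_2)

lemma linear_vec2: "linear vec2" "linear complex_of_vec2"
  by (auto simp: linear_iff vec2_def complex_of_vec2_def vec_eq_iff complex_eq_iff)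

lemma borel_measurable_vec2 [measurable]:
  "vec2 \<in> borel_measurable borel" "complex_of_vec2 \<in> borel_measurable borel"
  using linear_vec2 by (auto intro!: borel_measurable_continuous_onI linear_continuous_on
      simp: linear_conv_bounded_linear)

lemma lborel_vec2: "lborel = distr lborel borel vec2"
proof (rule lborel_eqI)
  fix l u :: "real^2"
  assume le: "\<And>b. b \<in> Basis \<Longrightarrow> l \<bullet> b \<le> u \<bullet> b"
  have Basis2: "(Basis :: (real^2) set) = {axis 1 1, axis 2 1}"
    by (auto simp: Basis_vec_def UNIV_2)
  have ne: "axis 1 1 \<noteq> (axis 2 1 :: real^2)" by (simp add: axis_eq_axis)
  have le': "l $ 1 \<le> u $ 1" "l $ 2 \<le> u $ 2"
    using le[of "axis 1 1"] le[of "axis 2 1"] by (auto simp: Basis2 inner_axis)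
  have "vec2 -` box l u = box (complex_of_vec2 l) (complex_of_vec2 u)"
    by (auto simp: box_def Basis2 Basis_complex_def inner_axis vec2_def complex_of_vec2_def inner_complex_def)
  then have "emeasure (distr lborel borel vec2) (box l u)
      = emeasure lborel (box (complex_of_vec2 l) (complex_of_vec2 u))"
    by (simp add: emeasure_distr)
  also have "\<dots> = (\<Prod>b\<in>Basis. (complex_of_vec2 u - complex_of_vec2 l) \<bullet> b)"
    using le' by (intro emeasure_lborel_box) (auto simp: Basis_complex_def complex_of_vec2_def inner_complex_def)
  also have "(\<Prod>b\<in>Basis. (complex_of_vec2 u - complex_of_vec2 l) \<bullet> b) = (\<Prod>b\<in>Basis. (u - l) \<bullet> b)"
    using ne by (auto simp: Basis2 Basis_complex_def inner_axis complex_of_vec2_def inner_complex_def)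
  finally show "emeasure (distr lborel borel vec2) (box l u) = (\<Prod>b\<in>Basis. (u - l) \<bullet> b)" .
qed auto

lemma vec2_image_sets_lebesgue:
  "S \<in> sets lebesgue \<Longrightarrow> vec2 ` S \<in> sets lebesgue"
  "S' \<in> sets lebesgue \<Longrightarrow> complex_of_vec2 ` S' \<in> sets lebesgue"
  using linear_vec2 by (auto intro!: differentiable_image_in_sets_lebesgue linear_imp_differentiable_on)

lemma vec2_vimage: "vec2 -` A = complex_of_vec2 ` A"
  by (auto simp: image_iff) (metis vec2_inverse(1))

text \<open>The Borel identity \<open>lborel_vec2\<close> reaches the completion by splitting a set
  into a Borel part and a subset of a null set.\<close>

lemma lebesgue_vec2: "lebesgue = distr lebesgue lebesgue vec2"
proof (rule measure_eqI)
  fix A :: "(real^2) set"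
  assume A: "A \<in> sets lebesgue"
  have meas: "vec2 \<in> measurable lebesgue lebesgue"
    by (rule measurableI) (auto simp: vec2_vimage vec2_image_sets_lebesgue)
  obtain S N N' where SN: "A = S \<union> N" "N \<subseteq> N'" "N' \<in> null_sets lborel" "S \<in> sets lborel"
    using A by (rule sets_completionE)
  have null: "vec2 -` N' \<in> null_sets lborel"
    using SN(3) emeasure_distr[of vec2 lborel borel N'] measurable_sets[OF borel_measurable_vec2(1), of N']
    by (simp add: null_sets_def lborel_vec2[symmetric])
  have "vec2 -` A = vec2 -` S \<union> vec2 -` N" using SN(1) by auto
  moreover have "vec2 -` S \<in> sets lborel"
    using SN(4) measurable_sets[OF borel_measurable_vec2(1), of S] by simp
  moreover have "vec2 -` N \<in> null_sets lebesgue"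
    using SN(2) null unfolding null_sets_completion_iff2 by (intro bexI[OF _ null]) auto
  ultimately have "emeasure lebesgue (vec2 -` A) = emeasure lborel (vec2 -` S)"
    by (simp add: emeasure_Un_null_set)
  also have "\<dots> = emeasure lborel S"
    using SN(4) emeasure_distr[of vec2 lborel borel S] by (simp add: lborel_vec2[symmetric])
  also have "\<dots> = emeasure lebesgue A"
  proof -
    have "N \<in> null_sets lebesgue" using SN by (auto simp: null_sets_completion_iff2)
    then show ?thesis using SN by (simp add: emeasure_Un_null_set)
  qed
  finally show "emeasure lebesgue A = emeasure (distr lebesgue lebesgue vec2) A"
    using A meas by (simp add: emeasure_distr)
qed simp

lemma measurable_vec2: "vec2 \<in> measurable lebesgue lebesgue"
  by (rule measurableI) (auto simp: vec2_vimage vec2_image_sets_lebesgue)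

text \<open>Multiplication by \<open>\<phi>' z\<close>, read as a real 2 x 2 matrix, has determinant
  |\<phi>'(z)|^2. Infinite values are included, so that nonnegative integrals can later be
  transformed without checking finiteness.\<close>

lemma emeasure_holomorphic_image:
  assumes S: "S \<in> sets lebesgue" and inj: "inj_on \<phi> S"
    and der: "\<And>z. z \<in> S \<Longrightarrow> (\<phi> has_field_derivative \<phi>' z) (at z)"
    and meas: "(\<lambda>z. cmod (\<phi>' z) ^ 2 * indicator S z) \<in> borel_measurable lebesgue"
  shows "emeasure lebesgue (\<phi> ` S) = (\<integral>\<^sup>+z. ennreal (cmod (\<phi>' z) ^ 2 * indicator S z) \<partial>lebesgue)"
proof -
  define f where "f = vec2 \<circ> \<phi> \<circ> complex_of_vec2"
  define f' where "f' v = vec2 \<circ> (\<lambda>h. \<phi>' (complex_of_vec2 v) * h) \<circ> complex_of_vec2" for v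
  define h where "h v = \<bar>det (matrix (f' v))\<bar> * indicator (vec2 ` S) v" for v
  have h_eq: "h v = cmod (\<phi>' (complex_of_vec2 v)) ^ 2 * indicator S (complex_of_vec2 v)" for v
  proof -
    have "\<bar>det (matrix (f' v))\<bar> = cmod (\<phi>' (complex_of_vec2 v)) ^ 2"
      by (simp add: det_2 matrix_def f'_def vec2_def complex_of_vec2_def axis_def)
        (simp add: cmod_power2 flip: power2_eq_square)
    moreover have "v \<in> vec2 ` S \<longleftrightarrow> complex_of_vec2 v \<in> S"
      by (metis image_iff vec2_inverse)
    ultimately show ?thesis by (simp add: h_def indicator_def)
  qed
  have cv_meas: "complex_of_vec2 \<in> measurable lebesgue lebesgue"
  proof (rule measurableI)
    fix A assume "A \<in> sets (lebesgue :: complex measure)"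
    moreover have "complex_of_vec2 -` A = vec2 ` A"
      by (auto simp: image_iff) (metis vec2_inverse(2))
    ultimately show "complex_of_vec2 -` A \<inter> space lebesgue \<in> sets lebesgue"
      by (simp add: vec2_image_sets_lebesgue)
  qed simp
  have h_meas: "h \<in> borel_measurable lebesgue"
    unfolding h_eq[abs_def] using measurable_compose[OF cv_meas meas] by simp
  have nn_h: "(\<integral>\<^sup>+v. ennreal (h v) \<partial>lebesgue)
      = (\<integral>\<^sup>+z. ennreal (cmod (\<phi>' z) ^ 2 * indicator S z) \<partial>lebesgue)" (is "_ = ?I")
  proof -
    have "(\<integral>\<^sup>+v. ennreal (h v) \<partial>lebesgue) = (\<integral>\<^sup>+v. ennreal (h v) \<partial>distr lebesgue lebesgue vec2)"
      using lebesgue_vec2 by simp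
    also have "\<dots> = (\<integral>\<^sup>+z. ennreal (h (vec2 z)) \<partial>lebesgue)"
      by (rule nn_integral_distr) (use h_meas measurable_vec2 in simp_all)
    finally show ?thesis by (simp add: h_eq)
  qed
  \<comment> \<open>The equivalence concerns finite values and runs both ways; the infinite case
    below follows from it by contradiction.\<close>
  have key: "f ` (vec2 ` S) \<in> lmeasurable \<and> measure lebesgue (f ` (vec2 ` S)) = m
       \<longleftrightarrow> (\<integral>\<^sup>+v. ennreal (h v) \<partial>lebesgue) = ennreal m \<and> 0 \<le> m" for m
  proof -
    have "(f has_derivative f' x) (at x within vec2 ` S)" if "x \<in> vec2 ` S" for x
    proof -
      have "complex_of_vec2 x \<in> S" using that by auto
      then have "(\<phi> has_derivative (\<lambda>h. \<phi>' (complex_of_vec2 x) * h)) (at (complex_of_vec2 x))"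
        using der by (simp add: has_field_derivative_def)
      moreover have "(complex_of_vec2 has_derivative complex_of_vec2) (at x)"
        "(vec2 has_derivative vec2) (at (\<phi> (complex_of_vec2 x)))"
        using linear_vec2 by (auto intro: linear_imp_has_derivative)
      ultimately have "(f has_derivative f' x) (at x)"
        unfolding f_def f'_def by (auto intro!: diff_chain_at)
      then show ?thesis by (rule has_derivative_at_withinI)
    qed
    moreover have "inj_on f (vec2 ` S)"
      using inj by (auto simp: inj_on_def f_def) (metis vec2_inverse(1))
    ultimately have "f ` (vec2 ` S) \<in> lmeasurable \<and> measure lebesgue (f ` (vec2 ` S)) = m
       \<longleftrightarrow> ((\<lambda>x. \<bar>det (matrix (f' x))\<bar>) has_integral m) (vec2 ` S)"
      using S by (intro has_measure_differentiable_image vec2_image_sets_lebesgue)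
    also have "\<dots> \<longleftrightarrow> (h has_integral m) UNIV"
    proof -
      have "h = (\<lambda>x. if x \<in> vec2 ` S then \<bar>det (matrix (f' x))\<bar> else 0)"
        by (auto simp: h_def fun_eq_iff)
      then show ?thesis by (simp add: has_integral_restrict_UNIV)
    qed
    also have "\<dots> \<longleftrightarrow> (\<integral>\<^sup>+v. ennreal (h v) \<partial>lebesgue) = ennreal m \<and> 0 \<le> m"
      using h_meas by (subst has_integral_iff_nn_integral_lebesgue) (auto simp: h_def)
    finally show ?thesis .
  qed
  have "\<phi> differentiable_on S"
    using der by (meson differentiable_at_withinI differentiable_def differentiable_on_def has_field_derivative_def)
  then have im: "\<phi> ` S \<in> sets lebesgue"
    using S by (intro differentiable_image_in_sets_lebesgue) auto
  have f_im: "f ` (vec2 ` S) = vec2 ` (\<phi> ` S)" by (auto simp: f_def image_iff)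
  have em: "emeasure lebesgue (f ` (vec2 ` S)) = emeasure lebesgue (\<phi> ` S)"
  proof -
    have "vec2 -` (vec2 ` (\<phi> ` S)) = \<phi> ` S"
      by (auto simp: image_iff) (metis vec2_inverse(1))
    then show ?thesis
      using im by (subst lebesgue_vec2) (auto simp: f_im emeasure_distr measurable_vec2 vec2_image_sets_lebesgue)
  qed
  show ?thesis
  proof (cases "?I = top")
    case False
    then obtain m where m: "?I = ennreal m" "m \<ge> 0" by (cases ?I) auto
    then have "f ` (vec2 ` S) \<in> lmeasurable" "measure lebesgue (f ` (vec2 ` S)) = m"
      using key[of m] nn_h by auto
    then show ?thesis using em m by (metis emeasure_eq_measure2)
  next
    case True
    have "emeasure lebesgue (\<phi> ` S) = top"
    proof (rule ccontr)
      assume "emeasure lebesgue (\<phi> ` S) \<noteq> top"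
      then have "f ` (vec2 ` S) \<in> lmeasurable"
        using em im by (intro fmeasurableI) (auto simp: f_im vec2_image_sets_lebesgue top.not_eq_extremum)
      then show False using key[of "measure lebesgue (f ` (vec2 ` S))"] nn_h True by auto
    qed
    then show ?thesis using True by simp
  qed
qed


section \<open>Normalized area on planar sets and its behaviour under biholomorphic maps\<close>

abbreviation area_on :: "complex set \<Rightarrow> complex measure" where
  "area_on U \<equiv> restrict_space area U"

abbreviation dA :: "complex measure" where
  "dA \<equiv> area_on \<bbbD>"

lemma sets_area [simp, measurable_cong]: "sets area = sets lebesgue" and space_area [simp]: "space area = UNIV"
  by (simp_all add: area_def)

lemma emeasure_area: "A \<in> sets lebesgue \<Longrightarrow> emeasure area A = ennreal (1 / pi) * emeasure lebesgue A"
  unfolding area_def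
  by (subst emeasure_density; (rule nn_integral_cmult_indicator | rule borel_measurable_const | assumption))

lemma nn_integral_area:
  "f \<in> borel_measurable lebesgue \<Longrightarrow> (\<integral>\<^sup>+z. f z \<partial>area) = ennreal (1 / pi) * (\<integral>\<^sup>+z. f z \<partial>lebesgue)"
  unfolding area_def
  by (subst nn_integral_density; (rule nn_integral_cmult | rule borel_measurable_const | assumption))

lemma sets_area_on: "sets (area_on U) = sets (lebesgue_on U)"
  by (rule sets_restrict_space_cong) simp

lemma measurable_area_on: "borel_measurable (area_on U) = borel_measurable (lebesgue_on U)"
  by (rule measurable_cong_sets[OF sets_area_on refl])

lemma space_area_on [simp]: "space (area_on U) = U"
  by (simp add: space_restrict_space)

lemma continuous_on_area_on:
  fixes f :: "complex \<Rightarrow> 'a::topological_space"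
  assumes "continuous_on U f" shows "f \<in> borel_measurable (area_on U)"
proof (rule measurableI)
  fix A :: "'a set" assume "A \<in> sets borel"
  then have "f -` A \<inter> U \<in> sets (restrict_space borel U)"
    using measurable_sets[OF borel_measurable_continuous_on_restrict[OF assms], of A]
    by (simp add: space_restrict_space)
  then obtain B where "B \<in> sets borel" "f -` A \<inter> U = U \<inter> B"
    by (auto simp: sets_restrict_space)
  then show "f -` A \<inter> space (area_on U) \<in> sets (area_on U)"
    by (auto simp: sets_restrict_space)
qed simp

text \<open>Lebesgue sets, not only Borel sets, must pull back: the preimage is the image under the
  holomorphic inverse, and differentiable maps of the plane send Lebesgue sets to Lebesgue
  sets.\<close>

lemma measurable_biholomorphic:
  assumes "open U" "open V" "biholomorphic \<phi> U V"
  shows "\<phi> \<in> measurable (area_on U) (area_on V)"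
proof (rule measurableI)
  obtain \<psi> where \<psi>: "\<psi> holomorphic_on V" "\<And>z. z \<in> U \<Longrightarrow> \<psi> (\<phi> z) = z" and im: "\<phi> ` U = V"
    using assms(3) by (auto simp: biholomorphic_def)
  show "\<phi> z \<in> space (area_on V)" if "z \<in> space (area_on U)" for z
    using that im by auto
  fix A assume "A \<in> sets (area_on V)"
  then have A: "A \<in> sets lebesgue" "A \<subseteq> V"
    using assms(2) by (auto simp: sets_restrict_space_iff)
  have "\<phi> -` A \<inter> U = \<psi> ` A"
    using \<psi>(2) im A(2) by (force simp: image_iff)
  moreover have "\<psi> ` A \<in> sets lebesgue"
  proof (rule differentiable_image_in_sets_lebesgue[OF A(1)])
    have "\<psi> differentiable_on V"
      using holomorphic_on_imp_differentiable_on[OF \<psi>(1)] by simp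
    then show "\<psi> differentiable_on A" using A(2) differentiable_on_subset by blast
  qed simp
  ultimately show "\<phi> -` A \<inter> space (area_on U) \<in> sets (area_on U)"
    using assms(1) by (auto simp: sets_restrict_space_iff)
qed

text \<open>As an identity of measures it yields the transformation of nonnegative integrals and of
  Bochner integrals alike.\<close>

lemma area_on_biholomorphic:
  assumes U: "open U" and V: "open V" and bi: "biholomorphic \<phi> U V"
  shows "area_on V = distr (density (area_on U) (\<lambda>z. ennreal (cmod (deriv \<phi> z) ^ 2))) (area_on V) \<phi>"
    (is "_ = ?D")
proof (rule measure_eqI)
  show "sets (area_on V) = sets ?D" by simp
  obtain \<psi> where hol: "\<phi> holomorphic_on U" and \<psi>: "\<And>z. z \<in> U \<Longrightarrow> \<psi> (\<phi> z) = z" and im: "\<phi> ` U = V"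
    using bi by (auto simp: biholomorphic_def)
  have inj: "inj_on \<phi> U" using \<psi> by (metis inj_onI)
  have m\<phi>: "\<phi> \<in> measurable (area_on U) (area_on V)" by (rule measurable_biholomorphic[OF U V bi])
  have md': "(\<lambda>z. cmod (deriv \<phi> z) ^ 2) \<in> borel_measurable (area_on U)"
    using hol U by (intro continuous_on_area_on continuous_intros holomorphic_on_imp_continuous_on holomorphic_deriv)
  then have md: "(\<lambda>z. ennreal (cmod (deriv \<phi> z) ^ 2)) \<in> borel_measurable (area_on U)"
    by simp
  fix A assume A: "A \<in> sets (area_on V)"
  define S where "S = \<phi> -` A \<inter> U"
  have S: "S \<in> sets lebesgue" "S \<subseteq> U"
    using measurable_sets[OF m\<phi> A] U by (auto simp: S_def sets_restrict_space_iff)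
  have S': "S \<in> sets (area_on U)" using measurable_sets[OF m\<phi> A] by (simp add: S_def)
  have A': "A \<in> sets lebesgue" "A \<subseteq> V" using A V by (auto simp: sets_restrict_space_iff)
  have imS: "\<phi> ` S = A" using im A' by (auto simp: S_def)
  have mS: "(\<lambda>z. cmod (deriv \<phi> z) ^ 2 * indicator S z) \<in> borel_measurable lebesgue"
  proof -
    have "(\<lambda>z. cmod (deriv \<phi> z) ^ 2) \<in> borel_measurable (area_on S)"
      using md' S(2) by (rule measurable_restrict_mono)
    then show ?thesis
      using S(1) by (simp add: borel_measurable_restrict_space_iff mult.commute)
  qed
  have "emeasure ?D A = emeasure (density (area_on U) (\<lambda>z. ennreal (cmod (deriv \<phi> z) ^ 2))) S"
    using m\<phi> A by (simp add: emeasure_distr S_def)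
  also have "\<dots> = (\<integral>\<^sup>+z. ennreal (cmod (deriv \<phi> z) ^ 2) * indicator S z \<partial>area_on U)"
    using md S' by (rule emeasure_density)
  also have "\<dots> = (\<integral>\<^sup>+z. ennreal (cmod (deriv \<phi> z) ^ 2 * indicator S z) \<partial>area)"
    using U S(2) by (subst nn_integral_restrict_space)
      (auto intro!: nn_integral_cong simp: indicator_def)
  also have "\<dots> = ennreal (1 / pi) * (\<integral>\<^sup>+z. ennreal (cmod (deriv \<phi> z) ^ 2 * indicator S z) \<partial>lebesgue)"
    using mS by (simp add: nn_integral_area)
  also have "(\<integral>\<^sup>+z. ennreal (cmod (deriv \<phi> z) ^ 2 * indicator S z) \<partial>lebesgue) = emeasure lebesgue (\<phi> ` S)"
  proof (rule emeasure_holomorphic_image[symmetric])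
    show "(\<phi> has_field_derivative deriv \<phi> z) (at z)" if "z \<in> S" for z
      using hol U S(2) that by (auto intro!: holomorphic_derivI)
  qed (use S mS inj in \<open>auto intro: inj_on_subset\<close>)
  also have "ennreal (1 / pi) * emeasure lebesgue (\<phi> ` S) = emeasure (area_on V) A"
    using A' V by (simp add: imS emeasure_restrict_space emeasure_area)
  finally show "emeasure (area_on V) A = emeasure ?D A" by simp
qed


lemma deriv_measurable_area_on:
  assumes "open U" "\<phi> holomorphic_on U"
  shows "(\<lambda>z. cmod (deriv \<phi> z) ^ 2) \<in> borel_measurable (area_on U)"
  using assms by (intro continuous_on_area_on continuous_intros holomorphic_on_imp_continuous_on holomorphic_deriv)

lemma nn_integral_biholomorphic:
  assumes U: "open U" and V: "open V" and bi: "biholomorphic \<phi> U V"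
    and f: "f \<in> borel_measurable (area_on V)"
  shows "(\<integral>\<^sup>+z. f z \<partial>area_on V) = (\<integral>\<^sup>+z. ennreal (cmod (deriv \<phi> z) ^ 2) * f (\<phi> z) \<partial>area_on U)"
proof -
  have m: "\<phi> \<in> measurable (area_on U) (area_on V)" by (rule measurable_biholomorphic[OF U V bi])
  have d: "(\<lambda>z. ennreal (cmod (deriv \<phi> z) ^ 2)) \<in> borel_measurable (area_on U)"
    using deriv_measurable_area_on[OF U, of \<phi>] bi by (simp add: biholomorphic_def)
  have "(\<integral>\<^sup>+z. f z \<partial>area_on V)
      = (\<integral>\<^sup>+z. f z \<partial>distr (density (area_on U) (\<lambda>z. ennreal (cmod (deriv \<phi> z) ^ 2))) (area_on V) \<phi>)"
    by (subst area_on_biholomorphic[OF U V bi]) rule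
  also have "\<dots> = (\<integral>\<^sup>+z. f (\<phi> z) \<partial>density (area_on U) (\<lambda>z. ennreal (cmod (deriv \<phi> z) ^ 2)))"
    using m f by (subst nn_integral_distr) auto
  also have "\<dots> = (\<integral>\<^sup>+z. ennreal (cmod (deriv \<phi> z) ^ 2) * f (\<phi> z) \<partial>area_on U)"
    using d measurable_compose[OF m f] by (rule nn_integral_density)
  finally show ?thesis .
qed

lemma integral_biholomorphic:
  fixes f :: "complex \<Rightarrow> complex"
  assumes U: "open U" and V: "open V" and bi: "biholomorphic \<phi> U V"
    and f: "f \<in> borel_measurable (area_on V)"
  shows "(\<integral>z. f z \<partial>area_on V) = (\<integral>z. cmod (deriv \<phi> z) ^ 2 *\<^sub>R f (\<phi> z) \<partial>area_on U)"
proof -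
  have m: "\<phi> \<in> measurable (area_on U) (area_on V)" by (rule measurable_biholomorphic[OF U V bi])
  have d: "(\<lambda>z. cmod (deriv \<phi> z) ^ 2) \<in> borel_measurable (area_on U)"
    using deriv_measurable_area_on[OF U, of \<phi>] bi by (simp add: biholomorphic_def)
  have "(\<integral>z. f z \<partial>area_on V)
      = (\<integral>z. f z \<partial>distr (density (area_on U) (\<lambda>z. ennreal (cmod (deriv \<phi> z) ^ 2))) (area_on V) \<phi>)"
    by (subst area_on_biholomorphic[OF U V bi]) rule
  also have "\<dots> = (\<integral>z. f (\<phi> z) \<partial>density (area_on U) (\<lambda>z. ennreal (cmod (deriv \<phi> z) ^ 2)))"
    using m f by (subst integral_distr) auto
  also have "\<dots> = (\<integral>z. cmod (deriv \<phi> z) ^ 2 *\<^sub>R f (\<phi> z) \<partial>area_on U)"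
    using d measurable_compose[OF m f] by (subst integral_density) auto
  finally show ?thesis .
qed

lemma biholomorphic_rotation:
  assumes "cmod c = 1" shows "biholomorphic (\<lambda>z. c * z) \<bbbD> \<bbbD>"
  unfolding biholomorphic_def
proof (intro conjI exI[of _ "\<lambda>z. z / c"])
  have c: "c \<noteq> 0" using assms by auto
  show "(\<lambda>z. c * z) ` \<bbbD> = \<bbbD>"
  proof
    show "\<bbbD> \<subseteq> (\<lambda>z. c * z) ` \<bbbD>"
    proof
      fix z :: complex assume "z \<in> \<bbbD>"
      then show "z \<in> (\<lambda>z. c * z) ` \<bbbD>"
        using assms c by (intro image_eqI[of _ _ "z / c"]) (auto simp: norm_divide)
    qed
  qed (use assms in \<open>auto simp: norm_mult\<close>)
qed (use assms in \<open>auto intro!: holomorphic_intros\<close>)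

lemma emeasure_area_rotation:
  assumes c: "cmod c = 1" and A: "A \<in> sets area" "A \<subseteq> \<bbbD>" and B: "B \<in> sets area" "B \<subseteq> \<bbbD>"
    and AB: "\<And>z. z \<in> \<bbbD> \<Longrightarrow> c * z \<in> B \<longleftrightarrow> z \<in> A"
  shows "emeasure area A = emeasure area B"
proof -
  have "emeasure area B = (\<integral>\<^sup>+z. indicator B z \<partial>dA)"
    using B by (subst nn_integral_indicator) (auto simp: sets_restrict_space_iff emeasure_restrict_space)
  also have "\<dots> = (\<integral>\<^sup>+z. ennreal (cmod (deriv (\<lambda>z. c * z) z) ^ 2) * indicator B (c * z) \<partial>dA)"
    using B by (intro nn_integral_biholomorphic biholomorphic_rotation c)
      (auto simp: sets_restrict_space_iff intro!: borel_measurable_indicator)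
  also have "\<dots> = (\<integral>\<^sup>+z. indicator A z \<partial>dA)"
    using AB c by (intro nn_integral_cong) (auto simp: indicator_def)
  also have "\<dots> = emeasure area A"
    using A by (subst nn_integral_indicator) (auto simp: sets_restrict_space_iff emeasure_restrict_space)
  finally show ?thesis by simp
qed

section \<open>Carleson boxes and the Bergman kernel\<close>

text \<open>Number of the dyadic arc containing the argument, on a circle of length 1 cut into 2^k
  arcs and turned by \<alpha>. The remainder closes the circle, as the floor may be
  negative.\<close>

definition cell :: "real \<Rightarrow> nat \<Rightarrow> complex \<Rightarrow> nat" where
  "cell \<alpha> k z = nat (\<lfloor>2 ^ k * (Arg z / (2 * pi) - \<alpha>)\<rfloor> mod 2 ^ k)"

definition carleson_box :: "real \<Rightarrow> nat \<Rightarrow> nat \<Rightarrow> complex set" where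
  "carleson_box \<alpha> k j = {z \<in> \<bbbD>. 1 - cmod z \<le> (1/2) ^ k \<and> cell \<alpha> k z = j}"

definition box_top :: "real \<Rightarrow> nat \<Rightarrow> nat \<Rightarrow> complex set" where
  "box_top \<alpha> k j = {z \<in> carleson_box \<alpha> k j. (1/2) ^ Suc k < 1 - cmod z}"

lemma cell_less: "cell \<alpha> k z < 2 ^ k"
proof -
  have "\<lfloor>2 ^ k * (Arg z / (2 * pi) - \<alpha>)\<rfloor> mod 2 ^ k < (2 ^ k :: int)" by (rule pos_mod_bound) simp
  then show ?thesis unfolding cell_def by (simp add: nat_less_iff)
qed

lemma of_int_cell: "int (cell \<alpha> k z) = \<lfloor>2 ^ k * (Arg z / (2 * pi) - \<alpha>)\<rfloor> mod 2 ^ k"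
  by (simp add: cell_def)

lemma cell_Suc: "cell \<alpha> k z = cell \<alpha> (Suc k) z div 2"
proof -
  let ?x = "Arg z / (2 * pi) - \<alpha>"
  have fl: "\<lfloor>2 ^ k * ?x\<rfloor> = \<lfloor>2 ^ Suc k * ?x\<rfloor> div 2"
    using floor_divide_real_eq_div[of 2 "2 ^ Suc k * ?x"] by simp
  have "(m div 2) mod 2 ^ k = (m mod 2 ^ Suc k) div 2" for m :: int
    by (simp add: mod_mult2_eq' power_Suc mod_mult2_eq zmod_zmult2_eq)
  then have "int (cell \<alpha> k z) = int (cell \<alpha> (Suc k) z) div 2"
    by (simp only: of_int_cell fl)
  then show ?thesis by (simp add: zdiv_int[symmetric])
qed

lemma cell_measurable: "{z. cell \<alpha> k z = j} \<in> sets borel"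
proof -
  have [measurable]: "Arg \<in> borel_measurable borel" unfolding Arg_def[abs_def] by measurable
  have "{z. cell \<alpha> k z = j} = {z \<in> space borel. cell \<alpha> k z = j}" by simp
  also have "\<dots> \<in> sets borel" unfolding cell_def by measurable
  finally show ?thesis .
qed

lemma carleson_box_borel: "carleson_box \<alpha> k j \<in> sets borel"
proof -
  have "carleson_box \<alpha> k j = \<bbbD> \<inter> {z. 1 - cmod z \<le> (1/2) ^ k} \<inter> {z. cell \<alpha> k z = j}"
    by (auto simp: carleson_box_def)
  also have "\<dots> \<in> sets borel"
  proof (intro sets.Int cell_measurable)
    show "{z. 1 - cmod z \<le> (1/2) ^ k} \<in> sets borel" by measurable
  qed simp
  finally show ?thesis .
qed

lemma box_top_borel: "box_top \<alpha> k j \<in> sets borel"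
proof -
  have "box_top \<alpha> k j = carleson_box \<alpha> k j \<inter> {z. (1/2) ^ Suc k < 1 - cmod z}"
    by (auto simp: box_top_def)
  also have "\<dots> \<in> sets borel"
  proof (intro sets.Int carleson_box_borel)
    show "{z. (1/2) ^ Suc k < 1 - cmod z} \<in> sets borel" by measurable
  qed
  finally show ?thesis .
qed

lemma box_lebesgue: "carleson_box \<alpha> k j \<in> sets lebesgue" "box_top \<alpha> k j \<in> sets lebesgue"
  using carleson_box_borel box_top_borel by auto

lemma carleson_box_subset: "carleson_box \<alpha> k j \<subseteq> \<bbbD>" and box_top_subset: "box_top \<alpha> k j \<subseteq> carleson_box \<alpha> k j"
  by (auto simp: carleson_box_def box_top_def)

lemma carleson_box_split:
  "carleson_box \<alpha> k j = carleson_box \<alpha> (Suc k) (2 * j) \<union> carleson_box \<alpha> (Suc k) (Suc (2 * j)) \<union> box_top \<alpha> k j"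
proof -
  have "cell \<alpha> k z = j \<longleftrightarrow> cell \<alpha> (Suc k) z = 2 * j \<or> cell \<alpha> (Suc k) z = Suc (2 * j)" for z
    unfolding cell_Suc[of \<alpha> k z] by presburger
  moreover have "x \<le> (1/2) ^ k" if "x \<le> (1/2) ^ Suc k" for x :: real
    using that by (rule order_trans) simp
  ultimately show ?thesis unfolding box_top_def carleson_box_def by (auto simp del: power_Suc)
qed

lemma carleson_box_disjoint:
  "carleson_box \<alpha> (Suc k) (2 * j) \<inter> carleson_box \<alpha> (Suc k) (Suc (2 * j)) = {}"
  "carleson_box \<alpha> (Suc k) i \<inter> box_top \<alpha> k j = {}"
  by (auto simp: carleson_box_def box_top_def)

lemma carleson_box_root: "carleson_box \<alpha> 0 0 = \<bbbD>"
  by (auto simp: carleson_box_def cell_def)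

lemma cmod_cis_diff_le: "cmod (cis x - cis y) \<le> \<bar>x - y\<bar>"
proof -
  have "cmod (cis x - cis y) \<le> 1 * norm (x - y)"
  proof (rule differentiable_bound[of UNIV])
    show "(cis has_derivative (\<lambda>t. t *\<^sub>R (\<i> * cis x))) (at x within UNIV)" for x
      by (auto intro!: derivative_eq_intros)
    show "onorm (\<lambda>t. t *\<^sub>R (\<i> * cis x)) \<le> 1" for x
      by (rule onorm_le) (simp add: norm_mult)
  qed auto
  then show ?thesis by simp
qed

lemma cis_add_int: "cis (x + 2 * pi * of_int m) = cis x"
  using cis_mult[of x "2 * pi * of_int m"] by simp

text \<open>A box spans an arc of length 2 pi 2^-k and a radial depth of 2^-k, and 1 + 2 pi < 8. The
  centre is an endpoint of its arc on the circle, so the box lies in a cap of the kind that the A_p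
  condition controls.\<close>

lemma carleson_box_subset_ball:
  "carleson_box \<alpha> k j \<subseteq> ball (cis (2 * pi * (j / 2 ^ k + \<alpha>))) (8 * (1/2) ^ k)"
proof
  fix z assume z: "z \<in> carleson_box \<alpha> k j"
  let ?c = "cis (2 * pi * (j / 2 ^ k + \<alpha>))"
  define n where "n = \<lfloor>2 ^ k * (Arg z / (2 * pi) - \<alpha>)\<rfloor>"
  have "int j = n mod 2 ^ k"
    using z of_int_cell[of \<alpha> k z] by (simp add: carleson_box_def n_def)
  then obtain m where m: "n = int j + 2 ^ k * m"
    using mod_div_mult_eq[of n "2 ^ k"] by (metis add.commute mult.commute)
  have bd: "\<bar>2 ^ k * (Arg z / (2 * pi) - \<alpha>) - n\<bar> \<le> 1"
    unfolding n_def by linarith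
  have "t - n / 2 ^ k = (2 ^ k * t - n) * (1/2) ^ k" for t :: real
    by (simp add: field_simps)
  then have "\<bar>Arg z / (2 * pi) - \<alpha> - n / 2 ^ k\<bar> = \<bar>2 ^ k * (Arg z / (2 * pi) - \<alpha>) - n\<bar> * (1/2) ^ k"
    by (simp only: abs_mult) simp
  also have "\<dots> \<le> (1/2) ^ k" using mult_right_mono[OF bd, of "(1/2) ^ k"] by simp
  finally have bd': "\<bar>Arg z / (2 * pi) - (j / 2 ^ k + \<alpha> + m)\<bar> \<le> (1/2) ^ k"
    by (simp add: m field_simps)
  have "?c = cis (2 * pi * (j / 2 ^ k + \<alpha> + m))"
    using cis_add_int[of "2 * pi * (j / 2 ^ k + \<alpha>)" m] by (simp add: algebra_simps)
  then have "cmod (cis (Arg z) - ?c) \<le> \<bar>Arg z - 2 * pi * (j / 2 ^ k + \<alpha> + m)\<bar>"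
    using cmod_cis_diff_le by simp
  also have "\<dots> = 2 * pi * \<bar>Arg z / (2 * pi) - (j / 2 ^ k + \<alpha> + m)\<bar>"
    by (simp add: abs_mult_pos' right_diff_distrib)
  also have "\<dots> \<le> 2 * pi * (1/2) ^ k" using bd' by (intro mult_left_mono) auto
  finally have 1: "cmod (cis (Arg z) - ?c) \<le> 2 * pi * (1/2) ^ k" .
  have "z = cmod z * cis (Arg z)" using rcis_cmod_Arg[of z] by (simp add: rcis_def)
  moreover have "w - c = of_real (r - 1) * c" if "w = of_real r * c" for w c :: complex and r :: real
    using that by (simp add: algebra_simps)
  ultimately have "z - cis (Arg z) = of_real (cmod z - 1) * cis (Arg z)" by blast
  then have "cmod (z - cis (Arg z)) = cmod (of_real (cmod z - 1) * cis (Arg z))" by simp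
  also have "\<dots> = \<bar>cmod z - 1\<bar>" by (simp only: norm_mult norm_of_real norm_cis mult_1_right)
  also have "\<dots> \<le> (1/2) ^ k" using z by (simp add: carleson_box_def)
  finally have "cmod (z - ?c) \<le> (1/2) ^ k + 2 * pi * (1/2) ^ k"
    using 1 norm_triangle_ineq[of "z - cis (Arg z)" "cis (Arg z) - ?c"] by simp
  also have "\<dots> = (1 + 2 * pi) * (1/2) ^ k" by (simp add: algebra_simps)
  also have "\<dots> < 8 * (1/2) ^ k" using pi_less_4 pi_approx by (intro mult_strict_right_mono) auto
  finally show "z \<in> ball ?c (8 * (1/2) ^ k)" by (simp add: dist_norm norm_minus_commute)
qed

lemma emeasure_area_ball: "r \<ge> 0 \<Longrightarrow> emeasure area (ball z r) = ennreal (r\<^sup>2)"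
  by (simp add: emeasure_area emeasure_ball unit_ball_vol_2 ennreal_mult'[symmetric])

lemma cell_rotate:
  assumes "z \<noteq> 0"
  shows "cell \<alpha> k (cis (2 * pi * j / 2 ^ k) * z) = (cell \<alpha> k z + j) mod 2 ^ k"
proof -
  let ?w = "cis (2 * pi * j / 2 ^ k) * z"
  have "cis (Arg ?w) = cis (2 * pi * j / 2 ^ k) * cis (Arg z)"
    using assms by (simp add: cis_Arg sgn_mult)
  also have "\<dots> = cis (2 * pi * j / 2 ^ k + Arg z)" by (simp add: cis_mult)
  finally have eq: "cis (Arg ?w) = cis (2 * pi * j / 2 ^ k + Arg z)" .
  have "sin (Arg ?w) = sin (2 * pi * j / 2 ^ k + Arg z) \<and> cos (Arg ?w) = cos (2 * pi * j / 2 ^ k + Arg z)"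
    using eq by (metis cis.sel)
  \<comment> \<open>Arguments add only modulo 2 pi; the integer \<open>m\<close> disappears modulo
    2^k.\<close>
  then obtain m :: int where m: "Arg ?w = 2 * pi * j / 2 ^ k + Arg z + 2 * pi * m"
    using sin_cos_eq_iff[of "Arg ?w" "2 * pi * j / 2 ^ k + Arg z"] by auto
  have "2 ^ k * (Arg ?w / (2 * pi) - \<alpha>) = 2 ^ k * (Arg z / (2 * pi) - \<alpha>) + of_int (int j + 2 ^ k * m)"
    unfolding m by (simp add: field_simps)
  then have "\<lfloor>2 ^ k * (Arg ?w / (2 * pi) - \<alpha>)\<rfloor> = \<lfloor>2 ^ k * (Arg z / (2 * pi) - \<alpha>)\<rfloor> + (int j + 2 ^ k * m)"
    by (simp only: floor_add_int)
  then have "int (cell \<alpha> k ?w) = (\<lfloor>2 ^ k * (Arg z / (2 * pi) - \<alpha>)\<rfloor> + int j + 2 ^ k * m) mod 2 ^ k"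
    by (simp add: of_int_cell add.assoc)
  also have "\<dots> = (int (cell \<alpha> k z) + int j) mod 2 ^ k"
    by (simp add: of_int_cell mod_simps)
  also have "\<dots> = int ((cell \<alpha> k z + j) mod 2 ^ k)"
    by (simp add: zmod_int)
  finally show ?thesis by (simp only: of_nat_eq_iff)
qed

lemma emeasure_box_top_eq:
  assumes j: "j < 2 ^ k"
  shows "emeasure area (box_top \<alpha> k 0) = emeasure area (box_top \<alpha> k j)"
proof (rule emeasure_area_rotation[of "cis (2 * pi * j / 2 ^ k)"])
  fix z assume z: "z \<in> \<bbbD>"
  let ?c = "cis (2 * pi * j / 2 ^ k)"
  show "?c * z \<in> box_top \<alpha> k j \<longleftrightarrow> z \<in> box_top \<alpha> k 0"
  proof (cases "z = 0")
    \<comment> \<open>Rotation fixes the origin, so its cell is not shifted; but the origin lies in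
      no box of a level k > 0, and level 0 has a single box.\<close>
    case True
    show ?thesis
    proof (cases k)
      case 0
      then show ?thesis using j by simp
    next
      case (Suc n)
      have "(1/2::real) ^ n \<le> 1" by (intro power_le_one) auto
      then have "\<not> 1 \<le> (1/2::real) ^ k" unfolding Suc by simp
      then show ?thesis using True by (simp add: box_top_def carleson_box_def)
    qed
  next
    case False
    have "(cell \<alpha> k z + j) mod 2 ^ k = j \<longleftrightarrow> cell \<alpha> k z = 0"
    proof
      assume "(cell \<alpha> k z + j) mod 2 ^ k = j"
      then have "(cell \<alpha> k z + j) mod 2 ^ k = (0 + j) mod 2 ^ k" using j by simp
      then have "2 ^ k dvd cell \<alpha> k z"
        by (metis add_diff_cancel_right' le_add2 mod_eq_dvd_iff_nat add_0)
      then show "cell \<alpha> k z = 0" using cell_less[of \<alpha> k z] by (metis nat_dvd_not_less neq0_conv)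
    qed (use j in simp)
    then show ?thesis
      by (simp add: box_top_def carleson_box_def cell_rotate[OF False] norm_mult)
  qed
qed (simp_all add: box_lebesgue subset_trans[OF box_top_subset carleson_box_subset])

text \<open>The 2^k tops of one level have equal area by rotation and tile the annulus 1 - h \<le>
  |z| < 1 - h/2 with h = 2^-k, whose area is h - 3h^2/4 \<ge> h/4. No integration over a sector is
  involved.\<close>

lemma emeasure_box_top:
  assumes j: "j < 2 ^ k"
  shows "emeasure area (box_top \<alpha> k j) \<ge> ennreal ((1/4) ^ k / 4)"
proof -
  define h :: real where "h = (1/2) ^ k"
  have h: "0 < h" "h \<le> 1" by (auto simp: h_def power_le_one)
  have tops: "(\<Union>i<2 ^ k. box_top \<alpha> k i) = ball 0 (1 - h / 2) - ball 0 (1 - h)"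
    using cell_less[of \<alpha> k] h by (auto simp: box_top_def carleson_box_def h_def)
  have "ennreal ((1 - h / 2)\<^sup>2 - (1 - h)\<^sup>2) = emeasure area (ball 0 (1 - h / 2)) - emeasure area (ball 0 (1 - h))"
    using h by (simp add: emeasure_area_ball ennreal_minus)
  also have "\<dots> = emeasure area (ball 0 (1 - h / 2) - ball 0 (1 - h))"
    using h by (intro emeasure_Diff[symmetric]) (auto simp: emeasure_area_ball subset_ball)
  also have "\<dots> = (\<Sum>i<2 ^ k. emeasure area (box_top \<alpha> k i))"
  proof -
    have "disjoint_family_on (box_top \<alpha> k) {..<2 ^ k}"
      by (auto simp: disjoint_family_on_def box_top_def carleson_box_def)
    then show ?thesis
      unfolding tops[symmetric] by (intro sum_emeasure[symmetric]) (simp_all add: image_subset_iff box_lebesgue)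
  qed
  also have "\<dots> = (\<Sum>i<(2::nat) ^ k. emeasure area (box_top \<alpha> k j))"
    using emeasure_box_top_eq[of _ k \<alpha>] j by (intro sum.cong) (auto, metis)
  also have "\<dots> = 2 ^ k * emeasure area (box_top \<alpha> k j)" by simp
  finally have eq: "ennreal ((1 - h / 2)\<^sup>2 - (1 - h)\<^sup>2) = 2 ^ k * emeasure area (box_top \<alpha> k j)" .
  have "(1/4::real) ^ k = h * h" by (simp add: h_def power_mult_distrib[symmetric])
  then have "ennreal ((1/4) ^ k / 4) = ennreal (h * (h / 4))" by simp
  also have "\<dots> \<le> ennreal (h * ((1 - h / 2)\<^sup>2 - (1 - h)\<^sup>2))"
  proof (intro ennreal_leI mult_left_mono)
    have "h * h \<le> h * 1" using h by (intro mult_left_mono) auto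
    then show "h / 4 \<le> (1 - h / 2)\<^sup>2 - (1 - h)\<^sup>2"
      by (simp add: power2_eq_square algebra_simps)
  qed (use h in auto)
  also have "\<dots> = ennreal h * (2 ^ k * emeasure area (box_top \<alpha> k j))"
    using h eq by (subst ennreal_mult') auto
  also have "\<dots> = (ennreal h * 2 ^ k) * emeasure area (box_top \<alpha> k j)" by (simp add: mult.assoc)
  also have "ennreal h * 2 ^ k = 1"
  proof -
    have "ennreal h * 2 ^ k = ennreal (h * 2 ^ k)" using h by (subst ennreal_mult') (auto simp: ennreal_power[symmetric])
    also have "h * 2 ^ k = 1" by (simp add: h_def power_mult_distrib[symmetric])
    finally show ?thesis by simp
  qed
  finally show ?thesis by simp
qed

section \<open>Lower bounds for |1 - z cnj w| and the choice of a box\<close>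

lemma sin_pi_ge:
  assumes "0 \<le> x" "x \<le> 1/2" shows "2 * x \<le> sin (pi * x)"
proof -
  have "concave_on {0..pi} sin"
  proof (rule f''_le0_imp_concave)
    show "(sin has_real_derivative cos x) (at x)" for x :: real by (rule DERIV_sin)
    show "(cos has_real_derivative - sin x) (at x)" for x :: real by (rule DERIV_cos)
  qed (auto intro: sin_ge_zero)
  then have "(1 - 2 * x) * sin 0 + 2 * x * sin (pi / 2) \<le> sin ((1 - 2 * x) *\<^sub>R 0 + (2 * x) *\<^sub>R (pi / 2))"
    using assms by (intro concave_onD[of "{0..pi}"]) auto
  then show ?thesis by (simp add: mult.commute)
qed

lemma cmod_one_minus_rcis:
  "(cmod (1 - rcis r \<theta>))\<^sup>2 = (1 - r)\<^sup>2 + 4 * r * (sin (\<theta> / 2))\<^sup>2"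
proof -
  have "cos \<theta> = 1 - 2 * (sin (\<theta> / 2))\<^sup>2" using cos_double_sin[of "\<theta> / 2"] by simp
  then have c: "(sin (\<theta> / 2))\<^sup>2 = (1 - cos \<theta>) / 2" by simp
  have alg: "(1 - r * c)\<^sup>2 + (r * s)\<^sup>2 = 1 - 2 * r * c + r\<^sup>2 * (c\<^sup>2 + s\<^sup>2)" for c s :: real
    by (simp add: power2_eq_square algebra_simps)
  have "(cmod (1 - rcis r \<theta>))\<^sup>2 = (1 - r * cos \<theta>)\<^sup>2 + (r * sin \<theta>)\<^sup>2"
    by (simp add: cmod_power2)
  also have "\<dots> = 1 - 2 * r * cos \<theta> + r\<^sup>2 * ((cos \<theta>)\<^sup>2 + (sin \<theta>)\<^sup>2)"
    by (rule alg)
  also have "(cos \<theta>)\<^sup>2 + (sin \<theta>)\<^sup>2 = 1" by simp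
  finally have "(cmod (1 - rcis r \<theta>))\<^sup>2 = 1 - 2 * r * cos \<theta> + r\<^sup>2" by simp
  also have "\<dots> = (1 - r)\<^sup>2 + 4 * r * (sin (\<theta> / 2))\<^sup>2"
    unfolding c by (simp add: power2_eq_square field_simps)
  finally show ?thesis .
qed

text \<open>Arguments are measured in full turns, and \<open>n\<close> rounds their difference to
  the nearest turn, leaving x with |x| \<le> 1/2. The squared modulus is at least 4 * (1/2) * sin^2
  (pi x), and the chord bound for the sine turns this into 2 * (2x)^2.\<close>

lemma angle_le_cmod:
  assumes "cmod z * cmod w \<ge> 1/2"
  obtains n :: int where
    "8 * (Arg z / (2 * pi) - Arg w / (2 * pi) - n)\<^sup>2 \<le> (cmod (1 - z * cnj w))\<^sup>2"
proof -
  define t where "t = Arg z / (2 * pi) - Arg w / (2 * pi)"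
  define n where "n = round t"
  have n: "\<bar>t - n\<bar> \<le> 1/2" using of_int_round_abs_le[of t] by (simp add: n_def abs_minus_commute)
  have "z * cnj w = rcis (cmod z) (Arg z) * cnj (rcis (cmod w) (Arg w))"
    by (simp add: rcis_cmod_Arg)
  also have "\<dots> = rcis (cmod z * cmod w) (Arg z - Arg w)"
  proof -
    have "cis (Arg z - Arg w) = cis (Arg z) * cis (- Arg w)" by (simp add: cis_mult)
    then show ?thesis by (simp add: rcis_def cis_cnj)
  qed
  finally have "(cmod (1 - z * cnj w))\<^sup>2
      = (1 - cmod z * cmod w)\<^sup>2 + 4 * (cmod z * cmod w) * (sin ((Arg z - Arg w) / 2))\<^sup>2"
    by (simp only: cmod_one_minus_rcis)
  also have "(Arg z - Arg w) / 2 = pi * t" by (simp add: t_def field_simps)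
  also have "(sin (pi * t))\<^sup>2 = (sin (pi * \<bar>t - n\<bar>))\<^sup>2"
  proof -
    have "sin (pi * t) = sin (pi * (t - n) + pi * n)" by (simp add: algebra_simps)
    also have "\<dots> = sin (pi * (t - n)) * cos (pi * n)"
      by (simp add: sin_add sin_integer_2pi sin_npi_int)
    finally have "(sin (pi * t))\<^sup>2 = (sin (pi * (t - n)))\<^sup>2 * (cos (pi * n))\<^sup>2"
      by (simp add: power_mult_distrib)
    also have "(cos (pi * n))\<^sup>2 = 1" by (simp add: cos_squared_eq sin_npi_int)
    finally have "(sin (pi * t))\<^sup>2 = (sin (pi * (t - n)))\<^sup>2" by simp
    moreover have "(sin (pi * x))\<^sup>2 = (sin (pi * \<bar>x\<bar>))\<^sup>2" for x :: real by (simp add: abs_if)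
    ultimately show ?thesis by simp
  qed
  also have "(1 - cmod z * cmod w)\<^sup>2 + 4 * (cmod z * cmod w) * (sin (pi * \<bar>t - n\<bar>))\<^sup>2
      \<ge> 0 + 2 * (2 * \<bar>t - n\<bar>)\<^sup>2"
  proof (intro add_mono mult_mono power_mono)
    show "2 * \<bar>t - n\<bar> \<le> sin (pi * \<bar>t - n\<bar>)" using n by (intro sin_pi_ge) auto
  qed (use assms in \<open>auto simp: mult.commute mult.left_commute\<close>)
  finally have "8 * (t - n)\<^sup>2 \<le> (cmod (1 - z * cnj w))\<^sup>2" by (simp add: power_mult_distrib)
  then show thesis using that by (simp add: t_def)
qed

lemma floor_ne_between:
  fixes x y :: real
  assumes "\<lfloor>x\<rfloor> \<noteq> \<lfloor>y\<rfloor>"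
  obtains a :: int where "x < a \<and> a \<le> y \<or> y < a \<and> a \<le> x"
proof -
  have "x < max \<lfloor>x\<rfloor> \<lfloor>y\<rfloor> \<and> max \<lfloor>x\<rfloor> \<lfloor>y\<rfloor> \<le> y \<or> y < max \<lfloor>x\<rfloor> \<lfloor>y\<rfloor> \<and> max \<lfloor>x\<rfloor> \<lfloor>y\<rfloor> \<le> x"
    using assms by (auto simp: max_def) linarith+
  then show thesis using that by blast
qed

text \<open>The one-third trick: since \<open>3\<close> does not divide \<open>2 ^ k\<close>, the breakpoints of the two grids
  stay \<open>2 ^ (- k) / 3\<close> apart.\<close>

lemma one_third_trick:
  fixes x y :: real and n :: int
  assumes "\<bar>x - y - n\<bar> < (1/2) ^ k / 3"
  shows "\<exists>\<alpha>\<in>{0, 1/3}. \<lfloor>2 ^ k * (x - \<alpha>)\<rfloor> mod 2 ^ k = \<lfloor>2 ^ k * (y - \<alpha>)\<rfloor> mod 2 ^ k"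
proof (rule ccontr)
  define N :: int where "N = 2 ^ k"
  have N: "real_of_int N = 2 ^ k" by (simp add: N_def)
  assume contr: "\<not> ?thesis"
  \<comment> \<open>Replacing y by y + n moves the floor by a multiple of N, which is invisible
    modulo N; so different cells mean different floors, with a breakpoint in between.\<close>
  have ne: "\<lfloor>N * (x - \<alpha>)\<rfloor> \<noteq> \<lfloor>N * (y + n - \<alpha>)\<rfloor>" if "\<alpha> \<in> {0, 1/3}" for \<alpha>
  proof
    assume eq: "\<lfloor>N * (x - \<alpha>)\<rfloor> = \<lfloor>N * (y + n - \<alpha>)\<rfloor>"
    have "N * (y + n - \<alpha>) = N * (y - \<alpha>) + of_int (N * n)" by (simp add: algebra_simps)
    then have "\<lfloor>N * (y + n - \<alpha>)\<rfloor> = \<lfloor>N * (y - \<alpha>)\<rfloor> + N * n" by (simp only: floor_add_int)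
    then have "\<lfloor>N * (x - \<alpha>)\<rfloor> mod N = \<lfloor>N * (y - \<alpha>)\<rfloor> mod N" using eq by simp
    then have "\<lfloor>2 ^ k * (x - \<alpha>)\<rfloor> mod 2 ^ k = \<lfloor>2 ^ k * (y - \<alpha>)\<rfloor> mod 2 ^ k"
      by (simp only: N) (simp only: N_def)
    then show False using contr that by blast
  qed
  have d: "\<bar>N * x - N * (y + n)\<bar> < 1/3"
  proof -
    have "N * x - N * (y + n) = N * (x - y - n)" by (simp add: algebra_simps)
    then have "\<bar>N * x - N * (y + n)\<bar> = N * \<bar>x - y - n\<bar>" by (simp only: abs_mult) (simp add: N)
    also have "\<dots> < N * ((1/2) ^ k / 3)" using assms by (intro mult_strict_left_mono) (auto simp: N)
    also have "\<dots> = 1/3" by (simp add: N power_mult_distrib[symmetric])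
    finally show ?thesis .
  qed
  obtain a :: int where a: "N * x < a \<and> a \<le> N * (y + n) \<or> N * (y + n) < a \<and> a \<le> N * x"
    using floor_ne_between ne[of 0] by auto
  obtain b :: int where b: "N * (x - 1/3) < b \<and> b \<le> N * (y + n - 1/3) \<or> N * (y + n - 1/3) < b \<and> b \<le> N * (x - 1/3)"
    using floor_ne_between ne[of "1/3"] by auto
  \<comment> \<open>Both \<open>a\<close> and \<open>b + N / 3\<close> separate N x from N (y + n),
    which are less than 1/3 apart.\<close>
  have "\<bar>real_of_int (3 * (a - b) - N)\<bar> < 1"
    using a b d by (auto simp: abs_less_iff right_diff_distrib)
  then have "3 * (a - b) = N" by linarith
  then have "3 dvd N" by (metis dvd_triv_left)
  moreover have "2 ^ k mod 3 = (1::int) \<or> 2 ^ k mod 3 = (2::int)"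
    by (induction k) (auto simp: mod_mult_right_eq[of 2 "2 ^ _", symmetric])
  ultimately show False by (auto simp: N_def dvd_eq_mod_eq_0)
qed

text \<open>Up to constants |1 - z cnj w| bounds the distances of both points to the circle and
  their angular distance, so a box of that scale in one of the two grids holds both.\<close>

lemma bergman_kernel_box:
  assumes z: "z \<in> \<bbbD>" and w: "w \<in> \<bbbD>"
  obtains \<alpha> k where "\<alpha> \<in> {0, 1/3}" "z \<in> carleson_box \<alpha> k (cell \<alpha> k z)" "w \<in> carleson_box \<alpha> k (cell \<alpha> k z)"
    "1 / (cmod (1 - z * cnj w))\<^sup>2 \<le> 16 * 4 ^ k"
proof -
  define L where "L = cmod (1 - z * cnj w)"
  have zw: "cmod z < 1" "cmod w < 1" using z w by auto
  have "cmod z * cmod w \<le> cmod z" "cmod z * cmod w \<le> cmod w"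
    using zw mult_left_mono[of "cmod w" 1 "cmod z"] mult_right_mono[of "cmod z" 1 "cmod w"] by auto
  moreover have "1 - cmod z * cmod w \<le> L"
    using norm_triangle_ineq2[of 1 "z * cnj w"] by (simp add: L_def norm_mult)
  ultimately have L: "1 - cmod z \<le> L" "1 - cmod w \<le> L" "1 - cmod z * cmod w \<le> L" by auto
  then have Lpos: "L > 0" using zw by linarith
  show thesis
  proof (cases "L > 1/2")
    case True
    then have "1 / L\<^sup>2 \<le> 1 / (1/2)\<^sup>2" by (intro divide_left_mono power_mono mult_pos_pos) auto
    then show thesis
      using z w that[of 0 0] by (simp add: L_def carleson_box_def cell_def power2_eq_square)
  next
    case False
    obtain n0 where "(1/2::real) ^ n0 < L" using real_arch_pow_inv[OF Lpos, of "1/2"] by auto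
    then have ex: "\<exists>n. (1/2::real) ^ n < L" by blast
    define m where "m = (LEAST n. (1/2::real) ^ n < L)"
    have m: "(1/2) ^ m < L" unfolding m_def using ex by (rule LeastI_ex)
    have m2: "\<not> m < 2"
    proof
      assume "m < 2"
      then have "(1/2::real) ^ 1 \<le> (1/2) ^ m" by (intro power_decreasing) auto
      then show False using False m by simp
    qed
    \<comment> \<open>Two generations above the first scale below L. One makes L at most 2^-k; the
      other improves the factor 1/8 in the squared angular bound to 1/32, which is below the 1/9
      that the one-third trick asks for. Together they cost 4^2 = 16.\<close>
    then obtain k where k: "m = Suc (Suc k)" by (metis add_2_eq_Suc le_Suc_ex not_less)
    have "\<not> (1/2) ^ Suc k < L" using not_less_Least[of "Suc k" "\<lambda>n. (1/2::real) ^ n < L"] k by (simp add: m_def)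
    then have Lk: "L \<le> (1/2) ^ Suc k" by simp
    have kern: "1 / L\<^sup>2 \<le> 16 * 4 ^ k"
    proof -
      have "1 / L\<^sup>2 \<le> 1 / ((1/2) ^ m)\<^sup>2"
        using m by (intro divide_left_mono power_mono mult_pos_pos) auto
      also have "\<dots> = 4 ^ m" by (simp add: power_one_over power_mult_distrib[symmetric] power2_eq_square)
      finally show ?thesis by (simp add: k)
    qed
    have h: "L \<le> (1/2) ^ k" using Lk by (rule order_trans) simp
    obtain n :: int where n: "8 * (Arg z / (2 * pi) - Arg w / (2 * pi) - n)\<^sup>2 \<le> L\<^sup>2"
      using angle_le_cmod[of z w] L(3) False unfolding L_def by fastforce
    have "\<bar>Arg z / (2 * pi) - Arg w / (2 * pi) - n\<bar> < (1/2) ^ k / 3"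
    proof (rule power2_less_imp_less)
      have "L\<^sup>2 \<le> ((1/2) ^ Suc k)\<^sup>2" using Lk Lpos by (intro power_mono) auto
      also have "\<dots> = ((1/2) ^ k)\<^sup>2 / 4" by (simp add: power2_eq_square)
      finally have "(Arg z / (2 * pi) - Arg w / (2 * pi) - n)\<^sup>2 \<le> ((1/2) ^ k)\<^sup>2 / 32" using n by simp
      also have "\<dots> < ((1/2) ^ k)\<^sup>2 / 9" by (intro divide_strict_left_mono) auto
      finally show "\<bar>Arg z / (2 * pi) - Arg w / (2 * pi) - n\<bar>\<^sup>2 < ((1/2) ^ k / 3)\<^sup>2"
        by (simp add: power_divide)
    qed auto
    then obtain \<alpha> where \<alpha>: "\<alpha> \<in> {0, 1/3}"
      "\<lfloor>2 ^ k * (Arg z / (2 * pi) - \<alpha>)\<rfloor> mod 2 ^ k = \<lfloor>2 ^ k * (Arg w / (2 * pi) - \<alpha>)\<rfloor> mod 2 ^ k"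
      using one_third_trick by blast
    then have "cell \<alpha> k w = cell \<alpha> k z" by (simp add: cell_def)
    then show thesis
      using that[OF \<alpha>(1), of k] z w h L kern by (auto simp: carleson_box_def L_def)
  qed
qed

section \<open>Sharp weighted estimate for the positive Bergman operator\<close>

lemma Holder_nn_integral_bound:
  fixes f g :: "'a \<Rightarrow> real"
  assumes pq: "p > 1" "q > 1" "1 / p + 1 / q = 1"
    and f: "f \<in> borel_measurable M" and g: "g \<in> borel_measurable M"
    and nn: "\<And>x. x \<in> space M \<Longrightarrow> f x \<ge> 0" "\<And>x. x \<in> space M \<Longrightarrow> g x \<ge> 0"
    and AB: "A \<ge> 0" "B \<ge> 0"
    and le: "(\<integral>\<^sup>+x. ennreal (f x powr p) \<partial>M) \<le> ennreal A" "(\<integral>\<^sup>+x. ennreal (g x powr q) \<partial>M) \<le> ennreal B"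
  shows "(\<integral>\<^sup>+x. ennreal (f x * g x) \<partial>M) \<le> ennreal (A powr (1 / p) * B powr (1 / q))"
proof (cases "A = 0 \<or> B = 0")
  case True
  \<comment> \<open>Normalizing divides by A and B; if one of them is 0, the corresponding factor
    vanishes almost everywhere.\<close>
  have "AE x in M. f x * g x = 0"
  proof (cases "A = 0")
    case True
    then have "AE x in M. ennreal (f x powr p) = 0"
      using le(1) f nn_integral_0_iff_AE[of "\<lambda>x. ennreal (f x powr p)" M] by simp
    then show ?thesis by eventually_elim auto
  next
    case False
    then have "B = 0" using \<open>A = 0 \<or> B = 0\<close> by simp
    then have "AE x in M. ennreal (g x powr q) = 0"
      using le(2) g nn_integral_0_iff_AE[of "\<lambda>x. ennreal (g x powr q)" M] by simp
    then show ?thesis by eventually_elim auto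
  qed
  then have "(\<integral>\<^sup>+x. ennreal (f x * g x) \<partial>M) = (\<integral>\<^sup>+x. 0 \<partial>M)"
    by (intro nn_integral_cong_AE) auto
  then show ?thesis by simp
next
  case False
  then have AB: "A > 0" "B > 0" using AB by auto
  let ?a = "A powr (1 / p)" and ?b = "B powr (1 / q)"
  have ab: "?a > 0" "?b > 0" using AB by auto
  have pw: "f x * g x \<le> ?a * ?b * (f x powr p * (1 / (A * p)) + g x powr q * (1 / (B * q)))"
    if "x \<in> space M" for x
  proof -
    have "(f x / ?a) * (g x / ?b) \<le> (f x / ?a) powr p / p + (g x / ?b) powr q / q"
      using nn that ab by (intro Youngs_inequality pq) auto
    also have "\<dots> = f x powr p * (1 / (A * p)) + g x powr q * (1 / (B * q))"
      using nn that AB pq by (simp add: powr_divide powr_powr)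
    finally show ?thesis using ab by (simp add: field_simps)
  qed
  have ennreal_lin: "ennreal (c * (a * d + b * e)) = ennreal c * (ennreal a * ennreal d + ennreal b * ennreal e)"
    if "c \<ge> 0" "a \<ge> 0" "d \<ge> 0" "b \<ge> 0" "e \<ge> 0" for a b c d e :: real
    using that by (simp add: ennreal_mult)
  have "(\<integral>\<^sup>+x. ennreal (f x * g x) \<partial>M)
     \<le> (\<integral>\<^sup>+x. ennreal (?a * ?b) * (ennreal (f x powr p) * ennreal (1 / (A * p)) + ennreal (g x powr q) * ennreal (1 / (B * q))) \<partial>M)"
  proof (rule nn_integral_mono)
    fix x assume "x \<in> space M"
    then have "ennreal (f x * g x) \<le> ennreal (?a * ?b * (f x powr p * (1 / (A * p)) + g x powr q * (1 / (B * q))))"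
      by (intro ennreal_leI pw)
    also have "\<dots> = ennreal (?a * ?b) * (ennreal (f x powr p) * ennreal (1 / (A * p)) + ennreal (g x powr q) * ennreal (1 / (B * q)))"
      using AB pq by (intro ennreal_lin) auto
    finally show "ennreal (f x * g x) \<le> ennreal (?a * ?b) * (ennreal (f x powr p) * ennreal (1 / (A * p)) + ennreal (g x powr q) * ennreal (1 / (B * q)))" .
  qed
  also have "\<dots> = ennreal (?a * ?b) * ((\<integral>\<^sup>+x. ennreal (f x powr p) \<partial>M) * ennreal (1 / (A * p))
      + (\<integral>\<^sup>+x. ennreal (g x powr q) \<partial>M) * ennreal (1 / (B * q)))"
    using f g by (subst nn_integral_cmult, measurable, subst nn_integral_add) (auto simp: nn_integral_multc)
  also have "\<dots> \<le> ennreal (?a * ?b) * (ennreal A * ennreal (1 / (A * p)) + ennreal B * ennreal (1 / (B * q)))"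
    using le by (intro mult_left_mono add_mono mult_right_mono) auto
  also have "ennreal A * ennreal (1 / (A * p)) = ennreal (1 / p)"
    using AB pq by (subst ennreal_mult'[symmetric]) auto
  also have "ennreal B * ennreal (1 / (B * q)) = ennreal (1 / q)"
    using AB pq by (subst ennreal_mult'[symmetric]) auto
  also have "ennreal (1 / p) + ennreal (1 / q) = 1"
    using pq by (subst ennreal_plus[symmetric]) auto
  finally show ?thesis by simp
qed

text \<open>Real valued, to feed the real inequalities on the tree. An infinite integral is read as
  0, hence the finiteness assumptions in the lemmas on \<open>mass\<close>.\<close>

definition mass :: "(complex \<Rightarrow> real) \<Rightarrow> complex set \<Rightarrow> real" where
  "mass h S = enn2real (\<integral>\<^sup>+z. ennreal (h z) * indicator S z \<partial>dA)"

lemma mass_nonneg [simp]: "mass h S \<ge> 0"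
  by (simp add: mass_def)

lemma nn_integral_disc_mono_set:
  "(\<integral>\<^sup>+z. ennreal (h z) * indicator S z \<partial>dA) \<le> (\<integral>\<^sup>+z. ennreal (h z) \<partial>dA)"
  by (intro nn_integral_mono) (auto simp: indicator_def)

lemma ennreal_mass:
  assumes "(\<integral>\<^sup>+z. ennreal (h z) \<partial>dA) < top"
  shows "ennreal (mass h S) = (\<integral>\<^sup>+z. ennreal (h z) * indicator S z \<partial>dA)"
  using order_le_less_trans[OF nn_integral_disc_mono_set[of h S] assms] by (simp add: mass_def)

lemma box_sets_disc: "carleson_box \<alpha> k j \<in> sets dA" "box_top \<alpha> k j \<in> sets dA"
  using box_lebesgue[of \<alpha> k j] carleson_box_subset[of \<alpha> k j] box_top_subset[of \<alpha> k j]
  by (auto simp: sets_restrict_space_iff)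

lemma mass_split:
  assumes fin: "(\<integral>\<^sup>+z. ennreal (h z) \<partial>dA) < top" and h: "h \<in> borel_measurable dA"
  shows "mass h (carleson_box \<alpha> k j) = mass h (carleson_box \<alpha> (Suc k) (2 * j))
    + mass h (carleson_box \<alpha> (Suc k) (Suc (2 * j))) + mass h (box_top \<alpha> k j)"
proof -
  have ind: "indicator (carleson_box \<alpha> k j) z = indicator (carleson_box \<alpha> (Suc k) (2 * j)) z
      + indicator (carleson_box \<alpha> (Suc k) (Suc (2 * j))) z + (indicator (box_top \<alpha> k j) z :: ennreal)" for z
    unfolding carleson_box_split[of \<alpha> k j]
    using carleson_box_disjoint(1)[of \<alpha> k j] carleson_box_disjoint(2)[of \<alpha> k "2 * j" j]
      carleson_box_disjoint(2)[of \<alpha> k "Suc (2 * j)" j] by (auto simp: indicator_def)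
  have "ennreal (mass h (carleson_box \<alpha> k j)) = ennreal (mass h (carleson_box \<alpha> (Suc k) (2 * j)))
    + ennreal (mass h (carleson_box \<alpha> (Suc k) (Suc (2 * j)))) + ennreal (mass h (box_top \<alpha> k j))"
  proof -
    let ?g = "\<lambda>S z. ennreal (h z) * indicator S z"
    have m: "?g S \<in> borel_measurable dA" if "S \<in> sets dA" for S
      using h that by (intro borel_measurable_times_ennreal measurable_compose[OF h measurable_ennreal]
        borel_measurable_indicator)
    have "(\<integral>\<^sup>+z. ?g (carleson_box \<alpha> k j) z \<partial>dA) = (\<integral>\<^sup>+z. (?g (carleson_box \<alpha> (Suc k) (2 * j)) z
      + ?g (carleson_box \<alpha> (Suc k) (Suc (2 * j))) z) + ?g (box_top \<alpha> k j) z \<partial>dA)"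
      by (simp only: ind distrib_left)
    then show ?thesis
      unfolding ennreal_mass[OF fin] by (simp only: nn_integral_add m box_sets_disc borel_measurable_add)
  qed
  then show ?thesis
    by (simp flip: ennreal_plus)
qed

lemma mass_mono_set:
  assumes fin: "(\<integral>\<^sup>+z. ennreal (h z) \<partial>dA) < top" and "S \<subseteq> T"
  shows "mass h S \<le> mass h T"
proof -
  have "ennreal (mass h S) \<le> ennreal (mass h T)"
    unfolding ennreal_mass[OF fin] using assms(2)
    by (intro nn_integral_mono) (auto simp: indicator_def)
  then show ?thesis by simp
qed

text \<open>\<open>dual\<close> says s = u^(-1/(p-1)) in a form symmetric under exchanging (p, u)
  with (q, s), so each estimate also holds with the roles exchanged. Positivity at every point
  avoids exceptional sets.\<close>

locale dual_pair =
  fixes p q :: real and u s :: "complex \<Rightarrow> real"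
  assumes p: "p > 1" and q: "q > 1" and pq: "1 / p + 1 / q = 1"
    and u_meas: "u \<in> borel_measurable dA" and s_meas: "s \<in> borel_measurable dA"
    and u_pos: "\<And>z. z \<in> \<bbbD> \<Longrightarrow> u z > 0" and s_pos: "\<And>z. z \<in> \<bbbD> \<Longrightarrow> s z > 0"
    and dual: "\<And>z. z \<in> \<bbbD> \<Longrightarrow> u z powr (1 / p) * s z powr (1 / q) = 1"
    and u_fin: "(\<integral>\<^sup>+z. ennreal (u z) \<partial>dA) < top" and s_fin: "(\<integral>\<^sup>+z. ennreal (s z) \<partial>dA) < top"

text \<open>The A_p condition for boxes, multiplied out; \<open>(1/4) ^ k\<close> takes the place of
  the area of a box of level k.\<close>

locale weight_pair = dual_pair p q u s for p q u s +
  fixes X :: real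
  assumes X: "X > 0"
    and Ap: "\<And>\<alpha> k j. mass u (carleson_box \<alpha> k j) * mass s (carleson_box \<alpha> k j) powr (p - 1)
        \<le> X * ((1/4) ^ k) powr p"

context dual_pair
begin

lemma dual_pair_swap: "dual_pair q p s u"
  by unfold_locales
    (use p q pq u_meas s_meas u_pos s_pos u_fin s_fin dual in \<open>auto simp: add.commute mult.commute\<close>)

text \<open>Hoelder's inequality for the factors f u^(1/p) and s^(1/q), whose product is f by
  \<open>dual\<close>.\<close>

lemma Holder_mass:
  assumes f: "f \<in> borel_measurable dA" "\<And>z. z \<in> \<bbbD> \<Longrightarrow> f z \<ge> 0"
    and fin: "(\<integral>\<^sup>+z. ennreal (f z powr p * u z) \<partial>dA) < top"
    and S: "S \<in> sets dA"
  shows "(\<integral>\<^sup>+z. ennreal (f z) * indicator S z \<partial>dA)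
    \<le> ennreal (mass (\<lambda>z. f z powr p * u z) S powr (1 / p) * mass s S powr (1 / q))"
proof -
  let ?F = "\<lambda>z. f z * u z powr (1 / p) * indicator S z" and ?G = "\<lambda>z. s z powr (1 / q) * indicator S z"
  have "(\<integral>\<^sup>+z. ennreal (?F z * ?G z) \<partial>dA)
    \<le> ennreal (mass (\<lambda>z. f z powr p * u z) S powr (1 / p) * mass s S powr (1 / q))"
  proof (rule Holder_nn_integral_bound[OF p q pq])
    show "(\<integral>\<^sup>+z. ennreal (?F z powr p) \<partial>dA) \<le> ennreal (mass (\<lambda>z. f z powr p * u z) S)"
      unfolding ennreal_mass[OF fin] using u_pos f(2) p
      by (intro nn_integral_mono) (auto simp: powr_mult powr_powr indicator_def less_imp_le)
    show "(\<integral>\<^sup>+z. ennreal (?G z powr q) \<partial>dA) \<le> ennreal (mass s S)"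
      unfolding ennreal_mass[OF s_fin] using s_pos q
      by (intro nn_integral_mono) (auto simp: powr_mult powr_powr indicator_def less_imp_le)
    show "?F \<in> borel_measurable dA" "?G \<in> borel_measurable dA"
      using f(1) u_meas s_meas S by measurable
  qed (use f(2) in \<open>auto simp: indicator_def\<close>)
  moreover have "(\<integral>\<^sup>+z. ennreal (?F z * ?G z) \<partial>dA) = (\<integral>\<^sup>+z. ennreal (f z) * indicator S z \<partial>dA)"
    using dual by (intro nn_integral_cong) (auto simp: indicator_def mult.assoc)
  ultimately show ?thesis by simp
qed

end

context dual_pair
begin

text \<open>The case f = 1 of \<open>Holder_mass\<close>: neither weighted mass of a top can
  degenerate, since their geometric mean dominates its area.\<close>

lemma box_top_lower:
  assumes "j < 2 ^ k"
  shows "(1/4) ^ k / 4 \<le> mass u (box_top \<alpha> k j) powr (1 / p) * mass s (box_top \<alpha> k j) powr (1 / q)"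
proof -
  have "ennreal ((1/4) ^ k / 4) \<le> emeasure area (box_top \<alpha> k j)"
    by (rule emeasure_box_top[OF assms])
  also have "\<dots> = emeasure dA (box_top \<alpha> k j)"
    using box_top_subset[of \<alpha> k j] carleson_box_subset[of \<alpha> k j]
    by (subst emeasure_restrict_space) auto
  also have "\<dots> = (\<integral>\<^sup>+z. ennreal 1 * indicator (box_top \<alpha> k j) z \<partial>dA)"
    using box_sets_disc by simp
  also have "\<dots> \<le> ennreal (mass (\<lambda>z. 1 powr p * u z) (box_top \<alpha> k j) powr (1 / p)
      * mass s (box_top \<alpha> k j) powr (1 / q))"
    by (rule Holder_mass) (use u_fin box_sets_disc in auto)
  finally show ?thesis by simp
qed

lemma box_top_mass_pos:
  assumes "j < 2 ^ k"
  shows "mass u (box_top \<alpha> k j) > 0" "mass s (box_top \<alpha> k j) > 0"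
proof -
  have "0 < (1/4::real) ^ k / 4" by simp
  then have "0 < mass u (box_top \<alpha> k j) powr (1 / p) * mass s (box_top \<alpha> k j) powr (1 / q)"
    using box_top_lower[OF assms, of \<alpha>] by linarith
  then have "mass u (box_top \<alpha> k j) \<noteq> 0" "mass s (box_top \<alpha> k j) \<noteq> 0" by auto
  then show "mass u (box_top \<alpha> k j) > 0" "mass s (box_top \<alpha> k j) > 0"
    by (simp_all add: order_less_le)
qed

lemma box_mass_pos:
  assumes "j < 2 ^ k"
  shows "mass u (carleson_box \<alpha> k j) > 0" "mass s (carleson_box \<alpha> k j) > 0"
  using box_top_mass_pos[OF assms, of \<alpha>] mass_mono_set[OF u_fin box_top_subset, of \<alpha> k j]
    mass_mono_set[OF s_fin box_top_subset, of \<alpha> k j] by linarith+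

lemma mass_powr_le:
  assumes f: "f \<in> borel_measurable dA" "\<And>z. z \<in> \<bbbD> \<Longrightarrow> f z \<ge> 0"
    and fin: "(\<integral>\<^sup>+z. ennreal (f z powr p * u z) \<partial>dA) < top"
    and S: "S \<in> sets dA" and sS: "mass s S > 0"
  shows "mass f S powr p / mass s S powr (p - 1) \<le> mass (\<lambda>z. f z powr p * u z) S"
proof -
  let ?F = "mass (\<lambda>z. f z powr p * u z) S"
  have "mass f S \<le> ?F powr (1 / p) * mass s S powr (1 / q)"
    using Holder_mass[OF f fin S] unfolding mass_def[of f]
    by (intro enn2real_leI) auto
  then have "mass f S powr p \<le> (?F powr (1 / p) * mass s S powr (1 / q)) powr p"
    using p by (intro powr_mono2) auto
  also have "\<dots> = ?F * mass s S powr (p / q)"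
    using p by (simp add: powr_mult powr_powr)
  also have "p / q = p - 1" using p by (subst conj_exponent_eq[OF p pq]) simp
  finally show ?thesis using sS by (simp add: field_simps)
qed

lemma integrable_from_weighted:
  assumes f: "f \<in> borel_measurable dA" "\<And>z. z \<in> \<bbbD> \<Longrightarrow> f z \<ge> 0"
    and fin: "(\<integral>\<^sup>+z. ennreal (f z powr p * u z) \<partial>dA) < top"
  shows "(\<integral>\<^sup>+z. ennreal (f z) \<partial>dA) < top"
proof -
  have D: "\<bbbD> \<in> sets dA" using sets.top[of dA] by (simp only: space_area_on)
  have "(\<integral>\<^sup>+z. ennreal (f z) * indicator \<bbbD> z \<partial>dA)
    \<le> ennreal (mass (\<lambda>z. f z powr p * u z) \<bbbD> powr (1 / p) * mass s \<bbbD> powr (1 / q))"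
    by (rule Holder_mass[OF f fin D])
  moreover have "(\<integral>\<^sup>+z. ennreal (f z) * indicator \<bbbD> z \<partial>dA) = (\<integral>\<^sup>+z. ennreal (f z) \<partial>dA)"
    by (intro nn_integral_cong) auto
  ultimately show ?thesis using ennreal_less_top order_le_less_trans by metis
qed

text \<open>For f = F s the quotient is the s-average of F over the box and f^p u = F^p s, so this
  is the dyadic Carleson embedding for the measure s dA. The tops are disjoint, hence the constant
  depends on p and not on s.\<close>

lemma carleson_embedding:
  assumes f: "f \<in> borel_measurable dA" "\<And>z. z \<in> \<bbbD> \<Longrightarrow> f z \<ge> 0"
    and fin: "(\<integral>\<^sup>+z. ennreal (f z powr p * u z) \<partial>dA) < top"
  shows "(\<Sum>k<n. \<Sum>j<2 ^ k. mass s (box_top \<alpha> k j) * (mass f (carleson_box \<alpha> k j) / mass s (carleson_box \<alpha> k j)) powr p)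
    \<le> 2 powr p / (p - 1) * mass (\<lambda>z. f z powr p * u z) \<bbbD>"
proof -
  have split: "mass h (carleson_box \<alpha> (Suc k) (2 * j)) + mass h (carleson_box \<alpha> (Suc k) (Suc (2 * j)))
      + mass h (box_top \<alpha> k j) = mass h (carleson_box \<alpha> k j)"
    if "h \<in> {s, f, \<lambda>z. f z powr p * u z}" for h k j
  proof -
    have "h \<in> borel_measurable dA" using that f(1) u_meas s_meas by auto
    moreover have "(\<integral>\<^sup>+z. ennreal (h z) \<partial>dA) < top" using that fin s_fin integrable_from_weighted[OF f fin] by auto
    ultimately show ?thesis by (rule mass_split[symmetric, rotated])
  qed
  note le = mass_powr_le[OF f fin]
  have "(\<Sum>k<n. \<Sum>j<2 ^ k. mass s (box_top \<alpha> k j) * (mass f (carleson_box \<alpha> k j) / mass s (carleson_box \<alpha> k j)) powr p)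
    \<le> 2 powr p / (p - 1) * mass (\<lambda>z. f z powr p * u z) (carleson_box \<alpha> 0 0)"
    by (rule tree_carleson[where IE = "\<lambda>k j. mass f (box_top \<alpha> k j)"
        and FE = "\<lambda>k j. mass (\<lambda>z. f z powr p * u z) (box_top \<alpha> k j)"])
      (use p box_mass_pos box_top_mass_pos split le box_sets_disc in simp_all)
  then show ?thesis by (simp add: carleson_box_root)
qed

end

lemma (in weight_pair) box_ratio:
  assumes "j < 2 ^ k"
  shows "mass u (carleson_box \<alpha> k j) * mass s (carleson_box \<alpha> k j) / (1/4) ^ k
    \<le> 4 powr (p + q) * X powr max 1 (1 / (p - 1))
      * (mass s (box_top \<alpha> k j) powr (1 / p) * mass u (box_top \<alpha> k j) powr (1 / q))"
  by (rule Ap_sparse[where d = "(1/4) ^ k / 4"])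
    (use p pq X box_mass_pos[OF assms] box_top_mass_pos[OF assms] Ap box_top_lower[OF assms]
      mass_mono_set[OF u_fin box_top_subset] mass_mono_set[OF s_fin box_top_subset] in auto)

text \<open>The factor of \<open>Ap_sparse\<close> times the p-th and q-th roots of the two
  embedding constants.\<close>

definition sparse_const :: "real \<Rightarrow> real \<Rightarrow> real" where
  "sparse_const p q = 4 powr (p + q) * (2 powr p / (p - 1)) powr (1 / p) * (2 powr q / (q - 1)) powr (1 / q)"

text \<open>With 4^-k for |Q|, each term is u(Q) s(Q) / |Q| times the s-average of f / s and the
  u-average of g / u. \<open>box_ratio\<close> splits the first factor between the two masses of the
  top, and Hoelder's inequality for sums then separates the two embeddings.\<close>

lemma (in weight_pair) sparse_form_bound:
  assumes f: "f \<in> borel_measurable dA" "\<And>z. z \<in> \<bbbD> \<Longrightarrow> f z \<ge> 0"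
    and g: "g \<in> borel_measurable dA" "\<And>z. z \<in> \<bbbD> \<Longrightarrow> g z \<ge> 0"
    and A: "A > 0" "(\<integral>\<^sup>+z. ennreal (f z powr p * u z) \<partial>dA) \<le> ennreal A"
    and B: "B > 0" "(\<integral>\<^sup>+z. ennreal (g z powr q * s z) \<partial>dA) \<le> ennreal B"
  shows "(\<Sum>k<n. \<Sum>j<2 ^ k. 4 ^ k * mass f (carleson_box \<alpha> k j) * mass g (carleson_box \<alpha> k j))
    \<le> sparse_const p q * X powr max 1 (1 / (p - 1)) * A powr (1 / p) * B powr (1 / q)"
proof -
  interpret dual: dual_pair q p s u by (rule dual_pair_swap)
  let ?f = "\<lambda>k j. mass f (carleson_box \<alpha> k j)" and ?g = "\<lambda>k j. mass g (carleson_box \<alpha> k j)"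
  let ?u = "\<lambda>k j. mass u (carleson_box \<alpha> k j)" and ?s = "\<lambda>k j. mass s (carleson_box \<alpha> k j)"
  let ?uE = "\<lambda>k j. mass u (box_top \<alpha> k j)" and ?sE = "\<lambda>k j. mass s (box_top \<alpha> k j)"
  let ?x = "\<lambda>k j. ?sE k j powr (1 / p) * (?f k j / ?s k j)"
  let ?y = "\<lambda>k j. ?uE k j powr (1 / q) * (?g k j / ?u k j)"
  let ?K = "4 powr (p + q) * X powr max 1 (1 / (p - 1))"
  let ?P = "2 powr p / (p - 1)" and ?Q = "2 powr q / (q - 1)"
  have finA: "(\<integral>\<^sup>+z. ennreal (f z powr p * u z) \<partial>dA) < top"
    and finB: "(\<integral>\<^sup>+z. ennreal (g z powr q * s z) \<partial>dA) < top"
    using A(2) B(2) ennreal_less_top order_le_less_trans by metis+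
  have mass_le: "mass h \<bbbD> \<le> C" if "(\<integral>\<^sup>+z. ennreal (h z) \<partial>dA) \<le> ennreal C" "C > 0" for h C
    using order_trans[OF nn_integral_disc_mono_set that(1), of \<bbbD>] that(2)
    unfolding mass_def by (intro enn2real_leI) auto
  have "(\<Sum>k<n. \<Sum>j<2 ^ k. ?sE k j * (?f k j / ?s k j) powr p) \<le> ?P * mass (\<lambda>z. f z powr p * u z) \<bbbD>"
    by (rule carleson_embedding[OF f finA])
  also have "\<dots> \<le> ?P * A" using p by (intro mult_left_mono mass_le A) auto
  finally have sumf: "(\<Sum>k<n. \<Sum>j<2 ^ k. ?x k j powr p) \<le> ?P * A"
    using p by (simp add: powr_mult powr_powr powr_divide)
  have "(\<Sum>k<n. \<Sum>j<2 ^ k. ?uE k j * (?g k j / ?u k j) powr q) \<le> ?Q * mass (\<lambda>z. g z powr q * s z) \<bbbD>"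
    by (rule dual.carleson_embedding[OF g finB])
  also have "\<dots> \<le> ?Q * B" using q by (intro mult_left_mono mass_le B) auto
  finally have sumg: "(\<Sum>k<n. \<Sum>j<2 ^ k. ?y k j powr q) \<le> ?Q * B"
    using q by (simp add: powr_mult powr_powr powr_divide)
  have box_le: "4 ^ k * ?f k j * ?g k j \<le> ?K * (?x k j * ?y k j)" if "j < 2 ^ k" for k j
  proof -
    have pos: "?s k j > 0" "?u k j > 0" using box_mass_pos[OF that] by auto
    have "4 ^ k * ?f k j * ?g k j = (?u k j * ?s k j / (1/4) ^ k) * ((?f k j / ?s k j) * (?g k j / ?u k j))"
      using pos by (simp add: power_one_over)
    also have "\<dots> \<le> ?K * (?sE k j powr (1 / p) * ?uE k j powr (1 / q)) * ((?f k j / ?s k j) * (?g k j / ?u k j))"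
      using pos by (intro mult_right_mono box_ratio[OF that]) auto
    finally show ?thesis by (simp add: mult_ac)
  qed
  define T where "T = (SIGMA k:{..<n}. {..<2 ^ k :: nat})"
  have "(\<Sum>k<n. \<Sum>j<2 ^ k. 4 ^ k * ?f k j * ?g k j) \<le> (\<Sum>k<n. \<Sum>j<2 ^ k. ?K * (?x k j * ?y k j))"
    by (intro sum_mono box_le) auto
  also have "\<dots> = ?K * (\<Sum>(k, j)\<in>T. ?x k j * ?y k j)"
    unfolding T_def by (subst sum.Sigma[symmetric]) (auto simp: sum_distrib_left)
  also have "\<dots> = ?K * (\<Sum>i\<in>T. ?x (fst i) (snd i) * ?y (fst i) (snd i))"
    by (simp add: case_prod_unfold)
  also have "\<dots> \<le> ?K * ((?P * A) powr (1 / p) * (?Q * B) powr (1 / q))"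
  proof (intro mult_left_mono Holder_sum_bound[OF p q pq])
    show "(\<Sum>i\<in>T. (?x (fst i) (snd i)) powr p) \<le> ?P * A"
      using sumf unfolding T_def by (subst (asm) sum.Sigma) (auto simp: case_prod_unfold)
    show "(\<Sum>i\<in>T. (?y (fst i) (snd i)) powr q) \<le> ?Q * B"
      using sumg unfolding T_def by (subst (asm) sum.Sigma) (auto simp: case_prod_unfold)
  qed (use p q A B in auto)
  also have "\<dots> = sparse_const p q * X powr max 1 (1 / (p - 1)) * A powr (1 / p) * B powr (1 / q)"
  proof -
    have "(?P * A) powr (1 / p) = ?P powr (1 / p) * A powr (1 / p)"
      by (rule powr_mult)
    moreover have "(?Q * B) powr (1 / q) = ?Q powr (1 / q) * B powr (1 / q)"
      by (rule powr_mult)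
    ultimately show ?thesis by (simp only: sparse_const_def mult_ac)
  qed
  finally show ?thesis .
qed

section \<open>The positive Bergman operator on weighted L^p\<close>

definition berg_kernel :: "complex \<Rightarrow> complex \<Rightarrow> real" where
  "berg_kernel z w = 1 / (cmod (1 - z * cnj w))\<^sup>2"

abbreviation berg_plus :: "(complex \<Rightarrow> real) \<Rightarrow> complex \<Rightarrow> ennreal" where
  "berg_plus f z \<equiv> \<integral>\<^sup>+w. ennreal (f w) * ennreal (berg_kernel z w) \<partial>dA"

text \<open>One box holding both points already dominates; the other terms of the sum are
  nonnegative.\<close>

lemma berg_kernel_le:
  assumes "z \<in> \<bbbD>" "w \<in> \<bbbD>"
  shows "ennreal (berg_kernel z w) \<le> (\<Sum>\<alpha>\<in>{0, 1/3}. \<Sum>k. \<Sum>j<2 ^ k. ennreal (16 * 4 ^ k)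
    * (indicator (carleson_box \<alpha> k j) z * indicator (carleson_box \<alpha> k j) w))"
    (is "_ \<le> (\<Sum>\<alpha>\<in>_. \<Sum>k. \<Sum>j<2 ^ k. ?t \<alpha> k j)")
proof -
  obtain \<alpha> k where \<alpha>k: "\<alpha> \<in> {0, 1/3}" "z \<in> carleson_box \<alpha> k (cell \<alpha> k z)" "w \<in> carleson_box \<alpha> k (cell \<alpha> k z)"
    "1 / (cmod (1 - z * cnj w))\<^sup>2 \<le> 16 * 4 ^ k"
    by (rule bergman_kernel_box[OF assms])
  have "ennreal (berg_kernel z w) \<le> ennreal (16 * 4 ^ k)"
    unfolding berg_kernel_def by (intro ennreal_leI \<alpha>k(4))
  also have "\<dots> = ?t \<alpha> k (cell \<alpha> k z)" using \<alpha>k(2,3) by simp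
  also have "\<dots> \<le> (\<Sum>j<2 ^ k. ?t \<alpha> k j)"
    using cell_less[of \<alpha> k z] by (intro member_le_sum) auto
  also have "\<dots> \<le> (\<Sum>k. \<Sum>j<2 ^ k. ?t \<alpha> k j)"
    using sum_le_suminf[of "\<lambda>k. \<Sum>j<2 ^ k. ?t \<alpha> k j" "{k}"] by (simp add: summableI)
  also have "\<dots> \<le> (\<Sum>\<alpha>\<in>{0, 1/3}. \<Sum>k. \<Sum>j<2 ^ k. ?t \<alpha> k j)"
    by (rule member_le_sum[OF \<alpha>k(1), of "\<lambda>\<alpha>. \<Sum>k. \<Sum>j<2 ^ k. ?t \<alpha> k j"]) auto
  finally show ?thesis .
qed

text \<open>Integrals and sums of nonnegative terms commute, leaving the sparse form of each grid,
  whose partial sums are bounded uniformly. The constant 32 is the 16 of the kernel bound times two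
  grids.\<close>

lemma (in weight_pair) bilinear_bound:
  assumes f: "f \<in> borel_measurable dA" "\<And>z. z \<in> \<bbbD> \<Longrightarrow> f z \<ge> 0"
    and g: "g \<in> borel_measurable dA" "\<And>z. z \<in> \<bbbD> \<Longrightarrow> g z \<ge> 0"
    and A: "A > 0" "(\<integral>\<^sup>+z. ennreal (f z powr p * u z) \<partial>dA) \<le> ennreal A"
    and B: "B > 0" "(\<integral>\<^sup>+z. ennreal (g z powr q * s z) \<partial>dA) \<le> ennreal B"
  shows "(\<integral>\<^sup>+z. ennreal (g z) * berg_plus f z \<partial>dA)
    \<le> ennreal (32 * sparse_const p q * X powr max 1 (1 / (p - 1)) * A powr (1 / p) * B powr (1 / q))"
proof -
  interpret dual: dual_pair q p s u by (rule dual_pair_swap)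
  let ?R = "sparse_const p q * X powr max 1 (1 / (p - 1)) * A powr (1 / p) * B powr (1 / q)"
  let ?M = "dA"
  let ?i = "\<lambda>\<alpha> k j z. indicator (carleson_box \<alpha> k j) z :: ennreal"
  have finf: "(\<integral>\<^sup>+z. ennreal (f z) \<partial>?M) < top"
    by (rule integrable_from_weighted[OF f order_le_less_trans[OF A(2) ennreal_less_top]])
  have fing: "(\<integral>\<^sup>+z. ennreal (g z) \<partial>?M) < top"
    by (rule dual.integrable_from_weighted[OF g order_le_less_trans[OF B(2) ennreal_less_top]])
  have [measurable]: "(\<lambda>z. ennreal (f z)) \<in> borel_measurable ?M" "(\<lambda>z. ennreal (g z)) \<in> borel_measurable ?M"
    using f(1) g(1) by measurable
  have [measurable]: "?i \<alpha> k j \<in> borel_measurable ?M" for \<alpha> k j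
    using box_sets_disc(1) by (rule borel_measurable_indicator)
  have inner: "berg_plus f z
      \<le> (\<Sum>\<alpha>\<in>{0, 1/3}. \<Sum>k. \<Sum>j<2 ^ k. ennreal (16 * 4 ^ k * mass f (carleson_box \<alpha> k j)) * ?i \<alpha> k j z)"
    if "z \<in> \<bbbD>" for z
  proof -
    have "berg_plus f z
      \<le> (\<integral>\<^sup>+w. (\<Sum>\<alpha>\<in>{0, 1/3}. \<Sum>k. \<Sum>j<2 ^ k. ennreal (16 * 4 ^ k) * ?i \<alpha> k j z * (ennreal (f w) * ?i \<alpha> k j w)) \<partial>?M)"
    proof (rule nn_integral_mono)
      fix w assume "w \<in> space ?M"
      then have "ennreal (f w) * ennreal (berg_kernel z w) \<le> ennreal (f w)
        * (\<Sum>\<alpha>\<in>{0, 1/3}. \<Sum>k. \<Sum>j<2 ^ k. ennreal (16 * 4 ^ k) * (?i \<alpha> k j z * ?i \<alpha> k j w))"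
        using that by (intro mult_left_mono berg_kernel_le) auto
      also have "\<dots> = (\<Sum>\<alpha>\<in>{0, 1/3}. \<Sum>k. \<Sum>j<2 ^ k. ennreal (16 * 4 ^ k) * ?i \<alpha> k j z * (ennreal (f w) * ?i \<alpha> k j w))"
        by (simp only: sum_distrib_left ennreal_suminf_cmult[symmetric] mult_ac)
      finally show "ennreal (f w) * ennreal (berg_kernel z w) \<le> \<dots>" .
    qed
    also have "\<dots> = (\<Sum>\<alpha>\<in>{0, 1/3}. \<Sum>k. \<Sum>j<2 ^ k. ennreal (16 * 4 ^ k) * ?i \<alpha> k j z
        * (\<integral>\<^sup>+w. ennreal (f w) * ?i \<alpha> k j w \<partial>?M))"
      by (subst nn_integral_sum, measurable, intro sum.cong refl, subst nn_integral_suminf, measurable,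
          intro suminf_cong, subst nn_integral_sum, measurable, intro sum.cong refl nn_integral_cmult, measurable)
    also have "\<dots> = (\<Sum>\<alpha>\<in>{0, 1/3}. \<Sum>k. \<Sum>j<2 ^ k. ennreal (16 * 4 ^ k * mass f (carleson_box \<alpha> k j)) * ?i \<alpha> k j z)"
    proof -
      have "ennreal (16 * 4 ^ k) * ?i \<alpha> k j z * (\<integral>\<^sup>+w. ennreal (f w) * ?i \<alpha> k j w \<partial>?M)
        = ennreal (16 * 4 ^ k * mass f (carleson_box \<alpha> k j)) * ?i \<alpha> k j z" for \<alpha> k j
        by (subst ennreal_mass[OF finf, symmetric], subst ennreal_mult''[OF mass_nonneg]) (simp only: mult_ac)
      then show ?thesis by (simp only:)
    qed
    finally show ?thesis .
  qed
  have "(\<integral>\<^sup>+z. ennreal (g z) * berg_plus f z \<partial>?M)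
    \<le> (\<integral>\<^sup>+z. (\<Sum>\<alpha>\<in>{0, 1/3}. \<Sum>k. \<Sum>j<2 ^ k. ennreal (16 * 4 ^ k * mass f (carleson_box \<alpha> k j)) * (ennreal (g z) * ?i \<alpha> k j z)) \<partial>?M)"
  proof (rule nn_integral_mono)
    fix z assume "z \<in> space ?M"
    then have "ennreal (g z) * berg_plus f z \<le> ennreal (g z) *
       (\<Sum>\<alpha>\<in>{0, 1/3}. \<Sum>k. \<Sum>j<2 ^ k. ennreal (16 * 4 ^ k * mass f (carleson_box \<alpha> k j)) * ?i \<alpha> k j z)"
      by (intro mult_left_mono inner) auto
    also have "\<dots> = (\<Sum>\<alpha>\<in>{0, 1/3}. \<Sum>k. \<Sum>j<2 ^ k. ennreal (16 * 4 ^ k * mass f (carleson_box \<alpha> k j)) * (ennreal (g z) * ?i \<alpha> k j z))"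
      by (simp only: sum_distrib_left ennreal_suminf_cmult[symmetric] mult_ac)
    finally show "ennreal (g z) * berg_plus f z \<le> \<dots>" .
  qed
  also have "\<dots> = (\<Sum>\<alpha>\<in>{0, 1/3}. \<Sum>k. \<Sum>j<2 ^ k. ennreal (16 * 4 ^ k * mass f (carleson_box \<alpha> k j))
      * (\<integral>\<^sup>+z. ennreal (g z) * ?i \<alpha> k j z \<partial>?M))"
    by (subst nn_integral_sum, measurable, intro sum.cong refl, subst nn_integral_suminf, measurable,
          intro suminf_cong, subst nn_integral_sum, measurable, intro sum.cong refl nn_integral_cmult, measurable)
  also have "\<dots> = (\<Sum>\<alpha>\<in>{0, 1/3}. \<Sum>k. \<Sum>j<2 ^ k.
      ennreal (16 * (4 ^ k * mass f (carleson_box \<alpha> k j) * mass g (carleson_box \<alpha> k j))))"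
    by (simp only: ennreal_mass[OF fing, symmetric] ennreal_mult''[OF mass_nonneg, symmetric] mult.assoc[where ?'a = real])
  also have "\<dots> \<le> (\<Sum>\<alpha>\<in>{0, 1/3::real}. ennreal (16 * ?R))"
  proof (intro sum_mono suminf_le_const summableI)
    fix \<alpha> :: real and n
    have "(\<Sum>k<n. \<Sum>j<2 ^ k. ennreal (16 * (4 ^ k * mass f (carleson_box \<alpha> k j) * mass g (carleson_box \<alpha> k j))))
      = ennreal (16 * (\<Sum>k<n. \<Sum>j<2 ^ k. 4 ^ k * mass f (carleson_box \<alpha> k j) * mass g (carleson_box \<alpha> k j)))"
      by (simp add: sum_ennreal sum_distrib_left sum_nonneg)
    also have "\<dots> \<le> ennreal (16 * ?R)"
      by (intro ennreal_leI mult_left_mono sparse_form_bound f g A B) auto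
    finally show "(\<Sum>k<n. \<Sum>j<2 ^ k. ennreal (16 * (4 ^ k * mass f (carleson_box \<alpha> k j) * mass g (carleson_box \<alpha> k j))))
      \<le> ennreal (16 * ?R)" .
  qed
  also have "\<dots> = ennreal (32 * ?R)"
  proof -
    have two: "(\<Sum>\<alpha>\<in>{0, 1/3::real}. ennreal (16 * r)) = ennreal (32 * r)" if "r \<ge> 0" for r
    proof -
      have "ennreal (32 * r) = ennreal (16 * r + 16 * r)" by simp
      also have "\<dots> = ennreal (16 * r) + ennreal (16 * r)" using that by (intro ennreal_plus) auto
      finally show ?thesis by (simp add: mult_2)
    qed
    show ?thesis by (rule two) (simp add: sparse_const_def)
  qed
  finally show ?thesis by (simp only: mult.assoc)
qed

text \<open>Duality with the extremal g = H^(p-1) u, for which both g H and g^q s equal H^p u. If I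
  is the integral of H^p u, the bilinear bound reads I \<le> K A^(1/p) I^(1/q), and I^(1/q) is
  cancelled.\<close>

lemma (in weight_pair) positive_operator_bound_aux:
  assumes f: "f \<in> borel_measurable dA" "\<And>z. z \<in> \<bbbD> \<Longrightarrow> f z \<ge> 0"
    and H: "H \<in> borel_measurable dA" "\<And>z. z \<in> \<bbbD> \<Longrightarrow> H z \<ge> 0"
    and H_le: "\<And>z. z \<in> \<bbbD> \<Longrightarrow> ennreal (H z) \<le> berg_plus f z"
    and bd: "\<And>z. z \<in> \<bbbD> \<Longrightarrow> H z \<le> b" and b: "b > 0"
    and A: "A > 0" "(\<integral>\<^sup>+z. ennreal (f z powr p * u z) \<partial>dA) \<le> ennreal A"
  shows "(\<integral>\<^sup>+z. ennreal (H z powr p * u z) \<partial>dA)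
    \<le> ennreal ((32 * sparse_const p q * X powr max 1 (1 / (p - 1))) powr p * A)"
proof -
  let ?M = "dA"
  let ?K = "32 * sparse_const p q * X powr max 1 (1 / (p - 1))"
  let ?I = "\<integral>\<^sup>+z. ennreal (H z powr p * u z) \<partial>?M"
  define g where "g z = H z powr (p - 1) * u z" for z
  have q2: "q = p / (p - 1)" by (rule conj_exponent_eq[OF p pq])
  have us: "u z powr q * s z = u z" if "z \<in> \<bbbD>" for z
  proof -
    have "(u z powr (1 / p) * s z powr (1 / q)) powr q = 1" using dual[OF that] by simp
    then have "u z powr (q / p) * s z = 1"
      using u_pos[OF that] s_pos[OF that] q by (simp add: powr_mult powr_powr)
    moreover have "q = 1 + q / p" using p by (simp add: q2 field_simps)
    then have "u z powr q = u z * u z powr (q / p)"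
      using powr_add[of "u z" 1 "q / p"] u_pos[OF that] by simp
    ultimately show ?thesis by (simp add: mult.assoc)
  qed
  have g_nn: "g z \<ge> 0" if "z \<in> \<bbbD>" for z using u_pos[OF that] by (simp add: g_def)
  have gq: "g z powr q * s z = H z powr p * u z" if "z \<in> \<bbbD>" for z
    using us[OF that] u_pos[OF that] H(2)[OF that] p by (simp add: g_def powr_mult powr_powr q2)
  have Hg: "H z * g z = H z powr p * u z" if "z \<in> \<bbbD>" for z
    using H(2)[OF that] p by (cases "H z = 0") (auto simp: g_def powr_diff)
  have g_meas: "g \<in> borel_measurable ?M" unfolding g_def using H(1) u_meas by measurable
  \<comment> \<open>The cancellation requires I to be finite; this is where the bound b on H
    enters.\<close>
  have "?I \<le> (\<integral>\<^sup>+z. ennreal (b powr p) * ennreal (u z) \<partial>?M)"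
    using bd H(2) b u_pos p
    by (intro nn_integral_mono) (auto simp: ennreal_mult[symmetric] less_imp_le intro!: ennreal_leI mult_right_mono powr_mono2)
  also have "\<dots> < top" using u_fin u_meas by (simp add: nn_integral_cmult ennreal_mult_less_top)
  finally have fin: "?I < top" .
  then obtain B where B: "?I = ennreal B" "B \<ge> 0" by (cases ?I) auto
  show ?thesis
  proof (cases "B = 0")
    case True
    then show ?thesis using B by simp
  next
    case False
    then have B0: "B > 0" using B by simp
    have "?I = (\<integral>\<^sup>+z. ennreal (g z) * ennreal (H z) \<partial>?M)"
    proof (rule nn_integral_cong)
      fix z assume "z \<in> space ?M"
      then have z: "z \<in> \<bbbD>" by simp
      have "ennreal (g z) * ennreal (H z) = ennreal (g z * H z)"
        using g_nn[OF z] H(2)[OF z] by (rule ennreal_mult[symmetric])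
      also have "g z * H z = H z powr p * u z" using Hg[OF z] by (simp add: mult.commute)
      finally show "ennreal (H z powr p * u z) = ennreal (g z) * ennreal (H z)" by simp
    qed
    also have "\<dots> \<le> (\<integral>\<^sup>+z. ennreal (g z) * berg_plus f z \<partial>?M)"
      using H_le by (intro nn_integral_mono mult_left_mono) auto
    also have "\<dots> \<le> ennreal (?K * A powr (1 / p) * B powr (1 / q))"
    proof (rule bilinear_bound[OF f g_meas g_nn A B0])
      have "(\<integral>\<^sup>+z. ennreal (g z powr q * s z) \<partial>?M) = ?I"
        using gq by (intro nn_integral_cong) auto
      then show "(\<integral>\<^sup>+z. ennreal (g z powr q * s z) \<partial>?M) \<le> ennreal B" using B by simp
    qed
    finally have "B \<le> ?K * A powr (1 / p) * B powr (1 / q)"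
      using B by (simp add: sparse_const_def)
    moreover have "B = B powr (1 / p) * B powr (1 / q)"
      using B0 pq by (simp add: powr_add[symmetric])
    ultimately have "B powr (1 / p) * B powr (1 / q) \<le> (?K * A powr (1 / p)) * B powr (1 / q)" by simp
    then have "B powr (1 / p) \<le> ?K * A powr (1 / p)" using B0 by simp
    then have "(B powr (1 / p)) powr p \<le> (?K * A powr (1 / p)) powr p"
      using p by (intro powr_mono2) auto
    also have "\<dots> = ?K powr p * (A powr (1 / p)) powr p"
      by (subst powr_mult) (auto simp: sparse_const_def)
    finally have "B \<le> ?K powr p * A" using B0 A p by (simp add: powr_powr)
    then show ?thesis using B by (simp add: ennreal_leI)
  qed
qed

text \<open>Stated for any measurable H below the positive operator, so that it applies directly to
  the modulus of the projection. The bound on H is removed by truncating at n + 1 and Fatou's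
  lemma.\<close>

lemma (in weight_pair) positive_operator_bound:
  assumes f: "f \<in> borel_measurable dA" "\<And>z. z \<in> \<bbbD> \<Longrightarrow> f z \<ge> 0"
    and H: "H \<in> borel_measurable dA" "\<And>z. z \<in> \<bbbD> \<Longrightarrow> H z \<ge> 0"
    and H_le: "\<And>z. z \<in> \<bbbD> \<Longrightarrow> ennreal (H z) \<le> berg_plus f z"
  shows "(\<integral>\<^sup>+z. ennreal (H z powr p * u z) \<partial>dA)
    \<le> ennreal ((32 * sparse_const p q * X powr max 1 (1 / (p - 1))) powr p)
      * (\<integral>\<^sup>+z. ennreal (f z powr p * u z) \<partial>dA)"
proof -
  let ?M = "dA"
  let ?K = "(32 * sparse_const p q * X powr max 1 (1 / (p - 1))) powr p"
  let ?F = "\<integral>\<^sup>+z. ennreal (f z powr p * u z) \<partial>?M"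
  have K: "?K > 0" using p q X by (simp add: sparse_const_def)
  have bounded: "(\<integral>\<^sup>+z. ennreal (H z powr p * u z) \<partial>?M) \<le> ennreal (?K * A)"
    if A: "A > 0" "?F \<le> ennreal A" for A
  proof -
    have lim: "(\<lambda>n. min (H z) (real (Suc n))) \<longlonglongrightarrow> H z" for z
    proof (rule tendsto_eventually)
      obtain N where "H z \<le> real N" using real_arch_simple by blast
      then show "\<forall>\<^sub>F n in sequentially. min (H z) (real (Suc n)) = H z"
        by (intro eventually_sequentiallyI[of N]) (auto simp: min_def)
    qed
    have "(\<integral>\<^sup>+z. ennreal (H z powr p * u z) \<partial>?M)
      \<le> liminf (\<lambda>n. \<integral>\<^sup>+z. ennreal (min (H z) (real (Suc n)) powr p * u z) \<partial>?M)"
    proof -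
      have "(\<lambda>n. ennreal (min (H z) (real (Suc n)) powr p * u z)) \<longlonglongrightarrow> ennreal (H z powr p * u z)"
        if "z \<in> \<bbbD>" for z
        using p H(2)[OF that] by (intro tendsto_ennrealI tendsto_mult_right tendsto_powr' lim) auto
      then have "(\<integral>\<^sup>+z. ennreal (H z powr p * u z) \<partial>?M)
        = (\<integral>\<^sup>+z. liminf (\<lambda>n. ennreal (min (H z) (real (Suc n)) powr p * u z)) \<partial>?M)"
        by (intro nn_integral_cong lim_imp_Liminf[symmetric]) (simp_all del: of_nat_Suc)
      also have "\<dots> \<le> liminf (\<lambda>n. \<integral>\<^sup>+z. ennreal (min (H z) (real (Suc n)) powr p * u z) \<partial>?M)"
      proof (intro nn_integral_liminf)
        show "(\<lambda>z. ennreal (min (H z) (real (Suc n)) powr p * u z)) \<in> borel_measurable ?M" for n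
          using H(1) u_meas by (intro measurable_compose[OF _ measurable_ennreal] borel_measurable_times
            powr_real_measurable borel_measurable_min borel_measurable_const)
      qed
      finally show ?thesis .
    qed
    also have "\<dots> \<le> limsup (\<lambda>n. \<integral>\<^sup>+z. ennreal (min (H z) (real (Suc n)) powr p * u z) \<partial>?M)"
      by (intro Liminf_le_Limsup) simp
    also have "\<dots> \<le> ennreal (?K * A)"
    proof (intro Limsup_bounded always_eventually allI)
      fix n
      show "(\<integral>\<^sup>+z. ennreal (min (H z) (real (Suc n)) powr p * u z) \<partial>?M) \<le> ennreal (?K * A)"
      proof (rule positive_operator_bound_aux[OF f, where b = "real (Suc n)"])
        show "ennreal (min (H z) (real (Suc n))) \<le> berg_plus f z"
          if "z \<in> \<bbbD>" for z
          using H_le[OF that] by (rule order_trans[rotated]) (auto intro: ennreal_leI)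
      qed (use H A in auto)
    qed
    finally show ?thesis .
  qed
  show ?thesis
  proof (cases "?F = top")
    case True
    then show ?thesis using K by (simp add: ennreal_mult_top)
  next
    case False
    then obtain A where A: "?F = ennreal A" "A \<ge> 0" by (cases ?F) auto
    \<comment> \<open>\<open>bounded\<close> asks for A > 0, while the integral of f^p u may vanish;
      so A is enlarged by e / ?K, and e is arbitrary.\<close>
    have eps: "(\<integral>\<^sup>+z. ennreal (H z powr p * u z) \<partial>?M) \<le> ennreal (?K * A) + ennreal e" if "e > 0" for e
    proof -
      have "(\<integral>\<^sup>+z. ennreal (H z powr p * u z) \<partial>?M) \<le> ennreal (?K * (A + e / ?K))"
        using A K that by (intro bounded) (auto simp: ennreal_leI add_nonneg_pos)
      also have "?K * (A + e / ?K) = ?K * A + e" using K by (simp add: field_simps)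
      finally show ?thesis using A K that by simp
    qed
    have "(\<integral>\<^sup>+z. ennreal (H z powr p * u z) \<partial>?M) \<le> ennreal (?K * A)"
      by (rule ennreal_le_epsilon) (rule eps)
    also have "\<dots> = ennreal ?K * ennreal A" using K A(2) by (intro ennreal_mult) auto
    finally show ?thesis unfolding A(1) .
  qed
qed

section \<open>The Bergman projection of the disc\<close>

text \<open>The factor 1 / (1 - z cnj w)^2 is the Bergman kernel of the disc for area of total mass
  1.\<close>

definition disc_proj :: "(complex \<Rightarrow> complex) \<Rightarrow> complex \<Rightarrow> complex" where
  "disc_proj F z = (\<integral>w. F w / (1 - z * cnj w)\<^sup>2 \<partial>dA)"

lemma emeasure_disc: "emeasure dA \<bbbD> = 1"
  using emeasure_area_ball[of 1 0] by (simp add: emeasure_restrict_space)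

interpretation disc: finite_measure "dA"
  by (rule finite_measureI) (simp add: emeasure_disc)

lemma borel_measurable_cnj [measurable]: "cnj \<in> borel_measurable borel"
  by (intro borel_measurable_continuous_onI continuous_intros)

lemma id_measurable_disc: "(\<lambda>z. z) \<in> borel_measurable dA"
  by (intro continuous_on_area_on continuous_intros)

lemma kernel_denom_ge:
  assumes "z \<in> \<bbbD>" "w \<in> \<bbbD>"
  shows "1 - cmod z \<le> cmod (1 - z * cnj w)"
proof -
  have "cmod z * cmod w \<le> cmod z * 1" using assms by (intro mult_left_mono) auto
  then show ?thesis
    using norm_triangle_ineq2[of 1 "z * cnj w"] by (simp add: norm_mult)
qed

lemma kernel_nonzero: "z \<in> \<bbbD> \<Longrightarrow> w \<in> \<bbbD> \<Longrightarrow> 1 - z * cnj w \<noteq> 0"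
  using kernel_denom_ge[of z w] by auto

lemma disc_proj_integrable:
  assumes F: "integrable dA F" and z: "z \<in> \<bbbD>"
  shows "integrable dA (\<lambda>w. F w / (1 - z * cnj w)\<^sup>2)"
proof (rule Bochner_Integration.integrable_bound)
  show "integrable dA (\<lambda>w. cmod (F w) * (1 / (1 - cmod z)\<^sup>2))" using F by auto
  have Fm: "F \<in> borel_measurable dA" using F by auto
  have km: "(\<lambda>w. (1 - z * cnj w)\<^sup>2) \<in> borel_measurable dA"
    by (intro continuous_on_area_on continuous_intros)
  show "(\<lambda>w. F w / (1 - z * cnj w)\<^sup>2) \<in> borel_measurable dA"
    using Fm km by (rule borel_measurable_divide)
  show "AE w in dA. norm (F w / (1 - z * cnj w)\<^sup>2) \<le> norm (cmod (F w) * (1 / (1 - cmod z)\<^sup>2))"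
  proof (rule AE_I2)
    fix w assume "w \<in> space dA"
    then have w: "w \<in> \<bbbD>" by simp
    have "1 / (cmod (1 - z * cnj w))\<^sup>2 \<le> 1 / (1 - cmod z)\<^sup>2"
      using kernel_denom_ge[OF z w] z kernel_nonzero[OF z w]
      by (intro divide_left_mono power_mono mult_pos_pos) auto
    then have "cmod (F w) * (1 / (cmod (1 - z * cnj w))\<^sup>2) \<le> cmod (F w) * (1 / (1 - cmod z)\<^sup>2)"
      by (intro mult_left_mono) auto
    then show "norm (F w / (1 - z * cnj w)\<^sup>2) \<le> norm (cmod (F w) * (1 / (1 - cmod z)\<^sup>2))"
      by (simp add: norm_divide norm_power)
  qed
qed

text \<open>The kernel is the series of (n + 1) (z cnj w)^n, dominated for fixed z by (n + 1) |z|^n.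
  Integrating it term by term turns the projection into a power series, which makes it
  holomorphic.\<close>

lemma disc_proj_sums:
  assumes F: "integrable dA F" and z: "z \<in> \<bbbD>"
  shows "(\<lambda>n. (of_nat (Suc n) * (\<integral>w. F w * cnj w ^ n \<partial>dA)) * z ^ n) sums disc_proj F z"
proof -
  let ?M = "dA"
  let ?f = "\<lambda>n w. F w * (of_nat (Suc n) * (z * cnj w) ^ n)"
  have Fm: "F \<in> borel_measurable ?M" using F by auto
  have zw: "cmod (z * cnj w) \<le> cmod z" if "w \<in> \<bbbD>" for w
    using that mult_left_mono[of "cmod w" 1 "cmod z"] by (simp add: norm_mult)
  have bound: "norm (?f n w) \<le> real (Suc n) * cmod z ^ n * cmod (F w)" if "w \<in> \<bbbD>" for n w
    using power_mono[OF zw[OF that], of n] mult_left_mono[of "cmod (z * cnj w) ^ n" "cmod z ^ n" "cmod (F w) * real (Suc n)"]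
    by (simp add: norm_mult norm_power mult_ac del: of_nat_Suc)
  have geo: "summable (\<lambda>n. real (Suc n) * cmod z ^ n)"
    using geometric_deriv_sums[of "cmod z"] z by (auto simp: sums_iff)
  have int: "integrable ?M (?f n)" for n
  proof (rule Bochner_Integration.integrable_bound)
    show "integrable ?M (\<lambda>w. real (Suc n) * cmod z ^ n * cmod (F w))" using F by auto
    show "?f n \<in> borel_measurable ?M"
      by (intro borel_measurable_times Fm continuous_on_area_on continuous_intros)
    show "AE w in ?M. norm (?f n w) \<le> norm (real (Suc n) * cmod z ^ n * cmod (F w))"
      using bound by (intro AE_I2) (simp del: of_nat_Suc)
  qed
  have "(\<lambda>n. integral\<^sup>L ?M (?f n)) sums (\<integral>w. (\<Sum>n. ?f n w) \<partial>?M)"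
  proof (rule sums_integral[OF int])
    show "AE w in ?M. summable (\<lambda>n. norm (?f n w))"
    proof (rule AE_I2)
      fix w assume "w \<in> space ?M"
      then have "norm (norm (?f n w)) \<le> real (Suc n) * cmod z ^ n * cmod (F w)" for n
        using bound[of w n] by simp
      then show "summable (\<lambda>n. norm (?f n w))"
        by (intro summable_comparison_test'[OF summable_mult2[OF geo, of "cmod (F w)"], where N = 0])
    qed
    show "summable (\<lambda>n. \<integral>w. norm (?f n w) \<partial>?M)"
    proof (rule summable_comparison_test'[where N = 0])
      show "summable (\<lambda>n. real (Suc n) * cmod z ^ n * (\<integral>w. cmod (F w) \<partial>?M))"
        using geo by (rule summable_mult2)
      fix n
      have "(\<integral>w. norm (?f n w) \<partial>?M) \<le> (\<integral>w. real (Suc n) * cmod z ^ n * cmod (F w) \<partial>?M)"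
        using F int[of n] bound by (intro integral_mono) (auto simp del: of_nat_Suc)
      then show "norm (\<integral>w. norm (?f n w) \<partial>?M) \<le> real (Suc n) * cmod z ^ n * (\<integral>w. cmod (F w) \<partial>?M)"
        by (simp add: integral_nonneg_AE del: of_nat_Suc)
    qed
  qed
  moreover have "(\<integral>w. (\<Sum>n. ?f n w) \<partial>?M) = disc_proj F z"
    unfolding disc_proj_def
  proof (intro Bochner_Integration.integral_cong refl)
    fix w assume "w \<in> space ?M"
    then have "cmod (z * cnj w) < 1" using zw[of w] z by (auto intro: order_le_less_trans)
    then have "(\<lambda>n. ?f n w) sums (F w * (1 / (1 - z * cnj w)\<^sup>2))"
      by (intro sums_mult geometric_deriv_sums)
    then show "(\<Sum>n. ?f n w) = F w / (1 - z * cnj w)\<^sup>2" by (simp add: sums_iff)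
  qed
  moreover have "integral\<^sup>L ?M (?f n) = of_nat (Suc n) * (\<integral>w. F w * cnj w ^ n \<partial>?M) * z ^ n" for n
  proof -
    have "?f n = (\<lambda>w. (of_nat (Suc n) * z ^ n) * (F w * cnj w ^ n))"
      by (simp add: fun_eq_iff power_mult_distrib mult_ac)
    then have "integral\<^sup>L ?M (?f n) = (of_nat (Suc n) * z ^ n) * (\<integral>w. F w * cnj w ^ n \<partial>?M)"
      by (simp only: integral_mult_right_zero)
    then show ?thesis by (simp only: mult_ac)
  qed
  ultimately show ?thesis by simp
qed

lemma disc_proj_holomorphic:
  assumes F: "integrable dA F"
  shows "disc_proj F holomorphic_on \<bbbD>"
  by (rule power_series_holomorphic[where a = "\<lambda>n. of_nat (Suc n) * (\<integral>w. F w * cnj w ^ n \<partial>dA)"])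
    (use disc_proj_sums[OF F] in simp)

lemma disc_proj_measurable:
  assumes "integrable dA F"
  shows "disc_proj F \<in> borel_measurable dA"
  using disc_proj_holomorphic[OF assms] by (intro continuous_on_area_on holomorphic_on_imp_continuous_on)

lemma disc_proj_norm_le:
  "ennreal (cmod (disc_proj F z)) \<le> berg_plus (\<lambda>w. cmod (F w)) z"
proof (cases "integrable dA (\<lambda>w. F w / (1 - z * cnj w)\<^sup>2)")
  case True
  then have "ennreal (cmod (disc_proj F z)) \<le> (\<integral>\<^sup>+w. norm (F w / (1 - z * cnj w)\<^sup>2) \<partial>dA)"
    unfolding disc_proj_def by (rule integral_norm_bound_ennreal)
  also have "\<dots> = berg_plus (\<lambda>w. cmod (F w)) z"
    by (intro nn_integral_cong) (simp add: berg_kernel_def norm_divide norm_power ennreal_mult'[symmetric])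
  finally show ?thesis .
next
  \<comment> \<open>A Bochner integral that does not converge absolutely is 0 by convention.\<close>
  case False
  then show ?thesis by (simp add: disc_proj_def not_integrable_integral_eq)
qed

text \<open>Cauchy's formula at the centre for u \<mapsto> h (u w), which is holomorphic on the
  closed unit disc because |w| < 1.\<close>

lemma circle_mean:
  assumes h: "h holomorphic_on \<bbbD>" and w: "w \<in> \<bbbD>"
  shows "((\<lambda>t. h (cis (2 * pi * t) * w)) has_integral h 0) {0..1}"
proof -
  define H where "H = (\<lambda>u. h (u * w))"
  have sub: "u * w \<in> \<bbbD>" if "u \<in> cball 0 1" for u
    using that w mult_left_le_one_le[of "cmod w" "cmod u"] by (auto simp: norm_mult intro: order_le_less_trans)
  have hol: "H holomorphic_on cball 0 1"
    unfolding H_def using sub by (intro holomorphic_on_compose_gen[OF _ h, unfolded o_def] holomorphic_intros) auto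
  have "((\<lambda>u. H u / (u - 0)) has_contour_integral (2 * of_real pi * \<i> * H 0)) (circlepath 0 1)"
    using hol by (intro Cauchy_integral_circlepath holomorphic_on_imp_continuous_on)
      (auto intro: holomorphic_on_subset)
  then have "((\<lambda>t. H (circlepath 0 1 t) / (circlepath 0 1 t - 0) * vector_derivative (circlepath 0 1) (at t within {0..1}))
      has_integral (2 * of_real pi * \<i> * H 0)) {0..1}"
    unfolding has_contour_integral_def .
  then have "((\<lambda>t. (2 * of_real pi * \<i>) * h (cis (2 * pi * t) * w)) has_integral (2 * of_real pi * \<i>) * H 0) {0..1}"
  proof (rule has_integral_eq[rotated])
    fix t :: real assume t: "t \<in> {0..1}"
    have c: "circlepath 0 1 t = cis (2 * pi * t)"
      by (simp add: circlepath cis_conv_exp mult_ac)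
    have "vector_derivative (circlepath 0 1) (at t within {0..1}) = 2 * pi * \<i> * cis (2 * pi * t)"
      using t vector_derivative_circlepath01[of t 0 1] by (simp add: cis_conv_exp mult_ac)
    then show "H (circlepath 0 1 t) / (circlepath 0 1 t - 0) * vector_derivative (circlepath 0 1) (at t within {0..1})
        = (2 * of_real pi * \<i>) * h (cis (2 * pi * t) * w)"
      by (simp add: c H_def)
  qed
  then have "((\<lambda>t. (1 / (2 * of_real pi * \<i>)) * ((2 * of_real pi * \<i>) * h (cis (2 * pi * t) * w)))
      has_integral (1 / (2 * of_real pi * \<i>)) * ((2 * of_real pi * \<i>) * H 0)) {0..1}"
    by (rule has_integral_mult_right)
  then show ?thesis by (simp add: H_def)
qed

text \<open>Area is invariant under rotations, so h may be replaced by its mean over all rotations;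
  after Fubini's theorem the circle mean gives h 0 for every w. This stands in for polar
  coordinates, and no boundary values of h enter.\<close>

lemma disc_mean_value:
  assumes h: "h holomorphic_on \<bbbD>" and int: "integrable dA h"
  shows "(\<integral>w. h w \<partial>dA) = h 0"
proof -
  let ?M = "dA"
  define N where "N = restrict_space lborel {0..1::real}"
  have N1: "emeasure N {0..1} = 1" "space N = {0..1}"
    by (simp_all add: N_def emeasure_restrict_space space_restrict_space)
  interpret N: finite_measure N by (rule finite_measureI) (simp add: N1)
  interpret P: pair_sigma_finite N ?M ..
  let ?g = "\<lambda>t w. h (cis (2 * pi * t) * w)"
  have hm: "h \<in> borel_measurable ?M" using int by auto
  have dc: "cmod (deriv (\<lambda>z. cis (2 * pi * t) * z) z) = 1" for t z
    by (simp add: norm_mult)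
  have rot: "cmod (cis (2 * pi * t)) = 1" for t by simp
  \<comment> \<open>Lebesgue measurability of h need not survive composition with the product map;
    continuity makes h Borel on the disc.\<close>
  have gm: "case_prod ?g \<in> borel_measurable (N \<Otimes>\<^sub>M ?M)"
  proof -
    have id1: "(\<lambda>t. t) \<in> measurable N borel" unfolding N_def
      by (rule measurable_restrict_space1) simp
    have "(\<lambda>t. cis (2 * pi * t)) \<in> borel_measurable borel"
      by (intro borel_measurable_continuous_onI continuous_intros)
    then have "(\<lambda>x. cis (2 * pi * fst x)) \<in> borel_measurable (N \<Otimes>\<^sub>M ?M)"
      using measurable_compose[OF measurable_fst id1] by (rule measurable_compose[rotated])
    moreover have "(\<lambda>x. snd x) \<in> borel_measurable (N \<Otimes>\<^sub>M ?M)"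
      by (rule measurable_compose[OF measurable_snd id_measurable_disc])
    ultimately have "(\<lambda>x. cis (2 * pi * fst x) * snd x) \<in> borel_measurable (N \<Otimes>\<^sub>M ?M)"
      by (rule borel_measurable_times)
    then have "(\<lambda>x. cis (2 * pi * fst x) * snd x) \<in> measurable (N \<Otimes>\<^sub>M ?M) (restrict_space borel \<bbbD>)"
      by (rule measurable_restrict_space2[rotated]) (auto simp: space_pair_measure norm_mult)
    moreover have "h \<in> borel_measurable (restrict_space borel \<bbbD>)"
      using h by (intro borel_measurable_continuous_on_restrict holomorphic_on_imp_continuous_on)
    ultimately have "(\<lambda>x. h (cis (2 * pi * fst x) * snd x)) \<in> borel_measurable (N \<Otimes>\<^sub>M ?M)"
      by (rule measurable_compose)
    then show ?thesis by (simp add: case_prod_unfold)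
  qed
  have norm_rot: "(\<integral>\<^sup>+w. norm (?g t w) \<partial>?M) = (\<integral>\<^sup>+w. norm (h w) \<partial>?M)" for t
  proof -
    have "(\<integral>\<^sup>+w. norm (h w) \<partial>?M) = (\<integral>\<^sup>+w. ennreal (cmod (deriv (\<lambda>z. cis (2 * pi * t) * z) w) ^ 2)
        * norm (h (cis (2 * pi * t) * w)) \<partial>?M)"
      using hm by (intro nn_integral_biholomorphic biholomorphic_rotation rot open_ball) auto
    then show ?thesis by (simp only: dc) simp
  qed
  have "integrable (N \<Otimes>\<^sub>M ?M) (case_prod ?g)"
  proof (rule integrableI_bounded[OF gm])
    have "(\<integral>\<^sup>+x. norm (case_prod ?g x) \<partial>(N \<Otimes>\<^sub>M ?M)) = (\<integral>\<^sup>+t. (\<integral>\<^sup>+w. norm (?g t w) \<partial>?M) \<partial>N)"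
      using gm by (subst disc.nn_integral_fst[symmetric]) auto
    also have "\<dots> = (\<integral>\<^sup>+w. norm (h w) \<partial>?M)"
      by (simp only: norm_rot) (simp add: N1)
    also have "\<dots> < \<infinity>" using int by (simp add: integrable_iff_bounded)
    finally show "(\<integral>\<^sup>+x. norm (case_prod ?g x) \<partial>(N \<Otimes>\<^sub>M ?M)) < \<infinity>" .
  qed
  then have swap: "(\<integral>w. (\<integral>t. ?g t w \<partial>N) \<partial>?M) = (\<integral>t. (\<integral>w. ?g t w \<partial>?M) \<partial>N)"
    by (rule P.Fubini_integral)
  have inner: "(\<integral>w. ?g t w \<partial>?M) = (\<integral>w. h w \<partial>?M)" for t
  proof -
    have "(\<integral>w. h w \<partial>?M) = (\<integral>w. cmod (deriv (\<lambda>z. cis (2 * pi * t) * z) w) ^ 2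
        *\<^sub>R h (cis (2 * pi * t) * w) \<partial>?M)"
      using hm by (intro integral_biholomorphic biholomorphic_rotation rot open_ball) auto
    then show ?thesis by (simp only: dc) simp
  qed
  have "(\<integral>t. ?g t w \<partial>N) = h 0" if w: "w \<in> \<bbbD>" for w
  proof -
    have cont: "continuous_on {0..1} (\<lambda>t. ?g t w)"
      using w by (intro continuous_on_compose2[OF holomorphic_on_imp_continuous_on[OF h]] continuous_intros)
        (auto simp: norm_mult)
    have "(\<integral>t. ?g t w \<partial>N) = (LINT t:{0..1}|lborel. ?g t w)"
      unfolding N_def set_lebesgue_integral_def by (subst integral_restrict_space) auto
    also have "\<dots> = integral {0..1} (\<lambda>t. ?g t w)"
      using cont by (intro set_borel_integral_eq_integral borel_integrable_atLeastAtMost')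
    also have "\<dots> = h 0" using circle_mean[OF h w] by (rule integral_unique)
    finally show ?thesis .
  qed
  then have "(\<integral>w. (\<integral>t. ?g t w \<partial>N) \<partial>?M) = (\<integral>w. h 0 \<partial>?M)"
    by (intro Bochner_Integration.integral_cong refl) auto
  moreover have "measure N (space N) = 1" using N1 by (simp add: measure_def)
  moreover have "measure ?M \<bbbD> = 1" by (simp add: measure_def emeasure_disc)
  ultimately show ?thesis
    using swap by (simp add: inner)
qed

text \<open>The automorphism of the disc sending 0 to a; its inverse has parameter -a.\<close>

definition disc_moebius :: "complex \<Rightarrow> complex \<Rightarrow> complex" where
  "disc_moebius a w = (w + a) / (1 + cnj a * w)"

lemma disc_moebius_denom:
  assumes "a \<in> \<bbbD>" "w \<in> \<bbbD>" shows "1 + cnj a * w \<noteq> 0"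
  using kernel_nonzero[of w "- a"] assms by (simp add: mult.commute)

lemma disc_moebius_in_disc:
  assumes a: "a \<in> \<bbbD>" and w: "w \<in> \<bbbD>" shows "disc_moebius a w \<in> \<bbbD>"
proof -
  have "(cmod (1 + cnj a * w))\<^sup>2 - (cmod (w + a))\<^sup>2 = (1 - (cmod a)\<^sup>2) * (1 - (cmod w)\<^sup>2)"
    unfolding cmod_power2 by (simp add: power2_eq_square) algebra
  moreover have "(1 - (cmod a)\<^sup>2) * (1 - (cmod w)\<^sup>2) > 0"
    using a w by (intro mult_pos_pos) (auto simp: abs_square_less_1)
  ultimately have "(cmod (w + a))\<^sup>2 < (cmod (1 + cnj a * w))\<^sup>2" by linarith
  then have "cmod (w + a) < cmod (1 + cnj a * w)" by (rule power2_less_imp_less) simp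
  then show ?thesis using disc_moebius_denom[OF a w] by (simp add: disc_moebius_def norm_divide)
qed

lemma disc_moebius_inverse:
  assumes a: "a \<in> \<bbbD>" and w: "w \<in> \<bbbD>" shows "disc_moebius (- a) (disc_moebius a w) = w"
proof -
  let ?d = "1 + cnj a * w"
  have d: "?d \<noteq> 0" by (rule disc_moebius_denom[OF a w])
  have aa: "1 - a * cnj a \<noteq> 0" using kernel_nonzero[OF a a] .
  have "disc_moebius a w - a = w * (1 - a * cnj a) / ?d"
    using d by (simp add: disc_moebius_def field_simps)
  moreover have "1 - cnj a * disc_moebius a w = (1 - a * cnj a) / ?d"
    using d by (simp add: disc_moebius_def field_simps)
  ultimately show ?thesis
    unfolding disc_moebius_def[of "- a"] using d aa by simp
qed

lemma disc_moebius_holomorphic: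
  assumes "a \<in> \<bbbD>" shows "disc_moebius a holomorphic_on \<bbbD>"
  unfolding disc_moebius_def using disc_moebius_denom[OF assms] by (intro holomorphic_intros) auto

lemma biholomorphic_moebius:
  assumes a: "a \<in> \<bbbD>" shows "biholomorphic (disc_moebius a) \<bbbD> \<bbbD>"
  unfolding biholomorphic_def
proof (intro conjI exI[of _ "disc_moebius (- a)"] ballI)
  have a': "- a \<in> \<bbbD>" using a by simp
  show "disc_moebius a holomorphic_on \<bbbD>" "disc_moebius (- a) holomorphic_on \<bbbD>"
    using disc_moebius_holomorphic a a' by blast+
  show "disc_moebius (- a) (disc_moebius a z) = z" if "z \<in> \<bbbD>" for z
    by (rule disc_moebius_inverse[OF a that])
  show "disc_moebius a ` \<bbbD> = \<bbbD>"
  proof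
    show "\<bbbD> \<subseteq> disc_moebius a ` \<bbbD>"
    proof
      fix z assume z: "z \<in> \<bbbD>"
      then have "disc_moebius a (disc_moebius (- a) z) = z"
        using disc_moebius_inverse[OF a', of z] by simp
      then show "z \<in> disc_moebius a ` \<bbbD>"
        using disc_moebius_in_disc[OF a' z] by (metis image_eqI)
    qed
  qed (use disc_moebius_in_disc[OF a] in blast)
qed

lemma deriv_disc_moebius:
  assumes a: "a \<in> \<bbbD>" and w: "w \<in> \<bbbD>"
  shows "deriv (disc_moebius a) w = (1 - a * cnj a) / (1 + cnj a * w)\<^sup>2"
proof (rule DERIV_imp_deriv)
  show "(disc_moebius a has_field_derivative (1 - a * cnj a) / (1 + cnj a * w)\<^sup>2) (at w)"
    unfolding disc_moebius_def[abs_def] using disc_moebius_denom[OF a w]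
    by (auto intro!: derivative_eq_intros simp: power2_eq_square field_simps)
qed

text \<open>The mean value property is applied to \<open>k \<circ> \<phi>\<close>, where \<open>\<phi>\<close> is the automorphism of the disc with
  \<open>\<phi> 0 = a\<close> and the factor \<open>k w / h w = (1 - cnj a * w)\<^sup>2\<close> turns the Jacobian into the Bergman kernel.\<close>

lemma bergman_reproducing:
  assumes h: "h holomorphic_on \<bbbD>" and int: "integrable dA h" and a: "a \<in> \<bbbD>"
  shows "disc_proj h a = h a"
proof -
  let ?M = "dA" and ?\<psi> = "disc_moebius (- a)" and ?\<phi> = "disc_moebius a"
  define k where "k w = h w * (1 - cnj a * w)\<^sup>2" for w
  have a': "- a \<in> \<bbbD>" using a by simp
  have ca: "cnj (1 - cnj a * w) = 1 - a * cnj w" for w by simp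
  have khol: "k holomorphic_on \<bbbD>" unfolding k_def by (intro holomorphic_intros h)
  have kphol: "(\<lambda>w. k (?\<phi> w)) holomorphic_on \<bbbD>"
    using holomorphic_on_compose_gen[OF disc_moebius_holomorphic[OF a] khol] disc_moebius_in_disc[OF a]
    by (auto simp: o_def image_subset_iff)
  have hm: "h \<in> borel_measurable ?M" using int by auto
  have inv: "?\<phi> (?\<psi> w) = w" if "w \<in> \<bbbD>" for w using disc_moebius_inverse[OF a' that] by simp
  \<comment> \<open>The Jacobian of the inverse map is |1 - a cnj a|^2 / |1 - cnj a * w|^4; the
    factor in \<open>k\<close> cancels the holomorphic half of the denominator, and the conjugate
    half that remains is the Bergman kernel.\<close>
  have jac: "(cmod (deriv ?\<psi> w))\<^sup>2 *\<^sub>R k w = (1 - a * cnj a)\<^sup>2 * (h w / (1 - a * cnj w)\<^sup>2)" if w: "w \<in> \<bbbD>" for w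
  proof -
    let ?d = "1 - cnj a * w"
    have d: "?d \<noteq> 0" using disc_moebius_denom[OF a' w] by simp
    have r: "cnj (1 - a * cnj a) = 1 - a * cnj a" by (simp add: mult.commute)
    have "of_real ((cmod (deriv ?\<psi> w))\<^sup>2) = deriv ?\<psi> w * cnj (deriv ?\<psi> w)"
      by (rule complex_norm_square)
    also have "\<dots> = (1 - a * cnj a)\<^sup>2 / (?d\<^sup>2 * (cnj ?d)\<^sup>2)"
    proof -
      have D: "deriv ?\<psi> w = (1 - a * cnj a) / ?d\<^sup>2"
        using deriv_disc_moebius[OF a' w] by simp
      have "deriv ?\<psi> w * cnj (deriv ?\<psi> w) = ((1 - a * cnj a) * cnj (1 - a * cnj a)) / (?d\<^sup>2 * (cnj ?d)\<^sup>2)"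
        unfolding D by simp
      then show ?thesis unfolding r power2_eq_square[of "1 - a * cnj a"] .
    qed
    finally have "of_real ((cmod (deriv ?\<psi> w))\<^sup>2) = (1 - a * cnj a)\<^sup>2 / (?d\<^sup>2 * (cnj ?d)\<^sup>2)" .
    then have "of_real ((cmod (deriv ?\<psi> w))\<^sup>2) * k w = (1 - a * cnj a)\<^sup>2 / (?d\<^sup>2 * (cnj ?d)\<^sup>2) * (h w * ?d\<^sup>2)"
      by (simp only: k_def)
    also have "\<dots> = (1 - a * cnj a)\<^sup>2 * (h w / (cnj ?d)\<^sup>2)" using d by simp
    finally show ?thesis unfolding ca by (simp add: scaleR_conv_of_real)
  qed
  have kpm: "(\<lambda>w. k (?\<phi> w)) \<in> borel_measurable ?M"
    using kphol by (intro continuous_on_area_on holomorphic_on_imp_continuous_on)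
  have "integrable ?M (\<lambda>w. k (?\<phi> w))"
  proof (rule integrableI_bounded[OF kpm])
    have "(\<integral>\<^sup>+w. norm (k (?\<phi> w)) \<partial>?M)
        = (\<integral>\<^sup>+w. ennreal ((cmod (deriv ?\<psi> w))\<^sup>2) * norm (k (?\<phi> (?\<psi> w))) \<partial>?M)"
      using kpm by (intro nn_integral_biholomorphic biholomorphic_moebius a' open_ball) auto
    also have "\<dots> = (\<integral>\<^sup>+w. norm ((1 - a * cnj a)\<^sup>2 * (h w / (1 - a * cnj w)\<^sup>2)) \<partial>?M)"
    proof (rule nn_integral_cong)
      fix w assume "w \<in> space ?M"
      then have w: "w \<in> \<bbbD>" by simp
      show "ennreal ((cmod (deriv ?\<psi> w))\<^sup>2) * norm (k (?\<phi> (?\<psi> w))) = norm ((1 - a * cnj a)\<^sup>2 * (h w / (1 - a * cnj w)\<^sup>2))"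
        unfolding jac[OF w, symmetric] inv[OF w] by (simp add: ennreal_mult'[symmetric])
    qed
    also have "\<dots> < \<infinity>"
      using integrable_mult_right[OF disc_proj_integrable[OF int a], of "(1 - a * cnj a)\<^sup>2"]
      unfolding integrable_iff_bounded by blast
    finally show "(\<integral>\<^sup>+w. norm (k (?\<phi> w)) \<partial>?M) < \<infinity>" .
  qed
  then have "k (?\<phi> 0) = (\<integral>w. k (?\<phi> w) \<partial>?M)" by (rule disc_mean_value[OF kphol, symmetric])
  also have "\<dots> = (\<integral>w. (cmod (deriv ?\<psi> w))\<^sup>2 *\<^sub>R k (?\<phi> (?\<psi> w)) \<partial>?M)"
    by (intro integral_biholomorphic biholomorphic_moebius a' open_ball kpm)
  also have "\<dots> = (\<integral>w. (1 - a * cnj a)\<^sup>2 * (h w / (1 - a * cnj w)\<^sup>2) \<partial>?M)"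
    by (intro Bochner_Integration.integral_cong refl) (simp only: space_area_on inv jac)
  also have "\<dots> = (1 - a * cnj a)\<^sup>2 * disc_proj h a"
    by (simp only: disc_proj_def integral_mult_right_zero)
  also have "k (?\<phi> 0) = h a * (1 - a * cnj a)\<^sup>2" by (simp add: k_def disc_moebius_def mult.commute)
  finally show ?thesis using kernel_nonzero[OF a a] by simp
qed

section \<open>L^2 boundedness and orthogonality of the disc projection\<close>

lemma mass_one_box_le: "mass (\<lambda>_. 1) (carleson_box \<alpha> k j) \<le> 64 * (1/4) ^ k"
proof -
  have "(\<integral>\<^sup>+z. ennreal 1 * indicator (carleson_box \<alpha> k j) z \<partial>dA) = emeasure dA (carleson_box \<alpha> k j)"
    using box_sets_disc by simp
  also have "\<dots> = emeasure area (carleson_box \<alpha> k j)"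
    using carleson_box_subset by (subst emeasure_restrict_space) auto
  also have "\<dots> \<le> emeasure area (ball (cis (2 * pi * (j / 2 ^ k + \<alpha>))) (8 * (1/2) ^ k))"
    using carleson_box_subset_ball by (intro emeasure_mono) auto
  also have "\<dots> = ennreal ((8 * (1/2) ^ k)\<^sup>2)" by (rule emeasure_area_ball) simp
  also have "(8 * (1/2) ^ k)\<^sup>2 = (64 * (1/4) ^ k :: real)"
    by (simp add: power_mult_distrib power_even_eq[symmetric] power2_eq_square flip: power_mult_distrib)
  finally show ?thesis unfolding mass_def by (intro enn2real_leI) auto
qed

text \<open>The weight 1 with p = 2 satisfies the box condition, and 4096 = 64^2 comes from the area
  bound; the weighted theory thus supplies the L^2 boundedness.\<close>

interpretation unweighted: weight_pair 2 2 "\<lambda>_. 1" "\<lambda>_. 1" 4096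
proof
  fix \<alpha> k j
  have "mass (\<lambda>_. 1) (carleson_box \<alpha> k j) * mass (\<lambda>_. 1) (carleson_box \<alpha> k j)
    \<le> (64 * (1/4) ^ k) * (64 * (1/4) ^ k)"
    by (intro mult_mono mass_one_box_le) auto
  then show "mass (\<lambda>_. 1) (carleson_box \<alpha> k j) * mass (\<lambda>_. 1) (carleson_box \<alpha> k j) powr (2 - 1)
    \<le> 4096 * ((1/4) ^ k) powr 2"
    by (simp add: power2_eq_square)
qed (auto simp: emeasure_disc)

definition disc_L2 :: "(complex \<Rightarrow> complex) \<Rightarrow> bool" where
  "disc_L2 F \<longleftrightarrow> F \<in> borel_measurable dA \<and> (\<integral>\<^sup>+z. ennreal ((cmod (F z))\<^sup>2) \<partial>dA) < top"

lemma disc_L2_integrable: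
  assumes "disc_L2 F" shows "integrable dA F"
proof (rule integrableI_bounded)
  show "F \<in> borel_measurable dA" using assms by (simp add: disc_L2_def)
  then show "(\<integral>\<^sup>+z. ennreal (norm (F z)) \<partial>dA) < \<infinity>"
    using unweighted.integrable_from_weighted[of "\<lambda>z. cmod (F z)"] assms by (simp add: disc_L2_def)
qed

lemma disc_proj_L2:
  assumes F: "disc_L2 F" shows "disc_L2 (disc_proj F)"
proof -
  have m: "F \<in> borel_measurable dA" using F by (simp add: disc_L2_def)
  have pm: "disc_proj F \<in> borel_measurable dA"
    by (rule disc_proj_measurable[OF disc_L2_integrable[OF F]])
  have "(\<integral>\<^sup>+z. ennreal (cmod (disc_proj F z) powr 2 * 1) \<partial>dA)
    \<le> ennreal ((32 * sparse_const 2 2 * 4096 powr max 1 (1 / (2 - 1))) powr 2)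
      * (\<integral>\<^sup>+z. ennreal (cmod (F z) powr 2 * 1) \<partial>dA)"
    by (rule unweighted.positive_operator_bound) (use m pm disc_proj_norm_le in auto)
  also have "\<dots> < top" using F by (simp add: disc_L2_def ennreal_mult_less_top)
  finally show ?thesis using pm by (simp add: disc_L2_def)
qed

lemma disc_L2_mult_integrable:
  assumes "disc_L2 F" "disc_L2 H"
  shows "integrable dA (\<lambda>z. F z * cnj (H z))"
proof (rule Bochner_Integration.integrable_bound)
  have m: "F \<in> borel_measurable dA" "H \<in> borel_measurable dA"
    using assms by (auto simp: disc_L2_def)
  have "integrable dA (\<lambda>z. (cmod (G z))\<^sup>2)" if "disc_L2 G" for G
    using that by (intro integrableI_bounded) (auto simp: disc_L2_def)
  then show "integrable dA (\<lambda>z. (cmod (F z))\<^sup>2 + (cmod (H z))\<^sup>2)" using assms by auto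
  show "(\<lambda>z. F z * cnj (H z)) \<in> borel_measurable dA"
    using m by (intro borel_measurable_times measurable_compose[OF m(2) borel_measurable_cnj])
  have "cmod (F z) * cmod (H z) \<le> (cmod (F z))\<^sup>2 + (cmod (H z))\<^sup>2" for z
  proof -
    have "2 * cmod (F z) * cmod (H z) \<le> (cmod (F z))\<^sup>2 + (cmod (H z))\<^sup>2" by (rule sum_squares_bound)
    moreover have "0 \<le> cmod (F z) * cmod (H z)" by simp
    ultimately show ?thesis by linarith
  qed
  then show "AE z in dA. norm (F z * cnj (H z)) \<le> norm ((cmod (F z))\<^sup>2 + (cmod (H z))\<^sup>2)"
    by (intro AE_I2) (simp add: norm_mult)
qed

text \<open>The kernel is Hermitian, so Fubini's theorem moves the operator onto H, which it
  reproduces. Absolute convergence of the double integral is the bilinear bound for |F| and |H| with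
  weight 1.\<close>

lemma disc_proj_orthogonal:
  assumes F: "disc_L2 F" and H: "disc_L2 H" "H holomorphic_on \<bbbD>"
  shows "(\<integral>z. (F z - disc_proj F z) * cnj (H z) \<partial>dA) = 0"
proof -
  let ?M = "dA"
  interpret P: pair_sigma_finite ?M ?M ..
  have Fm: "F \<in> borel_measurable ?M" and Hm: "H \<in> borel_measurable ?M"
    using F H by (auto simp: disc_L2_def)
  let ?g = "\<lambda>z w. F w / (1 - z * cnj w)\<^sup>2 * cnj (H z)"
  have gm: "case_prod ?g \<in> borel_measurable (?M \<Otimes>\<^sub>M ?M)"
  proof -
    have z: "(\<lambda>x. fst x) \<in> borel_measurable (?M \<Otimes>\<^sub>M ?M)"
      by (rule measurable_compose[OF measurable_fst id_measurable_disc])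
    have w: "(\<lambda>x. snd x) \<in> borel_measurable (?M \<Otimes>\<^sub>M ?M)"
      by (rule measurable_compose[OF measurable_snd id_measurable_disc])
    have "(\<lambda>x. F (snd x) / (1 - fst x * cnj (snd x))\<^sup>2 * cnj (H (fst x))) \<in> borel_measurable (?M \<Otimes>\<^sub>M ?M)"
      by (intro borel_measurable_times borel_measurable_divide borel_measurable_power borel_measurable_diff
          borel_measurable_const z w measurable_compose[OF w borel_measurable_cnj]
          measurable_compose[OF measurable_snd Fm]
          measurable_compose[OF measurable_compose[OF measurable_fst Hm] borel_measurable_cnj])
    then show ?thesis by (simp add: case_prod_unfold)
  qed
  obtain A B where AB: "A > 0" "(\<integral>\<^sup>+z. ennreal (cmod (F z) powr 2 * 1) \<partial>?M) \<le> ennreal A"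
    "B > 0" "(\<integral>\<^sup>+z. ennreal (cmod (H z) powr 2 * 1) \<partial>?M) \<le> ennreal B"
  proof -
    have ex: "\<exists>A>0. x \<le> ennreal A" if "x < top" for x
    proof -
      obtain r where "x = ennreal r" using \<open>x < top\<close> by (cases x) auto
      then show ?thesis by (intro exI[of _ "max 1 r"]) (auto intro: ennreal_leI)
    qed
    show thesis
      using ex[of "\<integral>\<^sup>+z. ennreal (cmod (F z) powr 2 * 1) \<partial>?M"]
        ex[of "\<integral>\<^sup>+z. ennreal (cmod (H z) powr 2 * 1) \<partial>?M"] F H that by (auto simp: disc_L2_def)
  qed
  have gn: "ennreal (norm (?g z w)) = ennreal (cmod (H z)) * (ennreal (cmod (F w)) * ennreal (berg_kernel z w))" for z w
    by (simp add: norm_mult norm_divide norm_power berg_kernel_def ennreal_mult'[symmetric] mult.commute)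
  have km: "(\<lambda>w. ennreal (berg_kernel z w)) \<in> borel_measurable ?M" if "z \<in> \<bbbD>" for z
    unfolding berg_kernel_def using kernel_nonzero[OF that]
    by (intro measurable_compose[OF _ measurable_ennreal] continuous_on_area_on continuous_intros) auto
  have "integrable (?M \<Otimes>\<^sub>M ?M) (case_prod ?g)"
  proof (rule integrableI_bounded[OF gm])
    have "(\<integral>\<^sup>+x. norm (case_prod ?g x) \<partial>(?M \<Otimes>\<^sub>M ?M)) = (\<integral>\<^sup>+z. (\<integral>\<^sup>+w. norm (?g z w) \<partial>?M) \<partial>?M)"
      using gm by (subst disc.nn_integral_fst[symmetric]) auto
    also have "\<dots> = (\<integral>\<^sup>+z. ennreal (cmod (H z)) * berg_plus (\<lambda>w. cmod (F w)) z \<partial>?M)"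
      unfolding gn using Fm km by (intro nn_integral_cong nn_integral_cmult borel_measurable_times_ennreal) auto
    also have "\<dots> < \<infinity>"
      using unweighted.bilinear_bound[OF _ _ _ _ AB(1,2) AB(3,4)] Fm Hm
      by (auto intro: order_le_less_trans)
    finally show "(\<integral>\<^sup>+x. norm (case_prod ?g x) \<partial>(?M \<Otimes>\<^sub>M ?M)) < \<infinity>" .
  qed
  then have swap: "(\<integral>w. (\<integral>z. ?g z w \<partial>?M) \<partial>?M) = (\<integral>z. (\<integral>w. ?g z w \<partial>?M) \<partial>?M)"
    by (rule P.Fubini_integral)
  have left: "(\<integral>z. ?g z w \<partial>?M) = F w * cnj (H w)" if "w \<in> \<bbbD>" for w
  proof -
    have "?g z w = F w * cnj (H z / (1 - w * cnj z)\<^sup>2)" for z by (simp add: mult.commute)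
    then have "(\<integral>z. ?g z w \<partial>?M) = F w * cnj (disc_proj H w)"
      by (simp only: integral_mult_right_zero Bochner_Integration.integral_cnj disc_proj_def)
    then show ?thesis using bergman_reproducing[OF H(2) disc_L2_integrable[OF H(1)] that] by simp
  qed
  have right: "(\<integral>w. ?g z w \<partial>?M) = disc_proj F z * cnj (H z)" for z
    by (simp only: integral_mult_left_zero disc_proj_def)
  have "(\<integral>z. disc_proj F z * cnj (H z) \<partial>?M) = (\<integral>w. (\<integral>z. ?g z w \<partial>?M) \<partial>?M)"
    unfolding swap by (simp only: right)
  also have "\<dots> = (\<integral>w. F w * cnj (H w) \<partial>?M)"
    by (intro Bochner_Integration.integral_cong refl) (simp only: space_area_on left)
  finally show ?thesis
    using disc_L2_mult_integrable[OF F H(1)] disc_L2_mult_integrable[OF disc_proj_L2[OF F] H(1)]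
    by (simp add: left_diff_distrib)
qed

section \<open>Transport to a simply connected domain\<close>

lemma AE_zero_disc_continuous:
  fixes H :: "complex \<Rightarrow> complex"
  assumes cont: "continuous_on \<bbbD> H" and AE: "AE z in dA. H z = 0" and z: "z \<in> \<bbbD>"
  shows "H z = 0"
proof (rule ccontr)
  assume nz: "H z \<noteq> 0"
  let ?S = "\<bbbD> \<inter> H -` (- {0})"
  have op: "open ?S" using cont by (intro continuous_open_preimage) auto
  have "emeasure dA {z \<in> space dA. \<not> H z = 0} = 0"
  proof (rule iffD1[OF AE_iff_measurable[OF _ refl] AE])
    have "{z \<in> space dA. \<not> H z = 0} = ?S" by auto
    then show "{z \<in> space dA. \<not> H z = 0} \<in> sets dA"
      using op by (simp add: sets_restrict_space_iff)
  qed
  moreover have "{z \<in> space dA. \<not> H z = 0} = ?S" by auto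
  ultimately have S0: "emeasure area ?S = 0" by (simp add: emeasure_restrict_space)
  have "z \<in> ?S" using nz z by simp
  then obtain e where e: "e > 0" "ball z e \<subseteq> ?S" by (rule openE[OF op])
  have "emeasure area (ball z e) \<le> emeasure area ?S" using e op by (intro emeasure_mono) auto
  then show False using S0 e by (simp add: emeasure_area_ball)
qed

lemma nn_integral_set_area_on:
  "open U \<Longrightarrow> (\<integral>\<^sup>+z\<in>U. f z \<partial>area) = (\<integral>\<^sup>+z. f z \<partial>area_on U)"
  by (subst nn_integral_restrict_space) auto

lemma epowr_less_top_iff: "x epowr a < top \<longleftrightarrow> x < top"
  by (simp add: epowr_def less_top[symmetric])

lemma Lp_norm_less_top_iff:
  assumes "open U"
  shows "Lp_norm U p w f < top \<longleftrightarrow> (\<integral>\<^sup>+z. ennreal (cmod (f z) powr p * w z) \<partial>area_on U) < top"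
  by (simp add: Lp_norm_def epowr_less_top_iff nn_integral_set_area_on[OF assms])

locale biholomorphic_disc =
  fixes \<Omega> :: "complex set" and \<phi> \<psi> :: "complex \<Rightarrow> complex"
  assumes open_\<Omega>: "open \<Omega>" and hol_\<phi>: "\<phi> holomorphic_on \<bbbD>" and im_\<phi>: "\<phi> ` \<bbbD> = \<Omega>"
    and hol_\<psi>: "\<psi> holomorphic_on \<Omega>" and \<psi>_\<phi>: "\<And>z. z \<in> \<bbbD> \<Longrightarrow> \<psi> (\<phi> z) = z"
begin

lemma bihol: "biholomorphic \<phi> \<bbbD> \<Omega>"
  using hol_\<phi> im_\<phi> hol_\<psi> \<psi>_\<phi> by (auto simp: biholomorphic_def)

lemma \<phi>_in: "z \<in> \<bbbD> \<Longrightarrow> \<phi> z \<in> \<Omega>" and \<psi>_in: "x \<in> \<Omega> \<Longrightarrow> \<psi> x \<in> \<bbbD>" and \<phi>_\<psi>: "x \<in> \<Omega> \<Longrightarrow> \<phi> (\<psi> x) = x"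
  using im_\<phi> \<psi>_\<phi> by (blast, metis image_iff, metis image_iff)

lemma deriv_inverse:
  assumes z: "z \<in> \<bbbD>" shows "deriv \<psi> (\<phi> z) * deriv \<phi> z = 1"
proof -
  have "(\<phi> has_field_derivative deriv \<phi> z) (at z)"
    using hol_\<phi> z by (intro holomorphic_derivI) auto
  moreover have "(\<psi> has_field_derivative deriv \<psi> (\<phi> z)) (at (\<phi> z))"
    using hol_\<psi> open_\<Omega> \<phi>_in[OF z] by (intro holomorphic_derivI) auto
  ultimately have "((\<lambda>w. \<psi> (\<phi> w)) has_field_derivative deriv \<psi> (\<phi> z) * deriv \<phi> z) (at z)"
    by (rule DERIV_chain2[rotated])
  moreover have "((\<lambda>w. \<psi> (\<phi> w)) has_field_derivative 1) (at z)"
    using z \<psi>_\<phi> by (intro has_field_derivative_transform_within_open[OF DERIV_ident, of \<bbbD>]) auto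
  ultimately show ?thesis by (rule DERIV_unique)
qed

lemma deriv_nonzero: "z \<in> \<bbbD> \<Longrightarrow> deriv \<phi> z \<noteq> 0"
  using deriv_inverse[of z] by auto

text \<open>The unitary map from L^2 of \<Omega> to L^2 of the disc that carries one Bergman space
  to the other.\<close>

definition pull :: "(complex \<Rightarrow> complex) \<Rightarrow> complex \<Rightarrow> complex" where
  "pull f z = f (\<phi> z) * deriv \<phi> z"

text \<open>Zero off \<Omega>, to match the representative chosen in
  \<open>bergman_proj\<close>.\<close>

definition push :: "(complex \<Rightarrow> complex) \<Rightarrow> complex \<Rightarrow> complex" where
  "push G x = (if x \<in> \<Omega> then G (\<psi> x) * deriv \<psi> x else 0)"

lemma pull_push: "z \<in> \<bbbD> \<Longrightarrow> pull (push G) z = G z"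
  using deriv_inverse[of z] \<phi>_in[of z] by (simp add: pull_def push_def \<psi>_\<phi> mult.assoc)

lemma push_holomorphic: "G holomorphic_on \<bbbD> \<Longrightarrow> push G holomorphic_on \<Omega>"
proof -
  assume G: "G holomorphic_on \<bbbD>"
  have "(\<lambda>x. G (\<psi> x)) holomorphic_on \<Omega>"
    using holomorphic_on_compose_gen[OF hol_\<psi> G] \<psi>_in by (auto simp: o_def image_subset_iff)
  then have "(\<lambda>x. G (\<psi> x) * deriv \<psi> x) holomorphic_on \<Omega>"
    using hol_\<psi> open_\<Omega> by (intro holomorphic_intros) auto
  then show ?thesis by (rule holomorphic_transform) (simp add: push_def)
qed

lemma pull_holomorphic: "f holomorphic_on \<Omega> \<Longrightarrow> pull f holomorphic_on \<bbbD>"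
proof -
  assume f: "f holomorphic_on \<Omega>"
  have "(\<lambda>z. f (\<phi> z)) holomorphic_on \<bbbD>"
    using holomorphic_on_compose_gen[OF hol_\<phi> f] im_\<phi> by (auto simp: o_def)
  then show ?thesis unfolding pull_def[abs_def]
    using hol_\<phi> by (intro holomorphic_intros) auto
qed

lemma measurable_\<phi>: "\<phi> \<in> measurable dA (area_on \<Omega>)"
  by (rule measurable_biholomorphic[OF open_ball open_\<Omega> bihol])

lemma pull_measurable:
  assumes "f \<in> borel_measurable (area_on \<Omega>)" shows "pull f \<in> borel_measurable dA"
proof -
  have "deriv \<phi> \<in> borel_measurable dA"
    using hol_\<phi> by (intro continuous_on_area_on holomorphic_on_imp_continuous_on holomorphic_deriv) auto
  then show ?thesis unfolding pull_def[abs_def]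
    by (intro borel_measurable_times measurable_compose[OF measurable_\<phi> assms])
qed

lemma holomorphic_measurable: "f holomorphic_on \<Omega> \<Longrightarrow> f \<in> borel_measurable (area_on \<Omega>)"
  by (intro continuous_on_area_on holomorphic_on_imp_continuous_on)

text \<open>The Jacobian splits as |\<phi>'|^2 = |\<phi>'|^p |\<phi>'|^(2-p): the first factor
  completes \<open>pull f\<close>, the second joins the weight.\<close>

lemma nn_integral_pull:
  assumes f: "f \<in> borel_measurable (area_on \<Omega>)" and w: "w \<in> borel_measurable (area_on \<Omega>)"
  shows "(\<integral>\<^sup>+x. ennreal (cmod (f x) powr p * w x) \<partial>area_on \<Omega>)
    = (\<integral>\<^sup>+z. ennreal (cmod (pull f z) powr p * (cmod (deriv \<phi> z) powr (2 - p) * w (\<phi> z))) \<partial>dA)"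
proof -
  have "(\<lambda>x. ennreal (cmod (f x) powr p * w x)) \<in> borel_measurable (area_on \<Omega>)"
    using f w by (intro measurable_compose[OF _ measurable_ennreal] borel_measurable_times
       powr_real_measurable borel_measurable_const measurable_compose[OF f borel_measurable_norm])
  then have "(\<integral>\<^sup>+x. ennreal (cmod (f x) powr p * w x) \<partial>area_on \<Omega>)
    = (\<integral>\<^sup>+z. ennreal (cmod (deriv \<phi> z) ^ 2) * ennreal (cmod (f (\<phi> z)) powr p * w (\<phi> z)) \<partial>dA)"
    by (rule nn_integral_biholomorphic[OF open_ball open_\<Omega> bihol])
  also have "\<dots> = (\<integral>\<^sup>+z. ennreal (cmod (pull f z) powr p * (cmod (deriv \<phi> z) powr (2 - p) * w (\<phi> z))) \<partial>dA)"
  proof (rule nn_integral_cong)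
    fix z assume "z \<in> space dA"
    then have "deriv \<phi> z \<noteq> 0" using deriv_nonzero by simp
    then have "cmod (deriv \<phi> z) ^ 2 = cmod (deriv \<phi> z) powr p * cmod (deriv \<phi> z) powr (2 - p)"
      by (simp add: powr_add[symmetric])
    then have "cmod (deriv \<phi> z) ^ 2 * (cmod (f (\<phi> z)) powr p * w (\<phi> z))
      = cmod (pull f z) powr p * (cmod (deriv \<phi> z) powr (2 - p) * w (\<phi> z))"
      by (simp add: pull_def norm_mult powr_mult mult_ac)
    then show "ennreal (cmod (deriv \<phi> z) ^ 2) * ennreal (cmod (f (\<phi> z)) powr p * w (\<phi> z))
      = ennreal (cmod (pull f z) powr p * (cmod (deriv \<phi> z) powr (2 - p) * w (\<phi> z)))"
      by (simp only: ennreal_mult'[OF zero_le_power2, symmetric])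
  qed
  finally show ?thesis .
qed

lemma L2_space_iff:
  assumes "f \<in> borel_measurable (area_on \<Omega>)"
  shows "f \<in> L2_space \<Omega> \<longleftrightarrow> disc_L2 (pull f)"
proof -
  have "(\<integral>\<^sup>+x. ennreal (cmod (f x) powr 2 * 1) \<partial>area_on \<Omega>)
    = (\<integral>\<^sup>+z. ennreal (cmod (pull f z) powr 2 * (cmod (deriv \<phi> z) powr (2 - 2) * 1)) \<partial>dA)"
    by (rule nn_integral_pull[OF assms]) simp
  also have "\<dots> = (\<integral>\<^sup>+z. ennreal ((cmod (pull f z))\<^sup>2) \<partial>dA)"
    using deriv_nonzero by (intro nn_integral_cong) auto
  finally show ?thesis
    using assms pull_measurable[OF assms]
    by (simp add: Lp_space_def Lp_norm_less_top_iff[OF open_\<Omega>] disc_L2_def measurable_area_on)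
qed

lemma inner_product_pull:
  assumes f: "f \<in> borel_measurable (area_on \<Omega>)" and h: "h \<in> borel_measurable (area_on \<Omega>)"
  shows "(LINT x:\<Omega>|area. f x * cnj (h x)) = (\<integral>z. pull f z * cnj (pull h z) \<partial>dA)"
proof -
  have "(LINT x:\<Omega>|area. f x * cnj (h x)) = (\<integral>x. f x * cnj (h x) \<partial>area_on \<Omega>)"
    using open_\<Omega> unfolding set_lebesgue_integral_def by (subst integral_restrict_space) auto
  also have "\<dots> = (\<integral>z. cmod (deriv \<phi> z) ^ 2 *\<^sub>R (f (\<phi> z) * cnj (h (\<phi> z))) \<partial>dA)"
    using f h by (intro integral_biholomorphic[OF open_ball open_\<Omega> bihol] borel_measurable_times
        measurable_compose[OF h borel_measurable_cnj])
  also have "\<dots> = (\<integral>z. pull f z * cnj (pull h z) \<partial>dA)"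
  proof -
    have "cmod (deriv \<phi> z) ^ 2 *\<^sub>R (f (\<phi> z) * cnj (h (\<phi> z))) = pull f z * cnj (pull h z)" for z
      by (simp only: pull_def scaleR_conv_of_real complex_norm_square complex_cnj_mult mult_ac)
    then show ?thesis by simp
  qed
  finally show ?thesis .
qed

text \<open>Orthogonality on the disc shows that the transplanted operator meets the defining
  conditions. For uniqueness, the difference of two candidates lies in the Bergman space and is
  orthogonal to itself, so it vanishes almost everywhere and by continuity on all of
  \<Omega>.\<close>

lemma bergman_proj_eq_push:
  assumes f: "f \<in> L2_space \<Omega>"
  shows "bergman_proj \<Omega> f = push (disc_proj (pull f))"
  unfolding bergman_proj_def
proof (rule the_equality)
  let ?P = "disc_proj (pull f)"
  let ?g = "push (?P)"
  have fm: "f \<in> borel_measurable (area_on \<Omega>)" using f by (simp add: Lp_space_def measurable_area_on)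
  have F: "disc_L2 (pull f)" using L2_space_iff[OF fm] f by blast
  have PF: "disc_L2 (?P)" by (rule disc_proj_L2[OF F])
  have PFh: "?P holomorphic_on \<bbbD>" by (rule disc_proj_holomorphic[OF disc_L2_integrable[OF F]])
  have gh: "?g holomorphic_on \<Omega>" by (rule push_holomorphic[OF PFh])
  have gm: "?g \<in> borel_measurable (area_on \<Omega>)" by (rule holomorphic_measurable[OF gh])
  \<comment> \<open>\<open>pull (push G)\<close> and \<open>G\<close> agree on the disc only, and
    \<open>disc_L2\<close> depends on nothing else.\<close>
  have L2_cong: "disc_L2 G \<longleftrightarrow> disc_L2 G'" if "\<And>z. z \<in> \<bbbD> \<Longrightarrow> G z = G' z" for G G'
  proof -
    have "G \<in> borel_measurable dA \<longleftrightarrow> G' \<in> borel_measurable dA"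
      using that by (intro measurable_cong) auto
    moreover have "(\<integral>\<^sup>+z. ennreal ((cmod (G z))\<^sup>2) \<partial>dA) = (\<integral>\<^sup>+z. ennreal ((cmod (G' z))\<^sup>2) \<partial>dA)"
      using that by (intro nn_integral_cong) auto
    ultimately show ?thesis by (simp add: disc_L2_def)
  qed
  have g2: "?g \<in> L2_space \<Omega>"
    using L2_space_iff[OF gm] PF L2_cong[of "pull ?g" "?P"] pull_push by blast
  have inner: "(LINT z:\<Omega>|area. (f z - g z) * cnj (h z))
      = (\<integral>z. (pull f z - pull g z) * cnj (pull h z) \<partial>dA)"
    if "g holomorphic_on \<Omega>" "h holomorphic_on \<Omega>" for g h
  proof -
    have "(\<lambda>z. f z - g z) \<in> borel_measurable (area_on \<Omega>)"
      using fm holomorphic_measurable[OF that(1)] by simp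
    moreover have "pull (\<lambda>z. f z - g z) z = pull f z - pull g z" for z
      by (simp add: pull_def left_diff_distrib)
    ultimately show ?thesis
      using inner_product_pull[of "\<lambda>z. f z - g z" h] holomorphic_measurable[OF that(2)] by simp
  qed
  have orth0: "(\<integral>z. (pull f z - ?P z) * cnj (pull h z) \<partial>dA) = 0"
    if h: "h \<in> bergman_space \<Omega>" for h
  proof (rule disc_proj_orthogonal[OF F])
    have hh: "h holomorphic_on \<Omega>" using h by (simp add: bergman_space_def)
    show "disc_L2 (pull h)" using L2_space_iff[OF holomorphic_measurable[OF hh]] h by (simp add: bergman_space_def)
    show "pull h holomorphic_on \<bbbD>" by (rule pull_holomorphic[OF hh])
  qed
  show "?g \<in> bergman_space \<Omega> \<and> (\<forall>z. z \<notin> \<Omega> \<longrightarrow> ?g z = 0) \<and>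
      (\<forall>h\<in>bergman_space \<Omega>. (LINT z:\<Omega>|area. (f z - ?g z) * cnj (h z)) = 0)"
  proof (intro conjI ballI allI impI)
    show "?g \<in> bergman_space \<Omega>" using gh g2 by (simp add: bergman_space_def)
    show "?g z = 0" if "z \<notin> \<Omega>" for z using that by (simp add: push_def)
    fix h assume h: "h \<in> bergman_space \<Omega>"
    then have "(LINT z:\<Omega>|area. (f z - ?g z) * cnj (h z))
        = (\<integral>z. (pull f z - pull ?g z) * cnj (pull h z) \<partial>dA)"
      using gh by (intro inner) (auto simp: bergman_space_def)
    also have "\<dots> = (\<integral>z. (pull f z - ?P z) * cnj (pull h z) \<partial>dA)"
      by (intro Bochner_Integration.integral_cong refl) (simp only: space_area_on pull_push)
    finally show "(LINT z:\<Omega>|area. (f z - ?g z) * cnj (h z)) = 0" using orth0[OF h] by simp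
  qed
  fix g assume g: "g \<in> bergman_space \<Omega> \<and> (\<forall>z. z \<notin> \<Omega> \<longrightarrow> g z = 0) \<and>
      (\<forall>h\<in>bergman_space \<Omega>. (LINT z:\<Omega>|area. (f z - g z) * cnj (h z)) = 0)"
  then have hol: "g holomorphic_on \<Omega>" by (simp add: bergman_space_def)
  have G: "disc_L2 (pull g)"
    using L2_space_iff[OF holomorphic_measurable[OF hol]] g by (simp add: bergman_space_def)
  let ?h = "\<lambda>x. g x - ?g x"
  let ?H = "\<lambda>z. pull g z - ?P z"
  have hh: "?h holomorphic_on \<Omega>" using hol gh by (intro holomorphic_intros)
  have pull_h: "pull ?h z = ?H z" if "z \<in> \<bbbD>" for z
    using pull_push[OF that, of "?P"] by (simp add: pull_def left_diff_distrib)
  have H2: "disc_L2 ?H"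
  proof -
    have "?H \<in> borel_measurable dA" using G PF by (auto simp: disc_L2_def)
    moreover have "(\<integral>\<^sup>+z. ennreal ((cmod (?H z))\<^sup>2) \<partial>dA)
      \<le> (\<integral>\<^sup>+z. 2 * ennreal ((cmod (pull g z))\<^sup>2) + 2 * ennreal ((cmod (?P z))\<^sup>2) \<partial>dA)"
    proof (rule nn_integral_mono)
      fix z
      have "(cmod (?H z))\<^sup>2 \<le> (cmod (pull g z) + cmod (?P z))\<^sup>2"
        by (intro power_mono norm_triangle_ineq4) auto
      also have "\<dots> \<le> 2 * (cmod (pull g z))\<^sup>2 + 2 * (cmod (?P z))\<^sup>2"
        using sum_squares_bound[of "cmod (pull g z)" "cmod (?P z)"]
        by (simp add: power2_sum)
      finally have "ennreal ((cmod (?H z))\<^sup>2) \<le> ennreal (2 * (cmod (pull g z))\<^sup>2 + 2 * (cmod (?P z))\<^sup>2)"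
        by (rule ennreal_leI)
      then show "ennreal ((cmod (?H z))\<^sup>2) \<le> 2 * ennreal ((cmod (pull g z))\<^sup>2) + 2 * ennreal ((cmod (?P z))\<^sup>2)"
        by (simp add: ennreal_mult')
    qed
    moreover have "\<dots> < top"
      using G PF by (subst nn_integral_add) (auto simp: disc_L2_def nn_integral_cmult ennreal_mult_less_top)
    ultimately show ?thesis by (simp add: disc_L2_def)
  qed
  have h_space: "?h \<in> bergman_space \<Omega>"
    using L2_space_iff[OF holomorphic_measurable[OF hh]] H2 L2_cong[of "pull ?h" ?H] pull_h hh
    by (simp add: bergman_space_def)
  have e1: "(\<integral>z. (pull f z - pull g z) * cnj (?H z) \<partial>dA) = 0"
  proof -
    have "(\<integral>z. (pull f z - pull g z) * cnj (?H z) \<partial>dA) = (\<integral>z. (pull f z - pull g z) * cnj (pull ?h z) \<partial>dA)"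
      by (intro Bochner_Integration.integral_cong refl) (simp only: space_area_on pull_h)
    also have "\<dots> = (LINT z:\<Omega>|area. (f z - g z) * cnj (?h z))" by (rule inner[OF hol hh, symmetric])
    also have "\<dots> = 0" using bspec[OF conjunct2[OF conjunct2[OF g]] h_space] by simp
    finally show ?thesis .
  qed
  have e2: "(\<integral>z. (pull f z - ?P z) * cnj (?H z) \<partial>dA) = 0"
  proof -
    have "(\<integral>z. (pull f z - ?P z) * cnj (?H z) \<partial>dA)
        = (\<integral>z. (pull f z - ?P z) * cnj (pull ?h z) \<partial>dA)"
      by (intro Bochner_Integration.integral_cong refl) (simp only: space_area_on pull_h)
    then show ?thesis using orth0[OF h_space] by simp
  qed
  note i = disc_L2_mult_integrable[OF F H2] disc_L2_mult_integrable[OF G H2] disc_L2_mult_integrable[OF PF H2]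
  \<comment> \<open>Subtracting the orthogonality relations \<open>e1\<close> and \<open>e2\<close>
    gives the squared norm of \<open>?H\<close>.\<close>
  have "(\<integral>z. ?H z * cnj (?H z) \<partial>dA)
      = (\<integral>z. pull g z * cnj (?H z) \<partial>dA) - (\<integral>z. ?P z * cnj (?H z) \<partial>dA)"
    using Bochner_Integration.integral_diff[OF i(2,3)] by (simp only: left_diff_distrib)
  also have "\<dots> = 0"
    using e1 e2 Bochner_Integration.integral_diff[OF i(1,2)] Bochner_Integration.integral_diff[OF i(1,3)]
    by (simp only: left_diff_distrib) simp
  finally have "(\<integral>z. complex_of_real ((cmod (?H z))\<^sup>2) \<partial>dA) = 0"
    by (simp only: complex_norm_square)
  then have zero: "(\<integral>z. (cmod (?H z))\<^sup>2 \<partial>dA) = 0" by (simp only: integral_complex_of_real of_real_eq_0_iff)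
  have "integrable dA (\<lambda>z. (cmod (?H z))\<^sup>2)"
    using H2 by (intro integrableI_bounded) (auto simp: disc_L2_def)
  then have "AE z in dA. (cmod (?H z))\<^sup>2 = 0"
    using zero by (subst (asm) integral_nonneg_eq_0_iff_AE) auto
  then have AE: "AE z in dA. ?H z = 0" by eventually_elim auto
  have cont: "continuous_on \<bbbD> ?H"
    using PFh pull_holomorphic[OF hol] by (intro holomorphic_on_imp_continuous_on holomorphic_intros)
  have pull_eq: "pull g z = pull ?g z" if "z \<in> \<bbbD>" for z
    using AE_zero_disc_continuous[OF cont AE that] pull_push[OF that] by simp
  show "g = ?g"
  proof
    fix x
    show "g x = ?g x"
    proof (cases "x \<in> \<Omega>")
      case True
      then show ?thesis
        using pull_eq[OF \<psi>_in[OF True]] deriv_nonzero[OF \<psi>_in[OF True]] by (simp add: pull_def \<phi>_\<psi>)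
    next
      case False
      then show ?thesis using g by (simp add: push_def)
    qed
  qed
qed

end

section \<open>Weights on boundary caps\<close>

lemma ennreal_epowr: "x \<ge> 0 \<Longrightarrow> ennreal x epowr a = ennreal (x powr a)"
  by (simp add: epowr_def)

lemma boundary_cap_facts:
  assumes \<zeta>: "\<zeta> \<in> sphere 0 1" and r: "r > 0"
  shows "ball \<zeta> r \<inter> \<bbbD> \<in> sets lebesgue" "emeasure area (ball \<zeta> r \<inter> \<bbbD>) > 0"
    "emeasure area (ball \<zeta> r \<inter> \<bbbD>) \<le> ennreal (r\<^sup>2)"
proof -
  show "ball \<zeta> r \<inter> \<bbbD> \<in> sets lebesgue" by simp
  have "\<zeta> \<in> ball \<zeta> r \<inter> closure \<bbbD>" using \<zeta> r by simp
  then have "ball \<zeta> r \<inter> closure \<bbbD> \<noteq> {}" by blast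
  then have "ball \<zeta> r \<inter> \<bbbD> \<noteq> {}" using open_Int_closure_eq_empty[of "ball \<zeta> r" \<bbbD>] by auto
  then obtain z where "z \<in> ball \<zeta> r \<inter> \<bbbD>" by blast
  then obtain e where e: "e > 0" "ball z e \<subseteq> ball \<zeta> r \<inter> \<bbbD>"
    by (metis openE open_Int open_ball)
  have "0 < emeasure area (ball z e)" using e by (simp add: emeasure_area_ball)
  also have "\<dots> \<le> emeasure area (ball \<zeta> r \<inter> \<bbbD>)" using e by (intro emeasure_mono) auto
  finally show "emeasure area (ball \<zeta> r \<inter> \<bbbD>) > 0" .
  have "emeasure area (ball \<zeta> r \<inter> \<bbbD>) \<le> emeasure area (ball \<zeta> r)" by (intro emeasure_mono) auto
  then show "emeasure area (ball \<zeta> r \<inter> \<bbbD>) \<le> ennreal (r\<^sup>2)" using r by (simp add: emeasure_area_ball)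
qed

lemma avg_cong_AE:
  assumes "AE z in area. z \<in> \<bbbD> \<longrightarrow> f z = g z" and "E \<subseteq> \<bbbD>"
  shows "avg E f = avg E g"
proof -
  have "(\<integral>\<^sup>+z\<in>E. ennreal (f z) \<partial>area) = (\<integral>\<^sup>+z\<in>E. ennreal (g z) \<partial>area)"
    using assms(1) by (intro nn_integral_cong_AE, eventually_elim) (use assms(2) in \<open>auto simp: indicator_def\<close>)
  then show ?thesis by (simp add: avg_def)
qed

text \<open>Permits changing a weight on a null set, so that it can be made positive
  everywhere.\<close>

lemma Ap_const_cong_AE:
  assumes "AE z in area. z \<in> \<bbbD> \<longrightarrow> f z = g z"
  shows "Ap_const p f = Ap_const p g"
proof -
  have "AE z in area. z \<in> \<bbbD> \<longrightarrow> f z powr (- 1 / (p - 1)) = g z powr (- 1 / (p - 1))"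
    using assms by eventually_elim auto
  then show ?thesis unfolding Ap_const_def
    using avg_cong_AE[OF assms] avg_cong_AE[of "\<lambda>z. f z powr (- 1 / (p - 1))" "\<lambda>z. g z powr (- 1 / (p - 1))"]
    by (intro SUP_cong refl) simp
qed

lemma RH_const_cong_AE:
  assumes "AE z in area. z \<in> \<bbbD> \<longrightarrow> f z = g z"
  shows "RH_const q f = RH_const q g"
proof -
  have "AE z in area. z \<in> \<bbbD> \<longrightarrow> f z powr q = g z powr q"
    using assms by eventually_elim auto
  then show ?thesis unfolding RH_const_def RH_quotient_def
    using avg_cong_AE[OF assms] avg_cong_AE[of "\<lambda>z. f z powr q" "\<lambda>z. g z powr q"]
    by (intro SUP_cong refl) simp
qed

lemma avg_pos:
  assumes h: "h \<in> borel_measurable dA" "\<And>z. z \<in> \<bbbD> \<Longrightarrow> h z > 0"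
    and E: "E \<in> sets lebesgue" "E \<subseteq> \<bbbD>" "emeasure area E > 0" "emeasure area E < top"
  shows "avg E h > 0"
proof -
  have EM: "E \<in> sets dA" using E by (simp add: sets_restrict_space_iff)
  have "(\<integral>\<^sup>+z\<in>E. ennreal (h z) \<partial>area) = (\<integral>\<^sup>+z. ennreal (h z) * indicator E z \<partial>dA)"
    using E by (subst nn_integral_restrict_space) (auto intro!: nn_integral_cong simp: indicator_def)
  moreover have "(\<integral>\<^sup>+z. ennreal (h z) * indicator E z \<partial>dA) \<noteq> 0"
  proof
    assume z: "(\<integral>\<^sup>+z. ennreal (h z) * indicator E z \<partial>dA) = 0"
    have "(\<lambda>z. ennreal (h z) * indicator E z) \<in> borel_measurable dA"
      by (intro borel_measurable_times_ennreal measurable_compose[OF h(1) measurable_ennreal] borel_measurable_indicator EM)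
    then have "AE z in dA. ennreal (h z) * indicator E z = 0"
      using z by (simp add: nn_integral_0_iff_AE)
    moreover have "AE z in dA. z \<in> \<bbbD>" using AE_space[of "dA"] by simp
    ultimately have "AE z in dA. z \<notin> E"
    proof eventually_elim
      case (elim z)
      then show ?case using h(2)[of z] by (auto simp: indicator_def)
    qed
    then have "emeasure dA E = 0"
      using EM by (subst (asm) AE_iff_measurable[OF EM]) (use E in auto)
    then show False using E by (simp add: emeasure_restrict_space)
  qed
  ultimately show ?thesis
    unfolding avg_def using E by (simp add: ennreal_zero_less_divide zero_less_iff_neq_zero)
qed

lemma avg_Holder:
  fixes P Q :: real
  assumes PQ: "P > 1" "Q > 1" "1 / P + 1 / Q = 1"
    and f: "f \<in> borel_measurable dA" "\<And>z. z \<in> \<bbbD> \<Longrightarrow> f z \<ge> 0"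
    and g: "g \<in> borel_measurable dA" "\<And>z. z \<in> \<bbbD> \<Longrightarrow> g z \<ge> 0"
    and E: "E \<in> sets lebesgue" "E \<subseteq> \<bbbD>" "emeasure area E = ennreal m" "m > 0"
    and a: "avg E (\<lambda>z. f z powr P) = ennreal a" "a \<ge> 0"
    and b: "avg E (\<lambda>z. g z powr Q) = ennreal b" "b \<ge> 0"
  shows "(\<integral>\<^sup>+z\<in>E. ennreal (f z * g z) \<partial>area) \<le> ennreal (m * (a powr (1 / P) * b powr (1 / Q)))"
proof -
  have int: "(\<integral>\<^sup>+z\<in>E. ennreal (h z) \<partial>area) = (\<integral>\<^sup>+z. ennreal (h z) \<partial>area_on E)" for h
    using E(1) by (subst nn_integral_restrict_space) auto
  have avg_int: "(\<integral>\<^sup>+z. ennreal (h z) \<partial>area_on E) = ennreal (c * m)" if "avg E h = ennreal c" "c \<ge> 0" for h c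
  proof -
    have "avg E h * emeasure area E = (\<integral>\<^sup>+z\<in>E. ennreal (h z) \<partial>area)"
      unfolding avg_def using E by (simp add: ennreal_divide_times ennreal_times_divide divide_mult_eq mult_divide_eq_ennreal ennreal_mult_divide_eq)
    then show ?thesis using that E by (simp add: int ennreal_mult')
  qed
  have meas: "f \<in> borel_measurable (area_on E)" "g \<in> borel_measurable (area_on E)"
    using f(1) g(1) E(2) by (blast intro: measurable_restrict_mono)+
  have "(\<integral>\<^sup>+z. ennreal (f z * g z) \<partial>area_on E) \<le> ennreal ((a * m) powr (1 / P) * (b * m) powr (1 / Q))"
    by (rule Holder_nn_integral_bound[OF PQ meas])
      (use f g E a b avg_int[of "\<lambda>z. f z powr P"] avg_int[of "\<lambda>z. g z powr Q"] in \<open>auto simp: subset_eq\<close>)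
  also have "(a * m) powr (1 / P) * (b * m) powr (1 / Q) = (m powr (1 / P) * m powr (1 / Q)) * (a powr (1 / P) * b powr (1 / Q))"
    by (simp add: powr_mult)
  also have "m powr (1 / P) * m powr (1 / Q) = m" using PQ E(4) by (simp add: powr_add[symmetric])
  finally show ?thesis by (simp add: int)
qed

text \<open>\<sigma> is p0'/p and S its conjugate, the reverse Hoelder exponent. For u^(-1/(p-1))
  the pair is \<tau> = (p-1) \<sigma> and t: raising to \<tau> turns the power of w into -1, raising
  to t turns that of v into the dual power of A_(p/p0). The product estimate rests on these two
  being conjugate as well.\<close>

lemma exponent_facts:
  fixes p0 p :: real
  assumes "1 < p0" "p0 < p" "p < conj_exp p0"
  defines "\<sigma> \<equiv> p0 / (p * (p0 - 1))" and "S \<equiv> conj_exp (conj_exp p0 / p)"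
    and "\<tau> \<equiv> (p - 1) * (p0 / (p * (p0 - 1)))" and "t \<equiv> p0 * (p - 1) / (p - p0)"
  shows "\<sigma> > 1" "S > 1" "1 / \<sigma> + 1 / S = 1" "\<tau> > 1" "t > 1" "1 / \<tau> + 1 / t = 1"
    "(p - 1) / \<tau> = 1 / \<sigma>" "(p - 1) / t = p / p0 - 1" "1 / \<sigma> = p * (p0 - 1) / p0"
    "t / (p - 1) = 1 / (p / p0 - 1)"
proof -
  have p: "p > 1" "p > 0" "p0 > 0" using assms by auto
  have lt: "p * (p0 - 1) < p0" using assms(1,3) by (simp add: conj_exp_def pos_less_divide_eq)
  have pos: "p * (p0 - 1) > 0" using assms p by simp
  show s: "\<sigma> > 1" using lt pos by (simp add: \<sigma>_def)
  have S: "S = \<sigma> / (\<sigma> - 1)" by (simp add: S_def \<sigma>_def conj_exp_def mult.commute)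
  show "S > 1" using s by (simp add: S)
  show "1 / \<sigma> + 1 / S = 1" using s by (simp add: S field_simps)
  have "p * (p0 - 1) < p0 * (p - 1)" using assms by (simp add: algebra_simps)
  then show "\<tau> > 1" using pos by (simp add: \<tau>_def mult.commute)
  have "p - p0 < p0 * (p - 1)" using mult_strict_right_mono[of 1 p0 p] assms p by (simp add: algebra_simps)
  then show "t > 1" using assms by (simp add: t_def)
  have "1 / \<tau> + 1 / t = (p * (p0 - 1) + (p - p0)) / (p0 * (p - 1))"
    using p by (simp add: \<tau>_def t_def add_divide_distrib mult.commute)
  also have "p * (p0 - 1) + (p - p0) = p0 * (p - 1)" by (simp add: algebra_simps)
  finally show "1 / \<tau> + 1 / t = 1" using p by simp
  show "(p - 1) / \<tau> = 1 / \<sigma>" using p by (simp add: \<tau>_def \<sigma>_def)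
  have "(p - 1) / t = (p - p0) / p0" unfolding t_def using p assms by simp
  then show "(p - 1) / t = p / p0 - 1" using p by (simp add: diff_divide_distrib)
  show "1 / \<sigma> = p * (p0 - 1) / p0" by (simp add: \<sigma>_def)
  have "t / (p - 1) = p0 / (p - p0)" unfolding t_def using p assms by simp
  also have "\<dots> = 1 / ((p - p0) / p0)" by simp
  also have "(p - p0) / p0 = p / p0 - 1" using p by (simp add: diff_divide_distrib)
  finally show "t / (p - 1) = 1 / (p / p0 - 1)" .
qed

lemma mult_finite_real:
  assumes "x * y \<le> K" "K < top" "x > 0" "y > (0::ennreal)"
  obtains a b where "x = ennreal a" "y = ennreal b" "a > 0" "b > 0"
proof -
  have "x * y < top" using assms by (rule_tac order_le_less_trans)
  then have "x < top" "y < top" using assms by (auto simp: ennreal_mult_less_top)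
  then obtain a b where "x = ennreal a" "y = ennreal b" "a \<ge> 0" "b \<ge> 0" by (cases x; cases y) auto
  then show thesis using assms that[of a b] by auto
qed

text \<open>Hoelder with (\<sigma>, S) for u and with (\<tau>, t) for its dual power. Raising the
  second to p - 1 makes both means of w appear to the power 1/\<sigma>, an A_2 product; the mean of
  v, restored by the reverse Hoelder condition, meets its dual mean in an A_(p/p0) product.\<close>

lemma product_weight_cap:
  fixes p0 p :: real
  assumes p0: "1 < p0" "p0 < p" "p < conj_exp p0"
    and w: "w \<in> borel_measurable dA" "\<And>z. z \<in> \<bbbD> \<Longrightarrow> w z > 0"
    and v: "v \<in> borel_measurable dA" "\<And>z. z \<in> \<bbbD> \<Longrightarrow> v z > 0"
    and A2: "Ap_const 2 w = ennreal A2" "A2 \<ge> 0"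
    and A: "Ap_const (p / p0) v = ennreal A" "A \<ge> 0"
    and R: "RH_const (conj_exp (conj_exp p0 / p)) v = ennreal R" "R \<ge> 0"
    and \<zeta>: "\<zeta> \<in> sphere 0 1" and r: "r > 0"
  defines "E \<equiv> ball \<zeta> r \<inter> \<bbbD>" and "u \<equiv> \<lambda>z. w z powr (p * (p0 - 1) / p0) * v z"
  shows "\<exists>x y. (\<integral>\<^sup>+z\<in>E. ennreal (u z) \<partial>area) \<le> ennreal x \<and> x > 0 \<and>
    (\<integral>\<^sup>+z\<in>E. ennreal (u z powr (- 1 / (p - 1))) \<partial>area) \<le> ennreal y \<and> y > 0 \<and>
    x * y powr (p - 1) \<le> (A * R * A2 powr (p * (p0 - 1) / p0)) * (r\<^sup>2) powr p"
proof -
  define \<sigma> where "\<sigma> = p0 / (p * (p0 - 1))"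
  define S where "S = conj_exp (conj_exp p0 / p)"
  define \<tau> where "\<tau> = (p - 1) * (p0 / (p * (p0 - 1)))"
  define t where "t = p0 * (p - 1) / (p - p0)"
  note ex = exponent_facts[OF p0, folded \<sigma>_def S_def \<tau>_def t_def]
  have p: "p > 1" using p0 by simp
  note cap = boundary_cap_facts[OF \<zeta> r, folded E_def]
  have ED: "E \<subseteq> \<bbbD>" by (simp add: E_def)
  have fin: "emeasure area E < top" using cap(3) ennreal_less_top order_le_less_trans by blast
  obtain m where m: "emeasure area E = ennreal m" "m > 0" "m \<le> r\<^sup>2"
    using cap(2,3) fin by (cases "emeasure area E") auto
  have meas_powr: "(\<lambda>z. h z powr a) \<in> borel_measurable dA"
    if "h \<in> borel_measurable dA" for h and a :: real
    using that by (intro powr_real_measurable borel_measurable_const)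
  have pos: "avg E h > 0" if "h \<in> borel_measurable dA" "\<And>z. z \<in> \<bbbD> \<Longrightarrow> h z > 0" for h
    by (rule avg_pos[OF that cap(1) ED cap(2) fin])
  have wpos: "w z powr a > 0" "v z powr a > 0" if "z \<in> \<bbbD>" for z a
    using w(2)[OF that] v(2)[OF that] by auto
  have le2: "avg E w * avg E (\<lambda>x. w x powr (- 1 / (2 - 1))) epowr (2 - 1) \<le> Ap_const 2 w"
    unfolding Ap_const_def E_def using \<zeta> r by (intro SUP_upper2[OF \<zeta>] SUP_upper2[of r]) auto
  have lep: "avg E v * avg E (\<lambda>x. v x powr (- 1 / (p / p0 - 1))) epowr (p / p0 - 1) \<le> Ap_const (p / p0) v"
    unfolding Ap_const_def E_def using \<zeta> r by (intro SUP_upper2[OF \<zeta>] SUP_upper2[of r]) auto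
  have leR: "RH_quotient S v E \<le> RH_const S v"
    unfolding RH_const_def E_def using \<zeta> r by (intro SUP_upper2[OF \<zeta>] SUP_upper2[of r]) auto
  have epos: "x epowr a > 0" if "x > 0" for x a
    using that by (cases x) (auto simp: epowr_def)
  obtain a1 a2' where a1: "avg E w = ennreal a1" "a1 > 0"
    and a2': "avg E (\<lambda>x. w x powr (- 1 / (2 - 1))) epowr (2 - 1) = ennreal a2'" "a2' > 0"
    using mult_finite_real[OF le2[unfolded A2(1)] ennreal_less_top pos[OF w] epos[OF pos[OF meas_powr[OF w(1)] wpos(1)]]]
    by metis
  obtain a2 where a2: "avg E (\<lambda>x. w x powr (- 1)) = ennreal a2" "a2 \<ge> 0"
    using a2' by (cases "avg E (\<lambda>x. w x powr (- 1))") (auto simp: epowr_def)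
  have A2le: "a1 * a2 \<le> A2"
    using le2 a1 a2 A2 by (simp add: ennreal_epowr ennreal_mult'[symmetric])
  obtain b1 b2' where b1: "avg E v = ennreal b1" "b1 > 0"
    and b2': "avg E (\<lambda>x. v x powr (- 1 / (p / p0 - 1))) epowr (p / p0 - 1) = ennreal b2'" "b2' > 0"
    using mult_finite_real[OF lep[unfolded A(1)] ennreal_less_top pos[OF v] epos[OF pos[OF meas_powr[OF v(1)] wpos(2)]]]
    by metis
  obtain b2 where b2: "avg E (\<lambda>x. v x powr (- 1 / (p / p0 - 1))) = ennreal b2" "b2 \<ge> 0"
    using b2' by (cases "avg E (\<lambda>x. v x powr (- 1 / (p / p0 - 1)))") (auto simp: epowr_def)
  have Ale: "b1 * b2 powr (p / p0 - 1) \<le> A"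
    using lep b1 b2 A by (simp add: ennreal_epowr ennreal_mult'[symmetric])
  \<comment> \<open>By the case distinction in \<open>RH_quotient\<close> an infinite numerator
    makes the quotient infinite, which a finite constant R excludes.\<close>
  have "avg E (\<lambda>x. v x powr S) \<noteq> top"
    using leR R(1)[folded S_def] by (auto simp: RH_quotient_def top_unique split: if_splits)
  then obtain c where c: "avg E (\<lambda>x. v x powr S) = ennreal c" "c \<ge> 0"
    by (cases "avg E (\<lambda>x. v x powr S)") auto
  have Rle: "c powr (1 / S) \<le> R * b1"
  proof -
    have "ennreal (c powr (1 / S) / b1) \<le> ennreal R"
      using leR c b1 R(1)[folded S_def] by (simp add: RH_quotient_def ennreal_epowr divide_ennreal)
    then show ?thesis using b1 R by (simp add: field_simps)
  qed
  have apos: "a1 > 0" "a2 > 0" "b1 > 0" "b2 > 0" "c > 0"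
  proof -
    show "a2 > 0" using pos[OF meas_powr[OF w(1)] wpos(1), of "-1"] a2 by simp
    show "b2 > 0" using pos[OF meas_powr[OF v(1)] wpos(2)] b2 by (metis ennreal_0 ennreal_less_zero_iff)
    show "c > 0" using pos[OF meas_powr[OF v(1)] wpos(2)] c by (metis ennreal_0 ennreal_less_zero_iff)
  qed (use a1 b1 in auto)
  define x where "x = m * (a1 powr (1 / \<sigma>) * c powr (1 / S))"
  define y where "y = m * (a2 powr (1 / \<tau>) * b2 powr (1 / t))"
  have xy: "x > 0" "y > 0" using m apos by (auto simp: x_def y_def)
  have up: "(\<integral>\<^sup>+z\<in>E. ennreal (u z) \<partial>area) \<le> ennreal x"
    unfolding x_def u_def ex(9)[symmetric]
  proof (rule avg_Holder[OF ex(1,2,3) meas_powr[OF w(1)] _ v(1) _ cap(1) ED m(1,2)])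
    have "avg E (\<lambda>z. (w z powr (1 / \<sigma>)) powr \<sigma>) = avg E w"
      using w(2) ex(1) by (intro avg_cong_AE AE_I2 ED) (auto simp: powr_powr less_imp_le)
    then show "avg E (\<lambda>z. (w z powr (1 / \<sigma>)) powr \<sigma>) = ennreal a1" using a1 by simp
  qed (use v(2) c apos in \<open>auto simp: less_imp_le\<close>)
  have sp: "(\<integral>\<^sup>+z\<in>E. ennreal (u z powr (- 1 / (p - 1))) \<partial>area) \<le> ennreal y"
  proof -
    have "(\<integral>\<^sup>+z\<in>E. ennreal (u z powr (- 1 / (p - 1))) \<partial>area)
        = (\<integral>\<^sup>+z\<in>E. ennreal (w z powr (- 1 / \<tau>) * v z powr (- 1 / (p - 1))) \<partial>area)"
    proof (intro nn_integral_cong)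
      fix z
      have "u z powr (- 1 / (p - 1)) = w z powr (- 1 / \<tau>) * v z powr (- 1 / (p - 1))"
      proof -
        have "(p * (p0 - 1) / p0) * (- 1 / (p - 1)) = - 1 / \<tau>"
          unfolding ex(9)[symmetric] ex(7)[symmetric] using p by simp
        then show ?thesis by (simp add: u_def powr_mult powr_powr)
      qed
      then show "ennreal (u z powr (- 1 / (p - 1))) * indicator E z
        = ennreal (w z powr (- 1 / \<tau>) * v z powr (- 1 / (p - 1))) * indicator E z" by simp
    qed
    also have "\<dots> \<le> ennreal y"
      unfolding y_def
    proof (rule avg_Holder[OF ex(4,5,6) meas_powr[OF w(1)] _ meas_powr[OF v(1)] _ cap(1) ED m(1,2)])
      have "avg E (\<lambda>z. (w z powr (- 1 / \<tau>)) powr \<tau>) = avg E (\<lambda>z. w z powr (- 1))"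
        using w(2) ex(4) by (intro avg_cong_AE AE_I2 ED) (auto simp: powr_powr)
      then show "avg E (\<lambda>z. (w z powr (- 1 / \<tau>)) powr \<tau>) = ennreal a2" using a2 by simp
      have "- 1 / (p - 1) * t = - 1 / (p / p0 - 1)" using ex(10) by (simp add: field_simps)
      then have "(v z powr (- 1 / (p - 1))) powr t = v z powr (- 1 / (p / p0 - 1))" for z
        by (simp only: powr_powr)
      then show "avg E (\<lambda>z. (v z powr (- 1 / (p - 1))) powr t) = ennreal b2" using b2 by simp
    qed (use apos in auto)
    finally show ?thesis .
  qed
  have "x * y powr (p - 1) = m powr p * ((a1 * a2) powr (1 / \<sigma>)) * (c powr (1 / S) * b2 powr (p / p0 - 1))"
  proof -
    have "y powr (p - 1) = m powr (p - 1) * (a2 powr ((p - 1) / \<tau>) * b2 powr ((p - 1) / t))"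
      by (simp add: y_def powr_mult powr_powr)
    moreover have "m * m powr (p - 1) = m powr p" using m by (simp add: powr_diff)
    ultimately show ?thesis by (simp add: x_def ex(7,8) powr_mult mult_ac)
  qed
  \<comment> \<open>The area m of the cap is enlarged to r^2, giving the multiplied-out form that
    the boxes use.\<close>
  also have "\<dots> \<le> (r\<^sup>2) powr p * (A2 powr (1 / \<sigma>)) * ((R * b1) * b2 powr (p / p0 - 1))"
    using m apos A2le Rle p ex(1) by (intro mult_mono powr_mono2 mult_right_mono mult_nonneg_nonneg) auto
  also have "\<dots> = (r\<^sup>2) powr p * (A2 powr (1 / \<sigma>)) * (R * (b1 * b2 powr (p / p0 - 1)))"
    by (simp add: mult_ac)
  also have "\<dots> \<le> (r\<^sup>2) powr p * (A2 powr (1 / \<sigma>)) * (R * A)"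
    using Ale R(2) by (intro mult_left_mono) auto
  also have "\<dots> = (A * R * A2 powr (p * (p0 - 1) / p0)) * (r\<^sup>2) powr p"
    unfolding ex(9) by (simp add: mult_ac)
  finally show ?thesis using xy up sp by blast
qed

section \<open>The main estimate\<close>

text \<open>Integrability on compact sets contains measurability there, and countably many compact
  sets exhaust U.\<close>

lemma weight_on_measurable:
  assumes U: "open U" and w: "weight_on U w"
  shows "w \<in> borel_measurable (area_on U)"
proof -
  obtain C :: "nat \<Rightarrow> complex set" where C: "\<And>n. compact (C n)" "\<And>n. C n \<subseteq> U" "\<Union>(range C) = U"
    using open_Union_compact_subsets[OF U] by metis
  show ?thesis
  proof (rule measurable_piecewise_restrict2[where A = C])
    show "C n \<in> sets (area_on U)" for n
      using C(1,2)[of n] U by (auto simp: sets_restrict_space_iff compact_imp_closed intro!: borel_closed)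
    show "space (area_on U) = (\<Union>n. C n)" using C(3) by simp
    fix n
    have "set_integrable area (C n) w" using w C(1,2)[of n] by (simp add: weight_on_def)
    then have "(\<lambda>z. indicator (C n) z *\<^sub>R w z) \<in> borel_measurable area"
      unfolding set_integrable_def by auto
    then have "(\<lambda>z. indicator (C n) z *\<^sub>R w z) \<in> borel_measurable (area_on U)"
      by (rule measurable_restrict_space1)
    then show "\<exists>h\<in>borel_measurable (area_on U). \<forall>z\<in>C n. w z = h z"
      by (intro bexI[of _ "\<lambda>z. indicator (C n) z *\<^sub>R w z"]) auto
  qed
qed

lemma epowr_mono: "x \<le> y \<Longrightarrow> a > 0 \<Longrightarrow> x epowr a \<le> y epowr a"
  by (auto simp: epowr_def top_unique less_top[symmetric] intro!: ennreal_leI powr_mono2 enn2real_mono)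

lemma epowr_cmult:
  assumes "c > 0" shows "(ennreal c * x) epowr a = ennreal (c powr a) * x epowr a"
proof (cases x)
  case top
  then show ?thesis using assms by (simp add: epowr_def ennreal_mult_top)
next
  case (real r)
  then have "ennreal c * x = ennreal (c * r)" using assms by (simp add: ennreal_mult')
  then have "(ennreal c * x) epowr a = ennreal ((c * r) powr a)"
    using real assms by (simp only: ennreal_epowr mult_nonneg_nonneg less_imp_le)
  then show ?thesis using real by (simp add: ennreal_epowr powr_mult ennreal_mult')
qed

text \<open>A box of level k sits in a cap of radius r = 8 * 2^-k, and r^2 = 64 * 4^-k is the origin
  of \<open>64 powr p\<close>.\<close>

lemma weight_pair_product:
  fixes p0 p :: real
  assumes p0: "1 < p0" "p0 < p" "p < conj_exp p0"
    and w: "w \<in> borel_measurable dA" "\<And>z. z \<in> \<bbbD> \<Longrightarrow> w z > 0"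
    and v: "v \<in> borel_measurable dA" "\<And>z. z \<in> \<bbbD> \<Longrightarrow> v z > 0"
    and A2: "Ap_const 2 w = ennreal A2" "A2 \<ge> 0"
    and A: "Ap_const (p / p0) v = ennreal A" "A \<ge> 0"
    and R: "RH_const (conj_exp (conj_exp p0 / p)) v = ennreal R" "R \<ge> 0"
  defines "u \<equiv> \<lambda>z. w z powr (p * (p0 - 1) / p0) * v z"
  shows "weight_pair p (p / (p - 1)) u (\<lambda>z. u z powr (- 1 / (p - 1)))
    (64 powr p * (A * R * A2 powr (p * (p0 - 1) / p0)))"
proof
  let ?q = "p / (p - 1)" and ?s = "\<lambda>z. u z powr (- 1 / (p - 1))"
  let ?Y = "A * R * A2 powr (p * (p0 - 1) / p0)"
  have cap: "\<exists>x y. (\<integral>\<^sup>+z\<in>ball \<zeta> r \<inter> \<bbbD>. ennreal (u z) \<partial>area) \<le> ennreal x \<and> x > 0 \<and>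
    (\<integral>\<^sup>+z\<in>ball \<zeta> r \<inter> \<bbbD>. ennreal (?s z) \<partial>area) \<le> ennreal y \<and> y > 0 \<and>
    x * y powr (p - 1) \<le> ?Y * (r\<^sup>2) powr p" if "\<zeta> \<in> sphere 0 1" "r > 0" for \<zeta> and r :: real
    unfolding u_def by (rule product_weight_cap[OF p0 w v A2 A R that])
  have p: "p > 1" using p0 by simp
  show "p > 1" "?q > 1" "1 / p + 1 / ?q = 1" using p by (auto simp: field_simps)
  have one: "(1::complex) \<in> sphere 0 1" by simp
  \<comment> \<open>The cap of radius 3 is the whole disc. It gives integrability of both weights
    over the disc and shows that the constant is positive.\<close>
  obtain x y where xy: "(\<integral>\<^sup>+z\<in>ball 1 3 \<inter> \<bbbD>. ennreal (u z) \<partial>area) \<le> ennreal x" "x > 0"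
    "(\<integral>\<^sup>+z\<in>ball 1 3 \<inter> \<bbbD>. ennreal (?s z) \<partial>area) \<le> ennreal y" "y > 0"
    "x * y powr (p - 1) \<le> ?Y * (3\<^sup>2) powr p"
    using cap[OF one, of 3] by auto
  have "0 < x * y powr (p - 1)" using xy by simp
  then have "0 < ?Y * (3\<^sup>2) powr p" using xy(5) by linarith
  then have Y: "?Y > 0" by (simp add: zero_less_mult_iff)
  then show "64 powr p * ?Y > 0" by simp
  show um: "u \<in> borel_measurable dA" unfolding u_def
    using w(1) v(1) by (intro borel_measurable_times powr_real_measurable borel_measurable_const)
  then show "?s \<in> borel_measurable dA"
    by (intro powr_real_measurable borel_measurable_const)
  show up: "u z > 0" if "z \<in> \<bbbD>" for z using w(2)[OF that] v(2)[OF that] by (simp add: u_def)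
  then show "?s z > 0" if "z \<in> \<bbbD>" for z using up[OF that] by simp
  show "u z powr (1 / p) * ?s z powr (1 / ?q) = 1" if "z \<in> \<bbbD>" for z
    using up[OF that] p by (simp add: powr_powr powr_add[symmetric])
  have disc: "ball 1 3 \<inter> \<bbbD> = \<bbbD>"
  proof -
    have "cmod (1 - z) < 3" if "cmod z < 1" for z
      using norm_triangle_ineq4[of 1 z] that by simp
    then show ?thesis by (auto simp: dist_norm)
  qed
  have "(\<integral>\<^sup>+z. ennreal (u z) \<partial>dA) \<le> ennreal x" "(\<integral>\<^sup>+z. ennreal (?s z) \<partial>dA) \<le> ennreal y"
    using xy(1,3) unfolding disc by (simp_all add: nn_integral_set_area_on)
  then show "(\<integral>\<^sup>+z. ennreal (u z) \<partial>dA) < top" "(\<integral>\<^sup>+z. ennreal (?s z) \<partial>dA) < top"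
    using ennreal_less_top order_le_less_trans by blast+
  fix \<alpha> k j
  define \<zeta> where "\<zeta> = cis (2 * pi * (real j / 2 ^ k + \<alpha>))"
  define r :: real where "r = 8 * (1/2) ^ k"
  let ?Q = "carleson_box \<alpha> k j"
  have Q: "?Q \<subseteq> ball \<zeta> r \<inter> \<bbbD>"
    using carleson_box_subset_ball[of \<alpha> k j] carleson_box_subset[of \<alpha> k j] by (auto simp: \<zeta>_def r_def)
  have \<zeta>: "\<zeta> \<in> sphere 0 1" and r: "r > 0" by (simp_all add: \<zeta>_def r_def)
  obtain x y where xy: "(\<integral>\<^sup>+z\<in>ball \<zeta> r \<inter> \<bbbD>. ennreal (u z) \<partial>area) \<le> ennreal x" "x > 0"
    "(\<integral>\<^sup>+z\<in>ball \<zeta> r \<inter> \<bbbD>. ennreal (?s z) \<partial>area) \<le> ennreal y" "y > 0"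
    "x * y powr (p - 1) \<le> ?Y * (r\<^sup>2) powr p"
    using cap[OF \<zeta> r] by auto
  have mass_le: "mass h ?Q \<le> c" if "(\<integral>\<^sup>+z\<in>ball \<zeta> r \<inter> \<bbbD>. ennreal (h z) \<partial>area) \<le> ennreal c" "c > 0" for h c
  proof -
    have "(\<integral>\<^sup>+z. ennreal (h z) * indicator ?Q z \<partial>dA) \<le> (\<integral>\<^sup>+z\<in>ball \<zeta> r \<inter> \<bbbD>. ennreal (h z) \<partial>area)"
      using Q by (subst nn_integral_restrict_space) (auto intro!: nn_integral_mono simp: indicator_def)
    then show ?thesis unfolding mass_def using that by (intro enn2real_leI) auto
  qed
  have "mass u ?Q * mass ?s ?Q powr (p - 1) \<le> x * y powr (p - 1)"
    using mass_le[OF xy(1,2)] mass_le[OF xy(3,4)] p xy by (intro mult_mono powr_mono2) auto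
  also have "\<dots> \<le> ?Y * (r\<^sup>2) powr p" by (rule xy(5))
  also have "r\<^sup>2 = 64 * (1/4) ^ k"
    by (simp add: r_def power_mult_distrib power_even_eq[symmetric] power2_eq_square flip: power_mult_distrib)
  also have "?Y * (64 * (1/4) ^ k) powr p = 64 powr p * ?Y * ((1/4) ^ k) powr p"
    by (simp only: powr_mult mult_ac)
  finally show "mass u ?Q * mass ?s ?Q powr (p - 1) \<le> 64 powr p * ?Y * ((1/4) ^ k) powr p" .
qed

text \<open>At P = p0' its factors bound those of \<open>sparse_const\<close> and the power of 64
  that comes from the caps, for all p between p0 and p0'.\<close>

definition bergman_const :: "real \<Rightarrow> real" where
  "bergman_const P = 32 * (4 powr (2 * P) * (2 powr P * (P - 1)) * (2 powr P * (P - 1))) * 64 powr (P * (P - 1))"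

text \<open>Conjugation maps the interval (p0, p0') to itself, so p and q are both below P = p0',
  and 1/(p-1), 1/(q-1) and m are at most P - 1.\<close>

lemma bergman_const_bound:
  fixes p0 p Y :: real
  assumes p0: "1 < p0" "p0 < 2" "p0 < p" "p < conj_exp p0" and Y: "Y \<ge> 0"
  defines "m \<equiv> max 1 (1 / (p - 1))"
  shows "32 * sparse_const p (p / (p - 1)) * (64 powr p * Y) powr m
    \<le> bergman_const (conj_exp p0) * Y powr m"
proof -
  define P where "P = conj_exp p0"
  define q where "q = p / (p - 1)"
  define B where "B = 2 powr P * (P - 1)"
  have p: "p > 1" using p0 by simp
  have P1: "P - 1 = 1 / (p0 - 1)" using p0 by (simp add: P_def conj_exp_def field_simps)
  have P2: "P > 2" using p0 by (simp add: P_def conj_exp_def pos_less_divide_eq)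
  have pP: "p < P" using p0 by (simp add: P_def)
  have q1: "q > 1" using p by (simp add: q_def)
  have q_eq: "q = 1 + 1 / (p - 1)" using p by (simp add: q_def field_simps)
  have "1 / (p - 1) < 1 / (p0 - 1)" using p0 by (intro divide_strict_left_mono) auto
  then have qP: "q < P" using q_eq P1 by simp
  have ip: "1 / (p - 1) \<le> P - 1" unfolding P1 using p0 by (intro divide_left_mono) auto
  have iq: "1 / (q - 1) \<le> P - 1"
    using pP by (simp add: q_eq)
  have "1 * 1 \<le> 2 powr P * (P - 1)" using P2 by (intro mult_mono ge_one_powr_ge_zero) auto
  then have B1: "B \<ge> 1" by (simp add: B_def)
  \<comment> \<open>As B \<ge> 1, taking the a-th root cannot enlarge it, so one bound serves both
    exponents.\<close>
  have root: "(2 powr a / (a - 1)) powr (1 / a) \<le> B" if a: "a > 1" "a < P" "1 / (a - 1) \<le> P - 1" for a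
  proof -
    have "2 powr a * (1 / (a - 1)) \<le> 2 powr P * (P - 1)" using a by (intro mult_mono) auto
    then have "2 powr a / (a - 1) \<le> B" by (simp add: B_def)
    then have "(2 powr a / (a - 1)) powr (1 / a) \<le> B powr (1 / a)" using a by (intro powr_mono2) auto
    also have "\<dots> \<le> B powr 1" using a B1 by (intro powr_mono) auto
    finally show ?thesis using B1 by simp
  qed
  have sc: "sparse_const p q \<le> 4 powr (2 * P) * B * B"
    unfolding sparse_const_def
    using root[OF p pP ip] root[OF q1 qP iq] pP qP B1 by (intro mult_mono powr_mono) auto
  have m: "0 < m" "m \<le> P - 1" using ip P2 by (auto simp: m_def)
  have "(64 powr p * Y) powr m = 64 powr (p * m) * Y powr m" by (simp add: powr_mult powr_powr)
  also have "\<dots> \<le> 64 powr (P * (P - 1)) * Y powr m"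
    using p pP m P2 by (intro mult_right_mono powr_mono mult_mono) auto
  finally have pw: "(64 powr p * Y) powr m \<le> 64 powr (P * (P - 1)) * Y powr m" .
  have "32 * sparse_const p q * (64 powr p * Y) powr m
    \<le> 32 * (4 powr (2 * P) * B * B) * (64 powr (P * (P - 1)) * Y powr m)"
    using sc pw B1 by (intro mult_mono) (auto simp: sparse_const_def)
  then show ?thesis by (simp add: bergman_const_def B_def P_def q_def mult_ac)
qed

text \<open>For f in L^2 the projection is the transplanted disc operator, whose modulus lies below
  the positive operator; transplantation preserves the weighted norms, and the p-th root is taken at
  the end.\<close>

lemma (in biholomorphic_disc) bergman_bound_weight_pair:
  assumes pair: "weight_pair p q u s X" and w: "w \<in> borel_measurable (area_on \<Omega>)"
    and u_eq: "AE z in dA. cmod (deriv \<phi> z) powr (2 - p) * w (\<phi> z) = u z"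
    and K: "32 * sparse_const p q * X powr max 1 (1 / (p - 1)) \<le> K"
  shows "bergman_bound \<Omega> p w (ennreal K)"
  unfolding bergman_bound_def
proof
  interpret weight_pair p q u s X by (rule pair)
  let ?K = "32 * sparse_const p q * X powr max 1 (1 / (p - 1))"
  have Kpos: "?K > 0" using p q X by (simp add: sparse_const_def)
  fix f assume f: "f \<in> L2_space \<Omega> \<inter> Lp_space \<Omega> p w"
  then have fm: "f \<in> borel_measurable (area_on \<Omega>)" by (simp add: Lp_space_def measurable_area_on)
  have F: "disc_L2 (pull f)" using L2_space_iff[OF fm] f by blast
  note Fi = disc_L2_integrable[OF F]
  let ?g = "push (disc_proj (pull f))"
  have gm: "?g \<in> borel_measurable (area_on \<Omega>)"
    by (rule holomorphic_measurable[OF push_holomorphic[OF disc_proj_holomorphic[OF Fi]]])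
  have norm_eq: "(\<integral>\<^sup>+x. ennreal (cmod (h x) powr p * w x) \<partial>area_on \<Omega>)
      = (\<integral>\<^sup>+z. ennreal (cmod (pull h z) powr p * u z) \<partial>dA)"
    if "h \<in> borel_measurable (area_on \<Omega>)" for h
  proof -
    have "AE z in dA. ennreal (cmod (pull h z) powr p * (cmod (deriv \<phi> z) powr (2 - p) * w (\<phi> z)))
        = ennreal (cmod (pull h z) powr p * u z)"
      using u_eq by eventually_elim simp
    then show ?thesis unfolding nn_integral_pull[OF that w] by (rule nn_integral_cong_AE)
  qed
  have "(\<integral>\<^sup>+x. ennreal (cmod (?g x) powr p * w x) \<partial>area_on \<Omega>)
      = (\<integral>\<^sup>+z. ennreal (cmod (disc_proj (pull f) z) powr p * u z) \<partial>dA)"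
    unfolding norm_eq[OF gm] by (intro nn_integral_cong) (simp only: space_area_on pull_push)
  also have "\<dots> \<le> ennreal (?K powr p) * (\<integral>\<^sup>+z. ennreal (cmod (pull f z) powr p * u z) \<partial>dA)"
  proof (rule positive_operator_bound)
    show "(\<lambda>z. cmod (pull f z)) \<in> borel_measurable dA"
      by (rule measurable_compose[OF pull_measurable[OF fm] borel_measurable_norm])
    show "(\<lambda>z. cmod (disc_proj (pull f) z)) \<in> borel_measurable dA"
      by (rule measurable_compose[OF disc_proj_measurable[OF Fi] borel_measurable_norm])
  qed (use disc_proj_norm_le in auto)
  also have "\<dots> = ennreal (?K powr p) * (\<integral>\<^sup>+x. ennreal (cmod (f x) powr p * w x) \<partial>area_on \<Omega>)"
    by (simp only: norm_eq[OF fm])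
  finally have "Lp_norm \<Omega> p w ?g \<le> (ennreal (?K powr p) * (\<integral>\<^sup>+x. ennreal (cmod (f x) powr p * w x) \<partial>area_on \<Omega>)) epowr (1 / p)"
    unfolding Lp_norm_def nn_integral_set_area_on[OF open_\<Omega>] using p by (intro epowr_mono) auto
  also have "\<dots> = ennreal ((?K powr p) powr (1 / p)) * Lp_norm \<Omega> p w f"
    unfolding Lp_norm_def nn_integral_set_area_on[OF open_\<Omega>] using Kpos by (intro epowr_cmult) auto
  also have "(?K powr p) powr (1 / p) = ?K" using Kpos p by (simp add: powr_powr)
  also have "ennreal ?K * Lp_norm \<Omega> p w f \<le> ennreal K * Lp_norm \<Omega> p w f"
    using K by (intro mult_right_mono ennreal_leI) auto
  finally show "Lp_norm \<Omega> p w (bergman_proj \<Omega> f) \<le> ennreal K * Lp_norm \<Omega> p w f"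
    using bergman_proj_eq_push f by simp
qed

theorem theorem2p2:
  fixes p0 :: real
  assumes "1 < p0" and "p0 < 2"
  shows "\<exists>C::real. C > 0 \<and>
    (\<forall>(\<Omega>::complex set) (\<phi>::complex \<Rightarrow> complex) (p::real) (\<omega>::complex \<Rightarrow> real).
       open \<Omega> \<and> \<Omega> \<noteq> {} \<and> simply_connected \<Omega> \<and> \<Omega> \<noteq> UNIV \<and>
       biholomorphic \<phi> \<bbbD> \<Omega> \<and>
       (\<forall>q. p0 < q \<and> q < conj_exp p0 \<longrightarrow> deriv_weight p0 \<phi> q \<in> Ap_plus 2) \<and>
       p0 < p \<and> p < conj_exp p0 \<and>
       weight_on \<Omega> \<omega> \<and>
       \<omega> \<circ> \<phi> \<in> Ap_plus (p / p0) \<inter> RH (conj_exp (conj_exp p0 / p))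
       \<longrightarrow>
       bergman_bounded \<Omega> p \<omega> \<and>
       bergman_opnorm \<Omega> p \<omega> \<le>
         ennreal (C * max p (1 / (p - 1))) *
         (Ap_const (p / p0) (\<omega> \<circ> \<phi>) *
          RH_const (conj_exp (conj_exp p0 / p)) (\<omega> \<circ> \<phi>) *
          Ap_const 2 (deriv_weight p0 \<phi> p) epowr (p * (p0 - 1) / p0))
         epowr max 1 (1 / (p - 1)))"
proof (intro exI[of _ "bergman_const (conj_exp p0)"] conjI allI impI)
  have "conj_exp p0 > 2" using assms by (simp add: conj_exp_def pos_less_divide_eq)
  then show Cpos: "bergman_const (conj_exp p0) > 0" by (simp add: bergman_const_def)
  fix \<Omega> \<phi> and p :: real and \<omega>
  let ?S = "conj_exp (conj_exp p0 / p)" and ?w = "deriv_weight p0 \<phi> p" and ?e = "p * (p0 - 1) / p0"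
  let ?m = "max 1 (1 / (p - 1))"
  let ?RHS = "ennreal (bergman_const (conj_exp p0) * max p (1 / (p - 1))) *
         (Ap_const (p / p0) (\<omega> \<circ> \<phi>) * RH_const ?S (\<omega> \<circ> \<phi>) * Ap_const 2 ?w epowr ?e) epowr ?m"
  assume H: "open \<Omega> \<and> \<Omega> \<noteq> {} \<and> simply_connected \<Omega> \<and> \<Omega> \<noteq> UNIV \<and>
       biholomorphic \<phi> \<bbbD> \<Omega> \<and>
       (\<forall>q. p0 < q \<and> q < conj_exp p0 \<longrightarrow> deriv_weight p0 \<phi> q \<in> Ap_plus 2) \<and>
       p0 < p \<and> p < conj_exp p0 \<and>
       weight_on \<Omega> \<omega> \<and>
       \<omega> \<circ> \<phi> \<in> Ap_plus (p / p0) \<inter> RH ?S"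
  then have p: "p0 < p" "p < conj_exp p0" and p1: "p > 1" using assms by auto
  have bi: "biholomorphic \<phi> \<bbbD> \<Omega>" using H by blast
  then obtain \<psi> where \<psi>: "\<psi> holomorphic_on \<Omega>" "\<forall>z\<in>\<bbbD>. \<psi> (\<phi> z) = z"
    unfolding biholomorphic_def by blast
  interpret biholomorphic_disc \<Omega> \<phi> \<psi>
    using H bi \<psi> by unfold_locales (auto simp: biholomorphic_def)
  \<comment> \<open>\<open>weight_pair\<close> asks for positivity at every point; v differs from
    \<omega> o \<phi> on a null set only.\<close>
  define v where "v z = (if 0 < \<omega> (\<phi> z) then \<omega> (\<phi> z) else 1)" for z
  have weight: "weight_on \<bbbD> (\<omega> \<circ> \<phi>)" using H by (simp add: Ap_plus_def)
  have AE_v: "AE z in area. z \<in> \<bbbD> \<longrightarrow> (\<omega> \<circ> \<phi>) z = v z"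
  proof -
    have "AE z in area. z \<in> \<bbbD> \<longrightarrow> 0 < (\<omega> \<circ> \<phi>) z" using weight by (simp add: weight_on_def)
    then show ?thesis by eventually_elim (auto simp: v_def)
  qed
  have v_meas: "v \<in> borel_measurable dA"
    using weight_on_measurable[OF open_ball weight] unfolding v_def comp_def by measurable
  have w_meas: "?w \<in> borel_measurable dA"
  proof -
    have "(\<lambda>z. cmod (deriv \<phi> z)) \<in> borel_measurable dA"
      using hol_\<phi> by (intro continuous_on_area_on continuous_intros holomorphic_on_imp_continuous_on holomorphic_deriv) auto
    then show ?thesis unfolding deriv_weight_def by (intro powr_real_measurable borel_measurable_const)
  qed
  have "Ap_const 2 ?w < top" "Ap_const (p / p0) (\<omega> \<circ> \<phi>) < top" "RH_const ?S (\<omega> \<circ> \<phi>) < top"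
    using H by (auto simp: Ap_plus_def RH_def)
  then obtain A2 A R where A2: "Ap_const 2 ?w = ennreal A2" "A2 \<ge> 0"
    and A: "Ap_const (p / p0) (\<omega> \<circ> \<phi>) = ennreal A" "A \<ge> 0"
    and R: "RH_const ?S (\<omega> \<circ> \<phi>) = ennreal R" "R \<ge> 0"
    by (cases "Ap_const 2 ?w"; cases "Ap_const (p / p0) (\<omega> \<circ> \<phi>)"; cases "RH_const ?S (\<omega> \<circ> \<phi>)") auto
  define u where "u z = ?w z powr ?e * v z" for z
  define Y where "Y = A * R * A2 powr ?e"
  have Y: "Y \<ge> 0" using A R by (simp add: Y_def)
  have pair: "weight_pair p (p / (p - 1)) u (\<lambda>z. u z powr (- 1 / (p - 1))) (64 powr p * Y)"
    unfolding u_def Y_def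
  proof (rule weight_pair_product[OF assms(1) p w_meas _ v_meas _ A2])
    show "?w z > 0" if "z \<in> \<bbbD>" for z using deriv_nonzero[OF that] by (simp add: deriv_weight_def)
    show "v z > 0" for z by (simp add: v_def)
    show "Ap_const (p / p0) v = ennreal A" using A(1) Ap_const_cong_AE[OF AE_v] by simp
    show "RH_const ?S v = ennreal R" using R(1) RH_const_cong_AE[OF AE_v] by simp
  qed (use A R in auto)
  \<comment> \<open>The exponent in \<open>deriv_weight\<close> is (2 - p) times the reciprocal of
    \<open>?e\<close>.\<close>
  have we: "?w z powr ?e = cmod (deriv \<phi> z) powr (2 - p)" for z
    using assms(1) p1 by (simp add: deriv_weight_def powr_powr)
  have u_eq: "AE z in dA. cmod (deriv \<phi> z) powr (2 - p) * \<omega> (\<phi> z) = u z"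
  proof -
    have "AE z in dA. (\<omega> \<circ> \<phi>) z = v z" using AE_v by (subst AE_restrict_space_iff) auto
    then show ?thesis by eventually_elim (simp only: u_def we comp_def)
  qed
  define K where "K = bergman_const (conj_exp p0) * max p (1 / (p - 1)) * Y powr ?m"
  have "32 * sparse_const p (p / (p - 1)) * (64 powr p * Y) powr ?m \<le> bergman_const (conj_exp p0) * Y powr ?m"
    by (rule bergman_const_bound[OF assms p Y])
  \<comment> \<open>Since p > 1, the factor \<open>max p (1 / (p - 1))\<close> is at least
    1.\<close>
  also have "\<dots> \<le> bergman_const (conj_exp p0) * Y powr ?m * max p (1 / (p - 1))"
    using mult_left_mono[of 1 "max p (1 / (p - 1))" "bergman_const (conj_exp p0) * Y powr ?m"] Cpos p1 by simp
  finally have "32 * sparse_const p (p / (p - 1)) * (64 powr p * Y) powr ?m \<le> K"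
    by (simp only: K_def mult_ac)
  then have bound: "bergman_bound \<Omega> p \<omega> (ennreal K)"
    using H by (intro bergman_bound_weight_pair[OF pair weight_on_measurable u_eq]) auto
  have "Ap_const (p / p0) (\<omega> \<circ> \<phi>) * RH_const ?S (\<omega> \<circ> \<phi>) * Ap_const 2 ?w epowr ?e = ennreal Y"
    using A R A2 by (simp add: Y_def ennreal_epowr ennreal_mult')
  then have RHS: "?RHS = ennreal K"
    using Y Cpos p1 by (simp add: K_def ennreal_epowr ennreal_mult')
  show "bergman_bounded \<Omega> p \<omega>"
    using bound ennreal_less_top unfolding bergman_bounded_def by blast
  show "bergman_opnorm \<Omega> p \<omega> \<le> ?RHS"
    unfolding RHS bergman_opnorm_def using bound by (intro Inf_lower) simp
qed

end
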